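(* Suppose that $(X,Y),(X_i,Y_i)_{i\ge 1}$ are independent and identically distributed with common distribution $P$ on $\mathbb R^d\times S$ and that $X$ has density $f_X$ with respect to Lebesgue measure $\lambda$ on $\mathbb R^d$. Let $S_X$ be the support of $X$. Suppose that there are $c>0$ and $T>0$ such that $$\lambda(S_X\cap B(x,\tau))\ge c\,\lambda(B(x,\tau)),\qquad\forall\tau\in(0,T],\ \forall x\in S_X,$$ and that there are $0<b_X\le U_X<+\infty$ such that $b_X\le f_X(x)\le U_X$ for all $x\in S_X$. Suppose that the class $\mathcal G$ of functions on $(S,\mathcal S)$ is VC with parameter $(v,A)$ and constant envelope $1$. Let $\kappa_X=U_X/(cb_X)$ and $\sigma_{\mathcal G}^2=\sup_{g\in\mathcal G,\,x\in S_X}\operatorname{Var}_{\mu_x}(g)$. Then, for all $n\ge1$, $\delta\in(0,1)$ and $1\le k\le n$ such that $$8d\log(24n/\delta)\le k\le n\left\{\left(\frac{2}{\sigma_{\mathcal G}^2\kappa_X}\right)\wedge\left(T^db_XcV_d/2\right)\right\},$$ it holds, with probability at least $1-\delta$, $$\sup_{g\in\mathcal G,\,x\in S_X}\left|k^{-1}\sum_{i\in N_{n,k}(x)}(g(Y_i)-\mu_{X_i}(g))\right|\le 2K_1\sqrt{\frac{(d+1+v)\sigma_{\mathcal G}^2\kappa_X}{k}\log\left(52e^2\frac{An}{\sigma_{\mathcal G}\delta}\right)}+4K_2\frac{(d+1+v)}{k}\log\left(52e^2\frac{An}{\sigma_{\mathcal G}\delta}\right),$$ where $K_1=5C$, $K_2=64C^2$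 and $C=9$.
   Context: $(S,\mathcal S)$ is a measurable space. $\mathbb R^d$ carries the Euclidean norm $\|\cdot\|$, $B(x,\tau)=\{z:\|x-z\|\le\tau\}$, and $V_d=\lambda(B(0,1))$. $P_X$ is the law of $X$. $\mu_x$ denotes the regular conditional distribution of $Y$ given $X=x$ (assumed to exist): $\mu_x$ is a probability measure on $(S,\mathcal S)$ for $P_X$-almost every $x$, $x\mapsto\mu_x(A)$ is measurable for each $A\in\mathcal S$, and $\mathbb P(Y\in A,X\in B)=\int_B\mu_x(A)f_X(x)\,dx$ for all $A\in\mathcal S$ and Borel $B$. For a probability measure $\mu$, $\mu(g)=\int g\,d\mu$ and $\operatorname{Var}_\mu(g)=\mu(g^2)-\mu(g)^2$. $N_{n,k}(x)$ is the index set of the $k$ nearest neighbors of $x$ among $X_1,\dots,X_n$ (ties broken by lexicographic order). The covering number $\mathcal N(\mathcal G,L_2(Q),\epsilon)$ is the smallest number of closed $L_2(Q)$-balls of radius $\epsilon>0$ needed to cover $\mathcal G$. A class $\mathcal G$ of real-valued functions on $(S,\mathcal S)$ that is pointwise measurable (there is a countable subclass $\mathcal G_0\subset\mathcal G$ such that every $g\in\mathcal G$ is the pointwise limit of a sequence in $\mathcal G_0$) is VC with parameters $(v,A)\in(0,\infty)\times[1,\infty)$ and envelope $G$ (a function with $|g|\le G$ for all $g\in\mathcal G$) if for any $0<\epsilon<1$ and any probability measure $Q$ on $(S,\mathcal S)$, $\mathcal N(\mathcal G,L_2(Q),\epsilon\|G\|_{L_2(Q)})\le(A/\epsilon)^v$.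 It is implicit that $\sigma_{\mathcal G}>0$, since it appears in denominators. *)

theory Defs
  imports "HOL-Probability.Probability"
begin

definition measure_support :: "'a::topological_space measure \<Rightarrow> 'a set" where
  "measure_support P = {x. \<forall>U. open U \<longrightarrow> x \<in> U \<longrightarrow> emeasure P U > 0}"

definition lex_less :: "real ^ ('d::{finite,linorder}) \<Rightarrow> real ^ ('d::{finite,linorder}) \<Rightarrow> bool" where
  "lex_less a b \<longleftrightarrow> (\<exists>i. a $ i < b $ i \<and> (\<forall>j<i. a $ j = b $ j))"

(* Point i is ranked before point j as a neighbour of x. Equidistant points are compared
   lexicographically; the index is only used for coinciding points. *)
definition nearer :: "(nat \<Rightarrow> real ^ ('d::{finite,linorder})) \<Rightarrow> real ^ ('d::{finite,linorder}) \<Rightarrow> nat \<Rightarrow> nat \<Rightarrow> bool" where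
  "nearer p x i j \<longleftrightarrow>
     dist x (p i) < dist x (p j) \<or>
     dist x (p i) = dist x (p j) \<and> (lex_less (p i) (p j) \<or> p i = p j \<and> i < j)"

definition nn_indices ::
    "(nat \<Rightarrow> real ^ ('d::{finite,linorder})) \<Rightarrow> nat \<Rightarrow> nat \<Rightarrow> real ^ ('d::{finite,linorder}) \<Rightarrow> nat set" where
  "nn_indices p n k x = {i \<in> {1..n}. card {j \<in> {1..n}. nearer p x j i} < k}"

(* Regular conditional distribution of Y given X, where X has Lebesgue density f.
   Only almost every mu x has to be a probability measure on S. *)
definition regular_cond_distr ::
    "'w measure \<Rightarrow> 's measure \<Rightarrow> ('w \<Rightarrow> 'x::euclidean_space) \<Rightarrow> ('w \<Rightarrow> 's)
      \<Rightarrow> ('x::euclidean_space \<Rightarrow> real) \<Rightarrow> ('x::euclidean_space \<Rightarrow> 's measure) \<Rightarrow> bool" where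
  "regular_cond_distr M S X Y f \<mu> \<longleftrightarrow>
     (AE x in distr M borel X. prob_space (\<mu> x) \<and> sets (\<mu> x) = sets S) \<and>
     (\<forall>A\<in>sets S. (\<lambda>x. emeasure (\<mu> x) A) \<in> borel_measurable borel) \<and>
     (\<forall>A\<in>sets S. \<forall>B\<in>sets borel.
        emeasure M {\<omega> \<in> space M. Y \<omega> \<in> A \<and> X \<omega> \<in> B} =
        (\<integral>\<^sup>+x\<in>B. (emeasure (\<mu> x) A * ennreal (f x)) \<partial>lborel))"

definition var_of :: "'s measure \<Rightarrow> ('s \<Rightarrow> real) \<Rightarrow> real" where
  "var_of \<nu> g = (\<integral>y. (g y)\<^sup>2 \<partial>\<nu>) - (\<integral>y. g y \<partial>\<nu>)\<^sup>2"

(* The variance is only meaningful for a probability measure, so the supremum skips the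
   exceptional (null) set of points x at which mu x is not a probability measure on S. *)
definition sup_cond_var ::
    "'s measure \<Rightarrow> ('s \<Rightarrow> real) set \<Rightarrow> 'x set \<Rightarrow> ('x \<Rightarrow> 's measure) \<Rightarrow> real" where
  "sup_cond_var S \<G> D \<mu> =
     (SUP (g, x) \<in> \<G> \<times> {x \<in> D. prob_space (\<mu> x) \<and> sets (\<mu> x) = sets S}. var_of (\<mu> x) g)"

definition L2_functions :: "'s measure \<Rightarrow> ('s \<Rightarrow> real) set" where
  "L2_functions Q = {h \<in> borel_measurable Q. integrable Q (\<lambda>y. (h y)\<^sup>2)}"

definition L2_norm :: "'s measure \<Rightarrow> ('s \<Rightarrow> real) \<Rightarrow> real" where
  "L2_norm Q h = sqrt (\<integral>y. (h y)\<^sup>2 \<partial>Q)"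

definition L2_cball :: "'s measure \<Rightarrow> ('s \<Rightarrow> real) \<Rightarrow> real \<Rightarrow> ('s \<Rightarrow> real) set" where
  "L2_cball Q c \<epsilon> = {h \<in> L2_functions Q. L2_norm Q (\<lambda>y. h y - c y) \<le> \<epsilon>}"

(* The centres range over the whole of L2(Q), not only over the class;
   the value is infinite if there is no finite cover. *)
definition covering_number :: "('s \<Rightarrow> real) set \<Rightarrow> 's measure \<Rightarrow> real \<Rightarrow> enat" where
  "covering_number \<G> Q \<epsilon> =
     (INF C \<in> {C. finite C \<and> C \<subseteq> L2_functions Q \<and> \<G> \<subseteq> (\<Union>c\<in>C. L2_cball Q c \<epsilon>)}. enat (card C))"

definition pointwise_measurable :: "'s measure \<Rightarrow> ('s \<Rightarrow> real) set \<Rightarrow> bool" where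
  "pointwise_measurable S \<G> \<longleftrightarrow>
     \<G> \<subseteq> borel_measurable S \<and>
     (\<exists>\<G>0\<subseteq>\<G>. countable \<G>0 \<and>
        (\<forall>g\<in>\<G>. \<exists>h. (\<forall>m::nat. h m \<in> \<G>0) \<and> (\<forall>y\<in>space S. (\<lambda>m. h m y) \<longlonglongrightarrow> g y)))"

(* Measures Q with the envelope F outside L2(Q) are left out: the radius would be infinite
   and the entropy bound void, as (A/eps)^v >= 1. *)
definition VC_class ::
    "'s measure \<Rightarrow> ('s \<Rightarrow> real) set \<Rightarrow> real \<Rightarrow> real \<Rightarrow> ('s \<Rightarrow> real) \<Rightarrow> bool" where
  "VC_class S \<G> v A F \<longleftrightarrow>
     0 < v \<and> 1 \<le> A \<and> pointwise_measurable S \<G> \<and>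
     F \<in> borel_measurable S \<and> (\<forall>g\<in>\<G>. \<forall>y\<in>space S. \<bar>g y\<bar> \<le> F y) \<and>
     (\<forall>\<epsilon> Q. 0 < \<epsilon> \<longrightarrow> \<epsilon> < 1 \<longrightarrow> prob_space Q \<longrightarrow> sets Q = sets S \<longrightarrow> F \<in> L2_functions Q \<longrightarrow>
        ereal_of_enat (covering_number \<G> Q (\<epsilon> * L2_norm Q F)) \<le> ereal ((A / \<epsilon>) powr v))"

(* Stated through a measurable subset, as suprema over uncountable families need not give
   measurable events; agrees with prob E >= p for measurable E. *)
definition holds_with_prob_ge :: "'w measure \<Rightarrow> real \<Rightarrow> ('w \<Rightarrow> bool) \<Rightarrow> bool" where
  "holds_with_prob_ge M p E \<longleftrightarrow> (\<exists>F\<in>sets M. p \<le> measure M F \<and> (\<forall>\<omega>\<in>F. E \<omega>))"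

end

theory Submission
  imports Defs
begin

text \<open>Given the covariates, the responses are independent with laws \<open>\<mu> (X i)\<close>, and the neighbour sets
  are determined. As \<open>x\<close> varies, the set of the \<open>k\<close> nearest neighbours depends only on the position of
  \<open>x\<close> relative to the bisecting hyperplanes of the sample, so at most \<open>(1 + 2n\<^sup>2)\<^sup>d\<close> sets occur. For one
  fixed set of indices, symmetrisation with two ghost samples, a covering of the class at scale
  \<open>1/n\<close> with respect to the empirical measure of all three samples, and a self-bounding quadratic
  penalty give a Bernstein-type exponential bound that is uniform over the class. A union bound over
  the neighbour sets finishes the proof.\<close>

section \<open>Neighbour sets and hyperplane arrangements\<close>

text \<open>A classical symmetrisation would leave an empirical variance, itself a supremum over the
  class, to be controlled. Here slot 0 holds the data, slot 1 the ghost used for symmetrising and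
  slot 2 a reference value. The penalty compares slots 1 and 2, so it does not involve the unknown
  mean; its expectation is a multiple of the variance; and swaps leave slot 2 in place, so that
  averaging over swaps reduces to a numerical inequality in two variables. There is no chaining: one
  net costs (2 n^2 A)^v, the neighbour sets cost (1 + 2 n^2)^d, and both bases are at most exp (2
  L), where L is the logarithm in the bound. With 2 e \<le> \<delta> exp (2 L) this explains the
  factor d + 1 + v. The obstacle in the union bound is that there are 2^n candidate sets. The sum
  over them is therefore taken under the integral over the covariates, where only the sets realised
  by the given covariates contribute. Since \<open>\<mu>\<close> consists of probability measures
  only almost everywhere, it is replaced by a kernel that is defined everywhere and has the same
  joint law.\<close>

lemma sgn_convex_combination:
  fixes p q u :: real
  assumes "sgn p = sgn q" "0 \<le> u" "u \<le> 1"
  shows "sgn ((1 - u) * p + u * q) = sgn p"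
proof (cases "p = 0")
  case False
  have "((1 - u) * p + u * q > 0 \<longleftrightarrow> p > 0) \<and> ((1 - u) * p + u * q < 0 \<longleftrightarrow> p < 0)"
  proof (cases "p > 0")
    case True
    then have "q > 0" using assms(1) by (metis sgn_1_pos)
    have "(1 - u) * p + u * q > 0"
      using True \<open>q > 0\<close> assms by (cases "u = 0") (auto intro: add_nonneg_pos)
    then show ?thesis using True by auto
  next
    case f: False
    then have "p < 0" using False by auto
    then have "q < 0" using assms(1) by (metis sgn_1_neg)
    have "(1 - u) * p + u * q < 0"
      using \<open>p < 0\<close> \<open>q < 0\<close> assms
      by (cases "u = 0") (auto intro!: add_nonpos_neg mult_nonneg_nonpos mult_pos_neg)
    then show ?thesis using \<open>p < 0\<close> by auto
  qed
  then show ?thesis by (auto simp: sgn_if)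
qed (use assms in \<open>auto simp: sgn_if split: if_splits\<close>)

text \<open>The value 0 is kept, so that faces of every dimension count and not only open cells;
  points \<open>x\<close> with equidistant sample points lie on such faces. Restriction to
  \<open>J\<close> identifies patterns that agree on \<open>J\<close>.\<close>

definition sign_patterns :: "'j set \<Rightarrow> ('j \<Rightarrow> 'a \<Rightarrow> real) \<Rightarrow> 'a set \<Rightarrow> ('j \<Rightarrow> real) set" where
  "sign_patterns J h W = (\<lambda>x. \<lambda>j\<in>J. sgn (h j x)) ` W"

lemma finite_sign_patterns:
  assumes "finite J"
  shows "finite (sign_patterns J h W)"
proof (rule finite_subset)
  show "sign_patterns J h W \<subseteq> (\<Pi>\<^sub>E j\<in>J. {-1, 0, 1})"
    by (auto simp: sign_patterns_def sgn_if split: if_splits)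
qed (use assms in \<open>auto intro: finite_PiE\<close>)

text \<open>Adding a hyperplane \<open>H\<close> to the arrangement splits only those cells that meet \<open>H\<close>, and these
  correspond to cells of the arrangement induced on the lower-dimensional space \<open>W \<inter> H\<close>.\<close>

lemma card_sign_patterns_affine:
  fixes W :: "'a::euclidean_space set" and a :: "'j \<Rightarrow> 'a" and b :: "'j \<Rightarrow> real"
  assumes "finite J" "affine W" "aff_dim W \<le> int D"
  shows "card (sign_patterns J (\<lambda>j x. a j \<bullet> x - b j) W) \<le> (1 + 2 * card J) ^ D"
  using assms
proof (induction J arbitrary: W D rule: finite_induct)
  case empty
  have "sign_patterns {} (\<lambda>j x. a j \<bullet> x - b j) W \<subseteq> {\<lambda>j. undefined}"
    by (auto simp: sign_patterns_def)
  then have "card (sign_patterns {} (\<lambda>j x. a j \<bullet> x - b j) W) \<le> card {\<lambda>j::'j. undefined :: real}"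
    by (intro card_mono) auto
  then show ?case by simp
next
  case (insert j J)
  define h where "h = (\<lambda>i x. a i \<bullet> x - b i)"
  define H where "H = {x. a j \<bullet> x = b j}"
  define F where "F = (\<lambda>V. sign_patterns J h V)"
  define G where "G = sign_patterns (insert j J) h W"
  define pt where "pt = (\<lambda>x. \<lambda>i\<in>J. sgn (h i x))"
  have finF: "finite (F V)" for V
    unfolding F_def by (rule finite_sign_patterns[OF insert.hyps(1)])
  have Fpt: "F V = pt ` V" for V by (simp add: F_def sign_patterns_def pt_def)
  have pt_insert: "(\<lambda>i\<in>insert j J. sgn (h i x)) = (pt x)(j := sgn (h j x))" for x
    by (auto simp: pt_def fun_eq_iff)
  have hH: "h j x = 0 \<longleftrightarrow> x \<in> H" for x by (auto simp: h_def H_def)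
  have FW: "card (F W) \<le> (1 + 2 * card J) ^ D"
    unfolding F_def h_def using insert.IH[OF insert.prems] .
  have step: "(1 + 2 * card J) ^ D \<le> (1 + 2 * card (insert j J)) ^ D"
    by (rule power_mono) (use insert.hyps in auto)
  show ?case
  proof (cases "W \<subseteq> H")
    case True
    have "G \<subseteq> (\<lambda>f. f(j := 0)) ` F W"
    proof
      fix f assume "f \<in> G"
      then obtain x where x: "x \<in> W" "f = (pt x)(j := sgn (h j x))"
        unfolding G_def sign_patterns_def using pt_insert by auto
      moreover have "h j x = 0" using x True hH by auto
      ultimately show "f \<in> (\<lambda>f. f(j := 0)) ` F W" by (auto simp: Fpt)
    qed
    then have "card G \<le> card (F W)" by (rule surj_card_le[OF finF])
    then show ?thesis using FW step unfolding G_def h_def by linarith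
  next
    case False
    \<comment> \<open>A cell of \<open>W\<close> that misses \<open>H\<close> lies on one side of
      it, so its sign can be read at an arbitrary point. On a cell that meets \<open>H\<close> the
      value 0 is chosen, and the three parts of the cover in \<open>sub\<close> then stand for the
      portion on \<open>H\<close> and the two sides.\<close>
    define s where "s = (\<lambda>f. if f \<in> F (W \<inter> H) then 0 else sgn (h j (SOME x. x \<in> W \<and> pt x = f)))"
    have const: "sgn (h j x) = sgn (h j y)"
      if "x \<in> W" "y \<in> W" "pt x = pt y" "pt x \<notin> F (W \<inter> H)" for x y
    proof (rule ccontr)
      assume ne: "sgn (h j x) \<noteq> sgn (h j y)"
      have "x \<notin> H" "y \<notin> H" using that unfolding Fpt by (metis IntI imageI)+
      then have nz: "h j x \<noteq> 0" "h j y \<noteq> 0" using hH by auto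
      \<comment> \<open>The parameter at which the affine function \<open>h j\<close>, of opposite
        signs at \<open>x\<close> and \<open>y\<close>, vanishes on the segment. The signs indexed
        by \<open>J\<close> agree at both ends, so the crossing point \<open>z\<close> is a point of
        \<open>W\<close> and \<open>H\<close> with the pattern of \<open>x\<close>.\<close>
      define u where "u = h j x / (h j x - h j y)"
      have opp: "h j x > 0 \<and> h j y < 0 \<or> h j x < 0 \<and> h j y > 0"
        using ne nz by (auto simp: sgn_if split: if_splits)
      have u: "0 \<le> u" "u \<le> 1" using opp by (auto simp: u_def divide_simps)
      define z where "z = (1 - u) *\<^sub>R x + u *\<^sub>R y"
      have hz: "h i z = (1 - u) * h i x + u * h i y" for i
        by (simp add: h_def z_def inner_add_right algebra_simps)
      have "h j z = 0" unfolding hz using opp by (auto simp: u_def field_simps)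
      then have "z \<in> H" using hH by auto
      moreover have "z \<in> W" using insert.prems(1) that u unfolding z_def
        by (metis affine_def diff_add_cancel)
      moreover have "pt z = pt x"
      proof
        fix i
        show "pt z i = pt x i"
        proof (cases "i \<in> J")
          case True
          then have "sgn (h i x) = sgn (h i y)" using that(3) by (auto simp: pt_def fun_eq_iff split: if_splits)
          then show ?thesis using sgn_convex_combination[OF _ u] hz True by (simp add: pt_def)
        qed (simp add: pt_def)
      qed
      ultimately have "pt x \<in> F (W \<inter> H)" by (metis Fpt IntI imageI)
      then show False using that by simp
    qed
    have sub: "G \<subseteq> (\<lambda>f. f(j := s f)) ` F W \<union> ((\<lambda>f. f(j := 1)) ` F (W \<inter> H) \<union> (\<lambda>f. f(j := -1)) ` F (W \<inter> H))"
      (is "_ \<subseteq> ?A \<union> (?B \<union> ?C)")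
    proof
      fix f assume "f \<in> G"
      then obtain x where x: "x \<in> W" "f = (pt x)(j := sgn (h j x))"
        unfolding G_def sign_patterns_def using pt_insert by auto
      show "f \<in> ?A \<union> (?B \<union> ?C)"
      proof (cases "pt x \<in> F (W \<inter> H)")
        case True
        have "pt x \<in> F W" using x by (auto simp: Fpt)
        moreover have "s (pt x) = 0" using True by (simp add: s_def)
        ultimately show ?thesis using x True by (cases "h j x" "0::real" rule: linorder_cases) force+
      next
        case f: False
        have "\<exists>y. y \<in> W \<and> pt y = pt x" using x by auto
        then have *: "(SOME y. y \<in> W \<and> pt y = pt x) \<in> W \<and> pt (SOME y. y \<in> W \<and> pt y = pt x) = pt x"
          by (rule someI_ex)
        have "s (pt x) = sgn (h j x)"
          unfolding s_def using f const[of x "SOME y. y \<in> W \<and> pt y = pt x"] * x by simp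
        then have "f = (pt x)(j := s (pt x))" using x by simp
        moreover have "pt x \<in> F W" using x by (auto simp: Fpt)
        ultimately show ?thesis by blast
      qed
    qed
    \<comment> \<open>With m = 1 + 2 card J this is m^D + 2 m^(D-1) = (m + 2) m^(D-1) \<le> (m +
      2)^D. The two additional patterns per cell of the section with \<open>H\<close> are the reason
      why each hyperplane raises the base by 2.\<close>
    have WH: "card (F (W \<inter> H)) * 2 + (1 + 2 * card J) ^ D \<le> (1 + 2 * card (insert j J)) ^ D"
    proof (cases "W \<inter> H = {}")
      case True
      then show ?thesis using step by (simp add: Fpt)
    next
      case ne: False
      have dim: "aff_dim (W \<inter> H) = aff_dim W - 1"
        using aff_dim_affine_Int_hyperplane[OF insert.prems(1), of "a j" "b j"] ne False by (simp add: H_def)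
      moreover have "aff_dim (W \<inter> H) \<ge> 0" using ne aff_dim_geq[of "W \<inter> H"] aff_dim_empty[of "W \<inter> H"] by linarith
      ultimately have D: "D \<ge> 1" "aff_dim (W \<inter> H) \<le> int (D - 1)" using insert.prems(2) by auto
      have "affine (W \<inter> H)" unfolding H_def
        by (intro affine_Int insert.prems affine_hyperplane)
      from insert.IH[OF this D(2)] have "card (F (W \<inter> H)) \<le> (1 + 2 * card J) ^ (D - 1)"
        unfolding F_def h_def .
      moreover have "(1 + 2 * card J) ^ D = (1 + 2 * card J) * (1 + 2 * card J) ^ (D - 1)"
        using D by (cases D) auto
      moreover have "(3 + 2 * card J) * (1 + 2 * card J) ^ (D - 1) \<le> (3 + 2 * card J) * (3 + 2 * card J) ^ (D - 1)"
        by (intro mult_left_mono power_mono) auto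
      moreover have "(3 + 2 * card J) * (3 + 2 * card J) ^ (D - 1) = (1 + 2 * card (insert j J)) ^ D"
      proof -
        have "3 + 2 * card J = 1 + 2 * card (insert j J)" using insert.hyps by simp
        then show ?thesis using D by (metis power_eq_if not_one_le_zero)
      qed
      ultimately show ?thesis by (simp add: algebra_simps)
    qed
    have "card G \<le> card (?A \<union> (?B \<union> ?C))" by (rule card_mono[OF _ sub]) (use finF in auto)
    also have "\<dots> \<le> card ?A + (card ?B + card ?C)"
      by (meson card_Un_le add_left_mono le_trans)
    also have "\<dots> \<le> card (F W) + (card (F (W \<inter> H)) + card (F (W \<inter> H)))"
      by (intro add_mono card_image_le finF)
    finally show ?thesis using FW WH unfolding G_def h_def by linarith
  qed
qed

section \<open>Distance comparisons as a hyperplane arrangement\<close>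

definition distance_pattern :: "(nat \<Rightarrow> 'a::euclidean_space) \<Rightarrow> nat \<Rightarrow> 'a \<Rightarrow> nat \<times> nat \<Rightarrow> real" where
  "distance_pattern p n x = (\<lambda>(i, j)\<in>{1..n} \<times> {1..n}. sgn (dist x (p i) - dist x (p j)))"

lemma distance_pattern_PiE: "distance_pattern p n x \<in> (\<Pi>\<^sub>E ij\<in>{1..n} \<times> {1..n}. {-1, 0, 1})"
  by (auto simp: distance_pattern_def sgn_if split: if_splits)

text \<open>The terms quadratic in \<open>x\<close> cancel in the difference of the squared
  distances, which leaves an affine function. Dividing by the sum of the distances keeps the sign;
  if that sum is 0, both sides vanish.\<close>

lemma sgn_dist_diff:
  fixes x u v :: "'a::euclidean_space"
  shows "sgn (dist x u - dist x v) = sgn ((2 *\<^sub>R (v - u)) \<bullet> x - (v \<bullet> v - u \<bullet> u))"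
proof -
  have "(2 *\<^sub>R (v - u)) \<bullet> x - (v \<bullet> v - u \<bullet> u) = (dist x u)\<^sup>2 - (dist x v)\<^sup>2"
    by (simp add: dist_norm power2_norm_eq_inner inner_diff inner_commute algebra_simps)
  also have "\<dots> = (dist x u - dist x v) * (dist x u + dist x v)"
    by (simp add: power2_eq_square algebra_simps)
  finally have eq: "(2 *\<^sub>R (v - u)) \<bullet> x - (v \<bullet> v - u \<bullet> u) = (dist x u - dist x v) * (dist x u + dist x v)" .
  show ?thesis
  proof (cases "dist x u + dist x v = 0")
    case True
    then have "dist x u = 0" "dist x v = 0" by (auto simp: add_nonneg_eq_0_iff)
    then show ?thesis using eq by simp
  next
    case False
    then have "dist x u + dist x v > 0" using zero_le_dist[of x u] zero_le_dist[of x v] by linarith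
    then show ?thesis unfolding eq sgn_mult by simp
  qed
qed

text \<open>There is one affine function for each of the \<open>n\<^sup>2\<close> ordered pairs,
  with \<open>i = j\<close> and both orders included; this redundancy costs only a constant inside a
  logarithm. The arrangement count admits zero normal vectors, so coinciding sample points are
  covered.\<close>

lemma card_distance_patterns:
  fixes p :: "nat \<Rightarrow> 'a::euclidean_space"
  shows "finite (range (distance_pattern p n))"
    and "card (range (distance_pattern p n)) \<le> (1 + 2 * n\<^sup>2) ^ DIM('a)"
proof -
  let ?h = "\<lambda>ij x. (2 *\<^sub>R (p (snd ij) - p (fst ij))) \<bullet> x
     - (p (snd ij) \<bullet> p (snd ij) - p (fst ij) \<bullet> p (fst ij))"
  have eq: "range (distance_pattern p n) = sign_patterns ({1..n} \<times> {1..n}) ?h UNIV"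
    unfolding sign_patterns_def distance_pattern_def
    by (intro image_cong refl) (auto simp: fun_eq_iff sgn_dist_diff)
  show "finite (range (distance_pattern p n))" unfolding eq by (rule finite_sign_patterns) auto
  show "card (range (distance_pattern p n)) \<le> (1 + 2 * n\<^sup>2) ^ DIM('a)"
    unfolding eq using card_sign_patterns_affine[of "{1..n} \<times> {1..n}" "UNIV :: 'a set" "DIM('a)"
       "\<lambda>ij. 2 *\<^sub>R (p (snd ij) - p (fst ij))" "\<lambda>ij. p (snd ij) \<bullet> p (snd ij) - p (fst ij) \<bullet> p (fst ij)"]
    by (simp add: power2_eq_square)
qed

text \<open>The tie-break compares sample points and indices only and is free of \<open>x\<close>.
  The neighbour set is a function of this relation and the distance pattern, so for a fixed sample
  it varies with \<open>x\<close> through the pattern alone.\<close>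

definition tie_order :: "(nat \<Rightarrow> real ^ ('d::{finite,linorder})) \<Rightarrow> nat \<Rightarrow> (nat \<times> nat) set" where
  "tie_order p n = {(i, j) \<in> {1..n} \<times> {1..n}. lex_less (p i) (p j) \<or> p i = p j \<and> i < j}"

definition pattern_neighbours ::
    "nat \<Rightarrow> nat \<Rightarrow> (nat \<times> nat \<Rightarrow> real) \<Rightarrow> (nat \<times> nat) set \<Rightarrow> nat set" where
  "pattern_neighbours n k s r =
     {i \<in> {1..n}. card {j \<in> {1..n}. s (j, i) = -1 \<or> s (j, i) = 0 \<and> (j, i) \<in> r} < k}"

lemma nn_indices_pattern:
  "nn_indices p n k x = pattern_neighbours n k (distance_pattern p n x) (tie_order p n)"
proof -
  have *: "{j \<in> {1..n}. nearer p x j i} = {j \<in> {1..n}. distance_pattern p n x (j, i) = -1 \<or>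
     distance_pattern p n x (j, i) = 0 \<and> (j, i) \<in> tie_order p n}" if "i \<in> {1..n}" for i
    using that by (auto simp: nearer_def distance_pattern_def tie_order_def sgn_if)
  show ?thesis
    unfolding nn_indices_def pattern_neighbours_def using * by (intro Collect_cong) auto
qed

lemma card_nn_indices_range:
  fixes p :: "nat \<Rightarrow> real ^ ('d::{finite,linorder})"
  shows "finite (range (nn_indices p n k))"
    and "card (range (nn_indices p n k)) \<le> (1 + 2 * n\<^sup>2) ^ CARD('d)"
proof -
  have eq: "range (nn_indices p n k) = (\<lambda>s. pattern_neighbours n k s (tie_order p n)) ` range (distance_pattern p n)"
    by (auto simp: nn_indices_pattern)
  show "finite (range (nn_indices p n k))" unfolding eq using card_distance_patterns(1) by (rule finite_imageI)
  have "card (range (nn_indices p n k)) \<le> card (range (distance_pattern p n))"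
    unfolding eq using card_distance_patterns(1) by (rule card_image_le)
  then show "card (range (nn_indices p n k)) \<le> (1 + 2 * n\<^sup>2) ^ CARD('d)"
    using card_distance_patterns(2)[of p n] by simp
qed

section \<open>The neighbour ranking as a strict total order\<close>

lemma lex_less_trans: "lex_less a b \<Longrightarrow> lex_less b c \<Longrightarrow> lex_less a c"
  unfolding lex_less_def
proof (elim exE conjE)
  fix i j assume h: "a $ i < b $ i" "\<forall>j<i. a $ j = b $ j" "b $ j < c $ j" "\<forall>i<j. b $ i = c $ i"
  have "a $ min i j < c $ min i j \<and> (\<forall>l<min i j. a $ l = c $ l)"
    using h by (cases i j rule: linorder_cases) (auto simp: min_def)
  then show "\<exists>i. a $ i < c $ i \<and> (\<forall>j<i. a $ j = c $ j)" by blast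
qed

lemma lex_less_irrefl: "\<not> lex_less a a"
  by (auto simp: lex_less_def)

lemma lex_less_total:
  assumes "a \<noteq> b" shows "lex_less a b \<or> lex_less b a"
proof -
  have fin: "finite {i. a $ i \<noteq> b $ i}" by simp
  have ne: "{i. a $ i \<noteq> b $ i} \<noteq> {}" using assms by (auto simp: vec_eq_iff)
  define i where "i = Min {i. a $ i \<noteq> b $ i}"
  have "a $ i \<noteq> b $ i" using Min_in[OF fin ne] by (simp add: i_def)
  moreover have "\<forall>j<i. a $ j = b $ j"
  proof (intro allI impI)
    fix j assume "j < i"
    show "a $ j = b $ j"
    proof (rule ccontr)
      assume "a $ j \<noteq> b $ j"
      then have "i \<le> j" unfolding i_def by (intro Min_le[OF fin]) simp
      then show False using \<open>j < i\<close> by simp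
    qed
  qed
  ultimately show ?thesis unfolding lex_less_def by (cases "a $ i < b $ i") (auto simp: not_less le_less)
qed

lemma nearer_trans: "nearer p x i j \<Longrightarrow> nearer p x j l \<Longrightarrow> nearer p x i l"
  unfolding nearer_def by (elim disjE conjE) (auto dest: lex_less_trans)

lemma nearer_irrefl: "\<not> nearer p x i i"
  using lex_less_irrefl by (auto simp: nearer_def)

lemma nearer_total:
  assumes "i \<noteq> j" shows "nearer p x i j \<or> nearer p x j i"
proof (cases "dist x (p i) = dist x (p j) \<and> p i = p j")
  case True
  then show ?thesis using assms unfolding nearer_def by (auto simp: neq_iff)
next
  case False
  then show ?thesis using lex_less_total[of "p i" "p j"] unfolding nearer_def by (auto simp: neq_iff)
qed

text \<open>The number of nearer points is a rank that increases strictly along a strict total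
  order. It is therefore injective, and the indices of rank below \<open>k\<close> inject into
  \<open>{..<k}\<close>.\<close>

lemma card_nn_indices_le: "card (nn_indices p n k x) \<le> k"
proof -
  define r where "r = (\<lambda>i. card {j \<in> {1..n}. nearer p x j i})"
  have mono: "r i < r j" if "nearer p x i j" "i \<in> {1..n}" for i j
    unfolding r_def
  proof (rule psubset_card_mono)
    show "{l \<in> {1..n}. nearer p x l i} \<subset> {l \<in> {1..n}. nearer p x l j}"
      using that nearer_trans nearer_irrefl by blast
  qed simp
  have "inj_on r {1..n}"
    by (rule inj_onI) (metis mono nearer_total less_irrefl)
  then have "inj_on r (nn_indices p n k x)"
    by (rule inj_on_subset) (auto simp: nn_indices_def)
  then have "card (nn_indices p n k x) = card (r ` nn_indices p n k x)" by (simp add: card_image)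
  also have "\<dots> \<le> card {..<k}" by (rule card_mono) (auto simp: nn_indices_def r_def)
  finally show ?thesis by simp
qed

lemma nn_indices_subset: "nn_indices p n k x \<subseteq> {1..n}"
  by (auto simp: nn_indices_def)

lemma nn_indices_cong:
  assumes "\<And>i. i \<in> {1..n} \<Longrightarrow> p i = q i"
  shows "nn_indices p n k x = nn_indices q n k x"
proof -
  have "{j \<in> {1..n}. nearer p x j i} = {j \<in> {1..n}. nearer q x j i}" if "i \<in> {1..n}" for i
    using assms that by (auto simp: nearer_def)
  then show ?thesis unfolding nn_indices_def by (intro Collect_cong) auto
qed

section \<open>Measurability of the event that a given neighbour set occurs\<close>

text \<open>Over an uncountable compact set the existential quantifier becomes a countable one because
  the minimum of a continuous function is a limit of values on a countable dense subset.\<close>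

lemma sets_ex_compact_nonpos:
  fixes \<Phi> :: "'w \<Rightarrow> 'a::euclidean_space \<Rightarrow> real"
  assumes "\<And>x. (\<lambda>w. \<Phi> w x) \<in> borel_measurable M"
    and cont: "\<And>w. continuous_on UNIV (\<Phi> w)" and "compact K"
  shows "{w \<in> space M. \<exists>x\<in>K. \<Phi> w x \<le> 0} \<in> sets M"
proof -
  obtain D where D: "countable D" "D \<subseteq> K" "K \<subseteq> closure D" using separable[of K] by blast
  have "(\<exists>x\<in>K. \<Phi> w x \<le> 0) \<longleftrightarrow> (\<forall>l::nat. \<exists>x\<in>D. \<Phi> w x < 1 / Suc l)" for w
  proof
    assume "\<exists>x\<in>K. \<Phi> w x \<le> 0"
    then obtain x where x: "x \<in> K" "\<Phi> w x \<le> 0" by blast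
    show "\<forall>l::nat. \<exists>x\<in>D. \<Phi> w x < 1 / Suc l"
    proof
      fix l :: nat
      have "open {y. \<Phi> w y < 1 / Suc l}"
        using cont by (intro open_Collect_less continuous_on_const) auto
      moreover have "x \<in> {y. \<Phi> w y < 1 / Suc l}" using x by (simp add: order.strict_trans1)
      moreover have "x \<in> closure D" using x D by auto
      ultimately show "\<exists>x\<in>D. \<Phi> w x < 1 / Suc l"
        using open_Int_closure_eq_empty[of "{y. \<Phi> w y < 1 / Suc l}" D] by blast
    qed
  next
    assume *: "\<forall>l::nat. \<exists>x\<in>D. \<Phi> w x < 1 / Suc l"
    then have "K \<noteq> {}" using D by blast
    then obtain x where x: "x \<in> K" "\<forall>y\<in>K. \<Phi> w x \<le> \<Phi> w y"
      using continuous_attains_inf[OF \<open>compact K\<close>, of "\<Phi> w"] cont continuous_on_subset by blast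
    have "\<Phi> w x < 1 / Suc l" for l using * x D by (meson order.strict_trans1 subsetD)
    then have "\<Phi> w x \<le> 0"
      by (meson less_le_not_le linorder_le_less_linear nat_approx_posE order.strict_trans)
    then show "\<exists>x\<in>K. \<Phi> w x \<le> 0" using x by blast
  qed
  then have "{w \<in> space M. \<exists>x\<in>K. \<Phi> w x \<le> 0} =
      {w \<in> space M. \<forall>l::nat. \<exists>x\<in>D. \<Phi> w x < 1 / Suc l}" by simp
  also have "\<dots> \<in> sets M"
    using assms(1) D(1) by measurable
  finally show ?thesis .
qed

text \<open>The conditions \<open>h > 0\<close> and \<open>h < 0\<close> are open. With a margin 1 /
  (m + 1) each becomes a countable union of closed conditions, every one of them the vanishing of a
  nonnegative continuous function of \<open>h\<close>, a form to which compactness applies.\<close>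

lemma sgn_eq_iff_violation:
  fixes h t :: real
  assumes "t \<in> {-1, 0, 1}"
  shows "sgn h = t \<longleftrightarrow> (\<exists>m::nat. (if t = 0 then \<bar>h\<bar> else max 0 (1 / Suc m - t * h)) \<le> 0)"
proof -
  have *: "(\<exists>m::nat. 1 / Suc m \<le> y) \<longleftrightarrow> y > 0" for y :: real
  proof
    assume "\<exists>m::nat. 1 / Suc m \<le> y"
    then obtain m :: nat where "1 / real (Suc m) \<le> y" ..
    moreover have "0 < 1 / real (Suc m)" by simp
    ultimately show "y > 0" by linarith
  qed (meson less_imp_le nat_approx_posE)
  show ?thesis
  proof (cases "t = 0")
    case False
    then have "sgn h = t \<longleftrightarrow> t * h > 0" using assms by (auto simp: sgn_if)
    then show ?thesis using *[of "t * h"] False by simp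
  qed (simp add: sgn_if)
qed

text \<open>For a fixed margin the pattern condition says that a sum of nonnegative continuous
  functions of \<open>x\<close> vanishes, so the quantifier over a compact ball preserves
  measurability. Countable unions over margins and radii then exhaust the space.\<close>

lemma sets_ex_distance_pattern:
  fixes p :: "'w \<Rightarrow> nat \<Rightarrow> 'a::euclidean_space"
  assumes p: "\<And>i. i \<in> {1..n} \<Longrightarrow> (\<lambda>w. p w i) \<in> borel_measurable M"
  shows "{w \<in> space M. \<exists>x. distance_pattern (p w) n x = s} \<in> sets M"
proof (cases "s \<in> (\<Pi>\<^sub>E ij\<in>{1..n}\<times>{1..n}. {-1, 0, 1})")
  case True
  define J where "J = {1..n} \<times> {1..n}"
  define h where "h = (\<lambda>(i, j) w x. dist x (p w i) - dist x (p w j))"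
  define \<psi> where "\<psi> = (\<lambda>m ij w x. if s ij = 0 then \<bar>h ij w x\<bar> else max 0 (1 / real (Suc m) - s ij * h ij w x))"
  define \<Phi> where "\<Phi> = (\<lambda>m w x. \<Sum>ij\<in>J. \<psi> m ij w x)"
  have finJ: "finite J" by (simp add: J_def)
  have nonneg: "\<psi> m ij w x \<ge> 0" for m ij w x by (simp add: \<psi>_def)
  have iff: "distance_pattern (p w) n x = s \<longleftrightarrow> (\<exists>m. \<Phi> m w x \<le> 0)" for w x
  proof -
    have ext: "s \<in> extensional J" using True by (auto simp: J_def PiE_def)
    have val: "s ij \<in> {-1, 0, 1}" if "ij \<in> J" for ij
      using True that unfolding J_def by (meson PiE_mem)
    have "distance_pattern (p w) n x = s \<longleftrightarrow> (\<forall>ij\<in>J. sgn (h ij w x) = s ij)"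
      using ext unfolding distance_pattern_def h_def J_def
      by (auto simp: fun_eq_iff extensional_def)
    also have "\<dots> \<longleftrightarrow> (\<forall>ij\<in>J. \<exists>m. \<psi> m ij w x \<le> 0)"
      unfolding \<psi>_def using sgn_eq_iff_violation val by blast
    also have "\<dots> \<longleftrightarrow> (\<exists>m. \<forall>ij\<in>J. \<psi> m ij w x \<le> 0)"
    proof
      assume "\<forall>ij\<in>J. \<exists>m. \<psi> m ij w x \<le> 0"
      then obtain m where m: "\<And>ij. ij \<in> J \<Longrightarrow> \<psi> (m ij) ij w x \<le> 0" by metis
      \<comment> \<open>A smaller margin is easier to meet, so the largest of the finitely many
        values \<open>m ij\<close> serves all pairs. The inserted 0 takes care of an empty
        \<open>J\<close>.\<close>
      have "\<psi> (Max (insert 0 (m ` J))) ij w x \<le> 0" if "ij \<in> J" for ij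
      proof -
        have "m ij \<le> Max (insert 0 (m ` J))" using finJ that by (intro Max_ge) auto
        then have "1 / real (Suc (Max (insert 0 (m ` J)))) \<le> 1 / real (Suc (m ij))"
          by (simp add: frac_le)
        then show ?thesis using m[OF that] unfolding \<psi>_def by (auto split: if_splits)
      qed
      then show "\<exists>m. \<forall>ij\<in>J. \<psi> m ij w x \<le> 0" by blast
    qed blast
    also have "\<dots> \<longleftrightarrow> (\<exists>m. \<Phi> m w x \<le> 0)"
    proof -
      have "(\<forall>ij\<in>J. \<psi> m ij w x \<le> 0) \<longleftrightarrow> \<Phi> m w x \<le> 0" for m
      proof -
        have "\<Phi> m w x \<le> 0 \<longleftrightarrow> \<Phi> m w x = 0"
          using sum_nonneg[of J "\<lambda>ij. \<psi> m ij w x"] nonneg unfolding \<Phi>_def by fastforce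
        also have "\<dots> \<longleftrightarrow> (\<forall>ij\<in>J. \<psi> m ij w x = 0)"
          unfolding \<Phi>_def by (rule sum_nonneg_eq_0_iff) (use finJ nonneg in auto)
        finally show ?thesis using nonneg by (metis order.antisym order.refl)
      qed
      then show ?thesis by simp
    qed
    finally show ?thesis .
  qed
  have "{w \<in> space M. \<exists>x. distance_pattern (p w) n x = s} =
      (\<Union>m. \<Union>R::nat. {w \<in> space M. \<exists>x\<in>cball 0 (real R). \<Phi> m w x \<le> 0})"
  proof -
    have "\<exists>R::nat. x \<in> cball 0 (real R)" for x :: 'a by (simp add: real_arch_simple)
    then show ?thesis unfolding iff by blast
  qed
  also have "\<dots> \<in> sets M"
  proof -
    have "(\<lambda>w. \<Phi> m w x) \<in> borel_measurable M" for m x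
      unfolding \<Phi>_def
    proof (rule borel_measurable_sum)
      fix ij assume "ij \<in> J"
      then obtain i j where ij: "ij = (i, j)" "i \<in> {1..n}" "j \<in> {1..n}" by (auto simp: J_def)
      have [measurable]: "(\<lambda>w. p w i) \<in> borel_measurable M" "(\<lambda>w. p w j) \<in> borel_measurable M"
        using p ij by auto
      show "(\<lambda>w. \<psi> m ij w x) \<in> borel_measurable M"
        unfolding \<psi>_def h_def ij prod.case by (cases "s (i, j) = 0") simp_all
    qed
    moreover have "continuous_on UNIV (\<Phi> m w)" for m w
      unfolding \<Phi>_def
    proof (rule continuous_on_sum)
      fix ij assume "ij \<in> J"
      obtain i j where ij: "ij = (i, j)" by (cases ij)
      show "continuous_on UNIV (\<psi> m ij w)"
        unfolding \<psi>_def h_def ij prod.case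
        by (cases "s (i, j) = 0") (auto intro!: continuous_intros)
    qed
    ultimately have "{w \<in> space M. \<exists>x\<in>cball 0 (real R). \<Phi> m w x \<le> 0} \<in> sets M" for m and R :: nat
      by (intro sets_ex_compact_nonpos compact_cball)
    then show ?thesis by (intro sets.countable_UN) auto
  qed
  finally show ?thesis .
next
  case False
  have "distance_pattern (p w) n x \<in> (\<Pi>\<^sub>E ij\<in>{1..n}\<times>{1..n}. {-1, 0, 1})" for w x
    by (rule distance_pattern_PiE)
  then have "{w \<in> space M. \<exists>x. distance_pattern (p w) n x = s} = {}" using False by auto
  then show ?thesis by (metis sets.empty_sets)
qed

text \<open>An uncountable union over \<open>x\<close> need not be measurable in general. Here it is
  a finite union over pairs of a distance pattern and a tie relation, and \<open>x\<close> enters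
  only through the pattern.\<close>

lemma sets_ex_nn_indices:
  fixes p :: "'w \<Rightarrow> nat \<Rightarrow> real ^ ('d::{finite,linorder})"
  assumes p: "\<And>i. i \<in> {1..n} \<Longrightarrow> (\<lambda>w. p w i) \<in> borel_measurable M"
  shows "{w \<in> space M. \<exists>x. nn_indices (p w) n k x = N} \<in> sets M"
proof -
  let ?S = "\<Pi>\<^sub>E ij\<in>{1..n}\<times>{1..n}. {-1, 0, 1 :: real}"
  let ?R = "Pow ({1..n} \<times> {1..n})"
  have tie: "{w \<in> space M. tie_order (p w) n = r} \<in> sets M" if "r \<in> ?R" for r
  proof -
    have eq: "{w \<in> space M. tie_order (p w) n = r} = {w \<in> space M. \<forall>i\<in>{1..n}. \<forall>j\<in>{1..n}.
       (i, j) \<in> r \<longleftrightarrow> lex_less (p w i) (p w j) \<or> p w i = p w j \<and> i < j}"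
      using that unfolding tie_order_def by auto
    have "{w \<in> space M. (i, j) \<in> r \<longleftrightarrow> lex_less (p w i) (p w j) \<or> p w i = p w j \<and> i < j} \<in> sets M"
      if "i \<in> {1..n}" "j \<in> {1..n}" for i j
    proof -
      have [measurable]: "(\<lambda>w. p w i) \<in> borel_measurable M" "(\<lambda>w. p w j) \<in> borel_measurable M"
        using p that by auto
      have [measurable]: "(\<lambda>w. p w i $ l) \<in> borel_measurable M" "(\<lambda>w. p w j $ l) \<in> borel_measurable M" for l
        by (simp_all add: cart_eq_inner_axis)
      show ?thesis unfolding lex_less_def by measurable
    qed
    then show ?thesis unfolding eq by (intro sets.sets_Collect_finite_All) auto
  qed
  have "{w \<in> space M. \<exists>x. nn_indices (p w) n k x = N} =
     (\<Union>(s, r)\<in>{(s, r) \<in> ?S \<times> ?R. pattern_neighbours n k s r = N}.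
       {w \<in> space M. \<exists>x. distance_pattern (p w) n x = s} \<inter> {w \<in> space M. tie_order (p w) n = r})"
  proof -
    have "distance_pattern (p w) n x \<in> ?S" for w x
      by (rule distance_pattern_PiE)
    moreover have "tie_order (p w) n \<in> ?R" for w by (auto simp: tie_order_def)
    ultimately show ?thesis unfolding nn_indices_pattern by auto blast
  qed
  also have "\<dots> \<in> sets M"
  proof (rule sets.finite_UN)
    have "finite (?S \<times> ?R)" by (intro finite_cartesian_product finite_PiE) auto
    then show "finite {(s, r) \<in> ?S \<times> ?R. pattern_neighbours n k s r = N}"
      by (rule finite_subset[rotated]) auto
  qed (use tie sets_ex_distance_pattern[OF p] in \<open>auto intro!: sets.Int\<close>)
  finally show ?thesis .
qed

section \<open>A uniform Bernstein bound by symmetrisation\<close>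

lemma exp_le_quadratic:
  fixes x :: real
  assumes "x \<le> 1"
  shows "exp x \<le> 1 + x + x\<^sup>2"
proof (cases "0 \<le> x")
  case True
  then show ?thesis using assms by (rule exp_bound)
next
  case False
  define y where "y = -x"
  have y: "y > 0" using False by (simp add: y_def)
  have "1 + y + y\<^sup>2 / 2 \<le> exp y" using y by (intro exp_lower_Taylor_quadratic) simp
  moreover have pos: "0 < 1 + y + y\<^sup>2 / 2" using y by (intro add_pos_nonneg) auto
  ultimately have "inverse (exp y) \<le> inverse (1 + y + y\<^sup>2 / 2)" by (intro le_imp_inverse_le)
  then have "exp x \<le> 1 / (1 + y + y\<^sup>2 / 2)" by (simp add: y_def exp_minus inverse_eq_divide)
  also have "\<dots> \<le> 1 - y + y\<^sup>2"
  proof -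
    \<comment> \<open>The product below shows that 1 - y + y^2 dominates the reciprocal of the
      Taylor bound 1 + y + y^2 / 2: the terms linear in y cancel and the remaining ones have
      positive coefficients.\<close>
    have "2 \<le> 2 + y\<^sup>2 + y ^ 3 + y ^ 4" using y by simp
    also have "\<dots> = (1 - y + y\<^sup>2) * (2 + 2 * y + y\<^sup>2)"
      by (simp add: power2_eq_square power3_eq_cube power4_eq_xxxx algebra_simps)
    also have "2 + 2 * y + y\<^sup>2 = 2 * (1 + y + y\<^sup>2 / 2)" by simp
    finally have "2 * 1 \<le> 2 * ((1 - y + y\<^sup>2) * (1 + y + y\<^sup>2 / 2))" by (simp only: mult.left_commute mult_1_right)
    then have "1 \<le> (1 - y + y\<^sup>2) * (1 + y + y\<^sup>2 / 2)" by (rule mult_left_le_imp_le) simp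
    then show ?thesis using pos by (simp add: divide_le_eq)
  qed
  finally show ?thesis by (simp add: y_def)
qed

text \<open>The penalty is quadratic in the value that a swap moves into the second slot only; after
  integrating out that slot it is therefore deterministic. This replaces a separate bound for the
  empirical variance.\<close>

lemma exp_swap_le_2:
  fixes u v :: real
  assumes "\<bar>u\<bar> \<le> 1 / 16" "\<bar>v\<bar> \<le> 1 / 16"
  shows "exp ((u - v) - 8 * v\<^sup>2) + exp ((v - u) - 8 * u\<^sup>2) \<le> 2"
proof -
  \<comment> \<open>The range 1 / 16 makes 8 b^2 at most |b| / 2, and Young's inequality with
    weights 3 / 2 and 3 absorbs the cross term. When the two exponentials are added, the linear
    parts cancel and the squares total at most (6 + 3/4) (u^2 + v^2), which the penalty of weight 8
    outweighs.\<close>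
  have sq: "(a - b - 8 * b\<^sup>2)\<^sup>2 \<le> 3 / 2 * (a - b)\<^sup>2 + 3 / 4 * b\<^sup>2" if "\<bar>b\<bar> \<le> 1 / 16" for a b :: real
  proof -
    define r where "r = a - b"
    define q where "q = 8 * b\<^sup>2"
    have "\<bar>b\<bar> * \<bar>b\<bar> \<le> 1 / 16 * \<bar>b\<bar>" using that by (intro mult_right_mono) auto
    then have "q \<le> \<bar>b\<bar> / 2" by (simp add: q_def power2_eq_square)
    then have "q\<^sup>2 \<le> (\<bar>b\<bar> / 2)\<^sup>2" by (intro power_mono) (auto simp: q_def)
    then have q: "q\<^sup>2 \<le> b\<^sup>2 / 4" by (simp add: power_divide)
    have "0 \<le> (r + 2 * q)\<^sup>2" by simp
    then have "(r - q)\<^sup>2 \<le> 3 / 2 * r\<^sup>2 + 3 * q\<^sup>2" by (simp add: power2_eq_square algebra_simps)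
    then show ?thesis using q unfolding r_def q_def by linarith
  qed
  have diff: "(u - v)\<^sup>2 \<le> 2 * u\<^sup>2 + 2 * v\<^sup>2"
    using zero_le_power2[of "u + v"] by (simp add: power2_eq_square algebra_simps)
  have "exp ((u - v) - 8 * v\<^sup>2) \<le> 1 + ((u - v) - 8 * v\<^sup>2) + ((u - v) - 8 * v\<^sup>2)\<^sup>2"
    by (rule exp_le_quadratic) (use assms zero_le_power2[of v] in linarith)
  moreover have "exp ((v - u) - 8 * u\<^sup>2) \<le> 1 + ((v - u) - 8 * u\<^sup>2) + ((v - u) - 8 * u\<^sup>2)\<^sup>2"
    by (rule exp_le_quadratic) (use assms zero_le_power2[of u] in linarith)
  moreover have "((v - u) - 8 * u\<^sup>2)\<^sup>2 \<le> 3 / 2 * (u - v)\<^sup>2 + 3 / 4 * u\<^sup>2"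
    using sq[OF assms(1), of v] by (simp add: power2_commute)
  moreover have lin: "ea + eb \<le> 2"
    if "ea \<le> 1 + (x - 8 * vv) + qa" "eb \<le> 1 + (y - 8 * uu) + qb" "y = - x"
      "qb \<le> 3 / 2 * dd + 3 / 4 * uu" "qa \<le> 3 / 2 * dd + 3 / 4 * vv"
      "dd \<le> 2 * uu + 2 * vv" "0 \<le> uu" "0 \<le> vv"
    for ea eb x y uu vv qa qb dd :: real
    using that by linarith
  ultimately show ?thesis
    using sq[OF assms(2), of u] diff
    by (intro lin[where x = "u - v" and y = "v - u" and uu = "u\<^sup>2" and vv = "v\<^sup>2" and dd = "(u - v)\<^sup>2"]) auto
qed

section \<open>Finite nets and averaging over swaps\<close>

text \<open>The entropy condition is applied to the empirical measure of the points
  \<open>y j\<close>. A single square is at most the sum of all, so L2 closeness gives closeness at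
  every point at the price of \<open>sqrt (card J)\<close>. Centres of a cover are arbitrary L2
  functions; clipping them to [-1, 1] brings them no farther from any \<open>g\<close> and makes
  them bounded.\<close>

lemma VC_class_finite_net:
  assumes VC: "VC_class S \<G> v A (\<lambda>_. 1)"
    and J: "finite J" "J \<noteq> {}" and y: "y \<in> J \<rightarrow> space S" and \<epsilon>: "0 < \<epsilon>" "\<epsilon> < 1"
  obtains C where "finite C" "real (card C) \<le> (A / \<epsilon>) powr v"
    "\<And>c z. c \<in> C \<Longrightarrow> \<bar>c z\<bar> \<le> (1::real)"
    "\<And>g. g \<in> \<G> \<Longrightarrow> \<exists>c\<in>C. \<forall>j\<in>J. \<bar>g (y j) - c (y j)\<bar> \<le> sqrt (real (card J)) * \<epsilon>"
proof -
  define Q where "Q = distr (uniform_count_measure J) S y"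
  have my: "y \<in> uniform_count_measure J \<rightarrow>\<^sub>M S"
    using y by (simp add: measurable_def space_uniform_count_measure sets_uniform_count_measure)
  have Q: "prob_space Q"
    unfolding Q_def by (rule prob_space.prob_space_distr[OF prob_space_uniform_count_measure[OF J] my])
  interpret Q: prob_space Q by (rule Q)
  have sQ: "sets Q = sets S" by (simp add: Q_def)
  have intQ: "(\<integral>z. h z \<partial>Q) = (\<Sum>j\<in>J. h (y j)) / card J" if "h \<in> borel_measurable S" for h :: "'a \<Rightarrow> real"
    unfolding Q_def using that J(1) by (simp add: integral_distr[OF my] integral_uniform_count_measure)
  have one: "(\<lambda>_. 1) \<in> L2_functions Q" by (simp add: L2_functions_def)
  have norm1: "L2_norm Q (\<lambda>_. 1) = 1" by (simp add: L2_norm_def Q.prob_space)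
  have "ereal_of_enat (covering_number \<G> Q (\<epsilon> * L2_norm Q (\<lambda>_. 1))) \<le> ereal ((A / \<epsilon>) powr v)"
    using VC \<epsilon> Q sQ one unfolding VC_class_def by blast
  then have cov: "ereal_of_enat (covering_number \<G> Q \<epsilon>) \<le> ereal ((A / \<epsilon>) powr v)" by (simp add: norm1)
  let ?S = "{C. finite C \<and> C \<subseteq> L2_functions Q \<and> \<G> \<subseteq> (\<Union>c\<in>C. L2_cball Q c \<epsilon>)}"
  obtain m where m: "covering_number \<G> Q \<epsilon> = enat m" "real m \<le> (A / \<epsilon>) powr v"
    using cov by (cases "covering_number \<G> Q \<epsilon>") auto
  \<comment> \<open>The strict inequality extracts a cover with at most \<open>m\<close> elements
    without showing that the infimum is attained.\<close>
  then have "(INF C\<in>?S. enat (card C)) < enat (Suc m)" by (simp add: covering_number_def)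
  then obtain C where "C \<in> ?S" "enat (card C) < enat (Suc m)" unfolding INF_less_iff by blast
  then have C: "finite C" "C \<subseteq> L2_functions Q" "\<G> \<subseteq> (\<Union>c\<in>C. L2_cball Q c \<epsilon>)" and card: "card C \<le> m"
    by auto
  define clip where "clip = (\<lambda>(c :: 'a \<Rightarrow> real) z. max (-1) (min 1 (c z)))"
  show ?thesis
  proof (rule that[of "clip ` C"])
    show "finite (clip ` C)" using C by simp
    have "real (card C) \<le> (A / \<epsilon>) powr v" using m card by linarith
    moreover have "card (clip ` C) \<le> card C" using C(1) by (rule card_image_le)
    ultimately show "real (card (clip ` C)) \<le> (A / \<epsilon>) powr v" by linarith
    show "\<bar>c z\<bar> \<le> 1" if "c \<in> clip ` C" for c z using that by (auto simp: clip_def)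
    fix g assume g: "g \<in> \<G>"
    then obtain c where c: "c \<in> C" "g \<in> L2_cball Q c \<epsilon>" using C by auto
    have mg: "g \<in> borel_measurable S" using VC g unfolding VC_class_def pointwise_measurable_def by auto
    have mc: "c \<in> borel_measurable S"
      using C(2) c(1) measurable_cong_sets[OF sQ refl] unfolding L2_functions_def by blast
    have bound: "\<bar>g z\<bar> \<le> 1" if "z \<in> space S" for z using VC g that unfolding VC_class_def by auto
    have "L2_norm Q (\<lambda>z. g z - c z) \<le> \<epsilon>" using c(2) by (simp add: L2_cball_def)
    then have "(\<integral>z. (g z - c z)\<^sup>2 \<partial>Q) \<le> \<epsilon>\<^sup>2"
      unfolding L2_norm_def by (rule sqrt_le_D)
    moreover have "(\<integral>z. (g z - c z)\<^sup>2 \<partial>Q) = (\<Sum>j\<in>J. (g (y j) - c (y j))\<^sup>2) / card J"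
      using mg mc by (subst intQ) auto
    moreover have "card J > 0" using J by (simp add: card_gt_0_iff)
    ultimately have sum: "(\<Sum>j\<in>J. (g (y j) - c (y j))\<^sup>2) \<le> card J * \<epsilon>\<^sup>2"
      by (simp add: divide_le_eq mult.commute)
    have "\<bar>g (y j) - clip c (y j)\<bar> \<le> sqrt (card J) * \<epsilon>" if j: "j \<in> J" for j
    proof -
      have "(g (y j) - c (y j))\<^sup>2 \<le> (\<Sum>j\<in>J. (g (y j) - c (y j))\<^sup>2)"
        using J(1) j by (intro member_le_sum) auto
      then have "\<bar>g (y j) - c (y j)\<bar> \<le> sqrt (card J * \<epsilon>\<^sup>2)"
        using sum by (intro real_le_rsqrt) (simp add: power2_abs)
      moreover have "\<bar>g (y j) - clip c (y j)\<bar> \<le> \<bar>g (y j) - c (y j)\<bar>"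
      proof -
        have "y j \<in> space S" using y j by auto
        then have "\<bar>g (y j)\<bar> \<le> 1" by (rule bound)
        then show ?thesis by (auto simp: clip_def max_def min_def abs_if split: if_splits)
      qed
      ultimately show ?thesis using \<epsilon>(1) by (simp add: real_sqrt_mult)
    qed
    then show "\<exists>c\<in>clip ` C. \<forall>j\<in>J. \<bar>g (y j) - c (y j)\<bar> \<le> sqrt (real (card J)) * \<epsilon>"
      using c(1) by auto
  qed
qed

text \<open>An index is a pair of a sample index and a slot. Exchanging slots 0 and 1 on a set
  \<open>E\<close> takes the place of a vector of random signs; since it permutes identically
  distributed coordinates, it preserves the product measure exactly.\<close>

definition ghost_swap :: "'i set \<Rightarrow> 'i \<times> nat \<Rightarrow> 'i \<times> nat" where
  "ghost_swap E k = (if fst k \<in> E then (fst k, if snd k = 0 then 1 else if snd k = 1 then 0 else snd k) else k)"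

text \<open>With u and w the values of \<open>l * g\<close> in slots 0 and 1 relative to slot 2,
  this is (u - w) - 8 w^2, and a swap exchanges u and w. Slot 2 acts as a base point in place of the
  mean.\<close>

definition ghost_term :: "real \<Rightarrow> ('s \<Rightarrow> real) \<Rightarrow> ('i \<times> nat \<Rightarrow> 's) \<Rightarrow> 'i \<Rightarrow> real" where
  "ghost_term l g y i = l * (g (y (i, 0)) - g (y (i, 1))) - 8 * l\<^sup>2 * (g (y (i, 1)) - g (y (i, 2)))\<^sup>2"

text \<open>The sum over all subsets factorises into a product over \<open>i\<close> of (swapped +
  unswapped) terms, and the two-point inequality bounds each factor by 2. The points
  \<open>y\<close> are fixed here: all randomness is in the swaps.\<close>

lemma sum_exp_ghost_swap_le:
  assumes N: "finite N" and l: "\<bar>l\<bar> \<le> 1 / 32" and c: "\<And>z. \<bar>c z\<bar> \<le> (1::real)"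
  shows "(\<Sum>E\<in>Pow N. exp (\<Sum>i\<in>N. ghost_term l c (y \<circ> ghost_swap E) i)) \<le> 2 ^ card N"
proof -
  define t0 where "t0 = (\<lambda>i. ghost_term l c y i)"
  define t1 where "t1 = (\<lambda>i. l * (c (y (i, 1)) - c (y (i, 0))) - 8 * l\<^sup>2 * (c (y (i, 0)) - c (y (i, 2)))\<^sup>2)"
  have "exp (\<Sum>i\<in>N. ghost_term l c (y \<circ> ghost_swap E) i) = (\<Prod>i\<in>E. exp (t1 i)) * (\<Prod>i\<in>N - E. exp (t0 i))"
    if "E \<subseteq> N" for E
  proof -
    have "(\<Sum>i\<in>N. ghost_term l c (y \<circ> ghost_swap E) i)
        = (\<Sum>i\<in>E. ghost_term l c (y \<circ> ghost_swap E) i) + (\<Sum>i\<in>N - E. ghost_term l c (y \<circ> ghost_swap E) i)"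
      using that N by (metis sum.subset_diff add.commute)
    also have "(\<Sum>i\<in>E. ghost_term l c (y \<circ> ghost_swap E) i) = (\<Sum>i\<in>E. t1 i)"
      by (intro sum.cong) (auto simp: ghost_term_def ghost_swap_def t1_def)
    also have "(\<Sum>i\<in>N - E. ghost_term l c (y \<circ> ghost_swap E) i) = (\<Sum>i\<in>N - E. t0 i)"
      by (intro sum.cong) (auto simp: ghost_term_def ghost_swap_def t0_def)
    finally have "(\<Sum>i\<in>N. ghost_term l c (y \<circ> ghost_swap E) i) = (\<Sum>i\<in>E. t1 i) + (\<Sum>i\<in>N - E. t0 i)" .
    moreover have "finite E" using that N by (rule finite_subset)
    ultimately show ?thesis using N by (simp only: exp_add exp_sum finite_Diff)
  qed
  then have "(\<Sum>E\<in>Pow N. exp (\<Sum>i\<in>N. ghost_term l c (y \<circ> ghost_swap E) i))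
     = (\<Sum>E\<in>Pow N. (\<Prod>i\<in>E. exp (t1 i)) * (\<Prod>i\<in>N - E. exp (t0 i)))"
    by (intro sum.cong) auto
  also have "\<dots> = (\<Prod>i\<in>N. exp (t1 i) + exp (t0 i))"
    using N by (rule prod_add[symmetric])
  also have "\<dots> \<le> (\<Prod>i\<in>N. 2)"
  proof (rule prod_mono)
    fix i assume "i \<in> N"
    define u where "u = l * (c (y (i, 0)) - c (y (i, 2)))"
    define w where "w = l * (c (y (i, 1)) - c (y (i, 2)))"
    \<comment> \<open>Differences of values of \<open>c\<close> are at most 2 in modulus, so the
      limit 1 / 32 on \<open>l\<close> is what meets the range 1 / 16 of the two-point
      inequality.\<close>
    have "\<bar>l\<bar> * \<bar>c a - c b\<bar> \<le> 1 / 32 * 2" for a b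
      using l c[of a] c[of b] by (intro mult_mono) auto
    then have uw: "\<bar>u\<bar> \<le> 1 / 16" "\<bar>w\<bar> \<le> 1 / 16" by (auto simp: u_def w_def abs_mult)
    have "t0 i = (u - w) - 8 * w\<^sup>2" "t1 i = (w - u) - 8 * u\<^sup>2"
      unfolding t0_def t1_def ghost_term_def u_def w_def power_mult_distrib
      by (simp_all add: right_diff_distrib)
    then show "0 \<le> exp (t1 i) + exp (t0 i) \<and> exp (t1 i) + exp (t0 i) \<le> 2"
      using exp_swap_le_2[OF uw] by (simp add: add_nonneg_nonneg)
  qed
  finally show ?thesis by simp
qed

text \<open>The linear part changes by at most 2 \<eta> / 32, and the penalty by at most 8 l^2 times
  8 \<eta>, which is again \<eta> / 16 because l^2 \<le> 1 / 1024. The coefficient 1 of \<eta> in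
  the conclusion is a rounding up.\<close>

lemma ghost_term_close:
  assumes l: "\<bar>l\<bar> \<le> 1 / 32" and "0 \<le> \<eta>"
    and close: "\<And>a. a \<in> {0, 1, 2} \<Longrightarrow> \<bar>g (y (i, a)) - c (y (i, a))\<bar> \<le> \<eta>"
    and gb: "\<And>a. a \<in> {0, 1, 2} \<Longrightarrow> \<bar>g (y (i, a))\<bar> \<le> 1"
    and cb: "\<And>a. a \<in> {0, 1, 2} \<Longrightarrow> \<bar>c (y (i, a))\<bar> \<le> 1"
  shows "ghost_term l g y i \<le> ghost_term l c y i + \<eta>"
proof -
  define G where "G = (\<lambda>a. g (y (i, a)))"
  define H where "H = (\<lambda>a. c (y (i, a)))"
  have cl: "\<bar>G 0 - H 0\<bar> \<le> \<eta>" "\<bar>G 1 - H 1\<bar> \<le> \<eta>" "\<bar>G 2 - H 2\<bar> \<le> \<eta>"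
    using close by (auto simp: G_def H_def)
  have b: "\<bar>G 1\<bar> \<le> 1" "\<bar>G 2\<bar> \<le> 1" "\<bar>H 1\<bar> \<le> 1" "\<bar>H 2\<bar> \<le> 1"
    using gb cb by (auto simp: G_def H_def)
  have "l * ((G 0 - G 1) - (H 0 - H 1)) \<le> \<bar>l\<bar> * \<bar>(G 0 - G 1) - (H 0 - H 1)\<bar>"
    by (simp add: abs_mult[symmetric])
  also have "\<dots> \<le> 1 / 32 * (2 * \<eta>)" using l cl by (intro mult_mono) auto
  finally have 1: "l * ((G 0 - G 1) - (H 0 - H 1)) \<le> \<eta> / 16" by simp
  have "(H 1 - H 2)\<^sup>2 - (G 1 - G 2)\<^sup>2 = ((H 1 - H 2) - (G 1 - G 2)) * ((H 1 - H 2) + (G 1 - G 2))"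
    by (simp add: power2_eq_square algebra_simps)
  also have "\<dots> \<le> \<bar>(H 1 - H 2) - (G 1 - G 2)\<bar> * \<bar>(H 1 - H 2) + (G 1 - G 2)\<bar>"
    by (simp add: abs_mult[symmetric])
  also have "\<dots> \<le> (2 * \<eta>) * 4" using cl b \<open>0 \<le> \<eta>\<close> by (intro mult_mono) auto
  finally have 2: "(H 1 - H 2)\<^sup>2 - (G 1 - G 2)\<^sup>2 \<le> 8 * \<eta>" by simp
  have "\<bar>l\<bar>\<^sup>2 \<le> (1 / 32)\<^sup>2" using l by (intro power_mono) auto
  then have l2: "l\<^sup>2 \<le> 1 / 1024" by (simp add: power_divide)
  have "8 * l\<^sup>2 * ((H 1 - H 2)\<^sup>2 - (G 1 - G 2)\<^sup>2) \<le> 8 * l\<^sup>2 * (8 * \<eta>)"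
    using 2 by (intro mult_left_mono) auto
  also have "\<dots> \<le> 8 * (1 / 1024) * (8 * \<eta>)" using l2 \<open>0 \<le> \<eta>\<close> by (intro mult_right_mono mult_left_mono) auto
  finally have "8 * l\<^sup>2 * ((H 1 - H 2)\<^sup>2 - (G 1 - G 2)\<^sup>2) \<le> \<eta> / 16" by simp
  then have "l * ((G 0 - G 1) - (H 0 - H 1)) + 8 * l\<^sup>2 * ((H 1 - H 2)\<^sup>2 - (G 1 - G 2)\<^sup>2) \<le> \<eta>"
    using 1 \<open>0 \<le> \<eta>\<close> by linarith
  then show ?thesis unfolding ghost_term_def G_def H_def by (simp add: algebra_simps)
qed

lemma borel_measurable_ghost_term:
  fixes \<nu> :: "nat \<Rightarrow> 's measure"
  assumes g: "g \<in> borel_measurable S" and sets: "\<And>i. sets (\<nu> i) = sets S" and i: "i \<in> N"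
  shows "(\<lambda>y. ghost_term l g y i) \<in> borel_measurable (\<Pi>\<^sub>M k\<in>N \<times> {0, 1, 2}. \<nu> (fst k))"
    (is "_ \<in> borel_measurable ?\<Omega>")
proof -
  have "(\<lambda>y. g (y (i, a))) \<in> borel_measurable ?\<Omega>" if "a \<in> {0, 1, 2}" for a
  proof -
    have "(\<lambda>y. y (i, a)) \<in> measurable ?\<Omega> (\<nu> (fst (i, a)))"
      by (rule measurable_component_singleton) (use that i in auto)
    moreover have "g \<in> borel_measurable (\<nu> (fst (i, a)))"
      using g measurable_cong_sets[OF sets refl] by blast
    ultimately show ?thesis by (rule measurable_compose)
  qed
  then have [measurable]: "(\<lambda>y. g (y (i, 0))) \<in> borel_measurable ?\<Omega>"
    "(\<lambda>y. g (y (i, 1))) \<in> borel_measurable ?\<Omega>" "(\<lambda>y. g (y (i, 2))) \<in> borel_measurable ?\<Omega>" by blast+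
  show ?thesis unfolding ghost_term_def by measurable
qed

text \<open>Each of the 2 ^ card N swaps preserves the law of the three samples, so the integral
  equals its average over all swaps, and that average is bounded for every fixed \<open>y\<close>.
  The net contributes its cardinality; the premise \<open>small\<close> limits the loss in moving
  from \<open>g\<close> to a net element to a factor e.\<close>

lemma nn_integral_ghost_term_le:
  fixes \<nu> :: "nat \<Rightarrow> 's measure"
  assumes VC: "VC_class S \<G> v A (\<lambda>_. 1)" and \<G>0: "countable \<G>0" "\<G>0 \<subseteq> \<G>"
    and N: "finite N" "N \<noteq> {}" and prob: "\<And>i. prob_space (\<nu> i)" and sets: "\<And>i. sets (\<nu> i) = sets S"
    and l: "\<bar>l\<bar> \<le> 1 / 32" and \<epsilon>: "0 < \<epsilon>" "\<epsilon> < 1"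
    and small: "real (card N) * (sqrt (3 * real (card N)) * \<epsilon>) \<le> 1"
  shows "(\<integral>\<^sup>+y. (SUP g\<in>\<G>0. ennreal (exp (\<Sum>i\<in>N. ghost_term l g y i))) \<partial>(\<Pi>\<^sub>M k\<in>N \<times> {0, 1, 2}. \<nu> (fst k)))
           \<le> ennreal (exp 1 * (A / \<epsilon>) powr v)"
proof -
  define K where "K = N \<times> {0, 1, 2 :: nat}"
  define \<Omega> where "\<Omega> = (\<Pi>\<^sub>M k\<in>K. \<nu> (fst k))"
  define \<Phi> where "\<Phi> = (\<lambda>y. SUP g\<in>\<G>0. ennreal (exp (\<Sum>i\<in>N. ghost_term l g y i)))"
  define B where "B = (A / \<epsilon>) powr v"
  have K: "finite K" "K \<noteq> {}" "card K = 3 * card N"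
    using N by (auto simp: K_def card_cartesian_product)
  interpret \<Omega>: prob_space \<Omega> unfolding \<Omega>_def by (rule prob_space_PiM) (rule prob)
  have space\<nu>: "space (\<nu> i) = space S" for i using sets by (rule sets_eq_imp_space_eq)
  have mg: "g \<in> borel_measurable S" if "g \<in> \<G>" for g
    using VC that unfolding VC_class_def pointwise_measurable_def by auto
  have meas: "(\<lambda>y. ghost_term l g y i) \<in> borel_measurable \<Omega>" if "g \<in> \<G>" "i \<in> N" for g i
    unfolding \<Omega>_def K_def using mg[OF that(1)] sets that(2) by (rule borel_measurable_ghost_term)
  have \<Phi>_meas: "\<Phi> \<in> borel_measurable \<Omega>"
    unfolding \<Phi>_def using \<G>0 meas by (intro borel_measurable_SUP) (auto intro!: borel_measurable_sum measurable_compose[OF _ measurable_ennreal])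
  define sw where "sw = (\<lambda>E (y :: nat \<times> nat \<Rightarrow> 's). \<lambda>k\<in>K. y (ghost_swap E k))"
  have swK: "ghost_swap E k \<in> K" if "k \<in> K" for E k using that by (auto simp: K_def ghost_swap_def)
  have fst_sw: "fst (ghost_swap E k) = fst k" for E and k :: "nat \<times> nat" by (simp add: ghost_swap_def)
  have inj: "inj_on (ghost_swap E) K" for E
    by (rule inj_onI) (auto simp: ghost_swap_def prod_eq_iff split: if_splits)
  have distr_sw: "distr \<Omega> \<Omega> (sw E) = \<Omega>" for E
    using distr_PiM_reindex[of K "\<lambda>k. \<nu> (fst k)" "ghost_swap E" K] prob inj[of E] swK[of _ E]
    unfolding \<Omega>_def sw_def by (simp add: fst_sw Pi_def)
  have m_sw: "sw E \<in> measurable \<Omega> \<Omega>" for E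
    unfolding sw_def \<Omega>_def
  proof (rule measurable_restrict)
    fix k assume "k \<in> K"
    then show "(\<lambda>y. y (ghost_swap E k)) \<in> (\<Pi>\<^sub>M k\<in>K. \<nu> (fst k)) \<rightarrow>\<^sub>M \<nu> (fst k)"
      using measurable_component_singleton[of "ghost_swap E k" K "\<lambda>k. \<nu> (fst k)"] swK[of k E] by (simp add: fst_sw)
  qed
  have swap_int: "(\<integral>\<^sup>+y. \<Phi> (sw E y) \<partial>\<Omega>) = (\<integral>\<^sup>+y. \<Phi> y \<partial>\<Omega>)" for E
    using nn_integral_distr[OF m_sw[of E], of \<Phi>] \<Phi>_meas by (simp add: distr_sw)
  have gs: "ghost_term l g (sw E y) i = ghost_term l g (y \<circ> ghost_swap E) i" if "i \<in> N" for g E y i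
    using that by (simp add: ghost_term_def sw_def K_def)
  have point: "(\<Sum>E\<in>Pow N. \<Phi> (sw E y)) \<le> ennreal (2 ^ card N * (exp 1 * B))" if y: "y \<in> space \<Omega>" for y
  proof -
    have yS: "y \<in> K \<rightarrow> space S" using y by (auto simp: \<Omega>_def space_PiM PiE_def Pi_def space\<nu>)
    \<comment> \<open>A swap only permutes the points \<open>y k\<close>, so one net at the
      unswapped points serves all swaps. The sum over swaps can then be taken separately for each
      net element.\<close>
    obtain C where C: "finite C" "real (card C) \<le> B" "\<And>c z. c \<in> C \<Longrightarrow> \<bar>c z\<bar> \<le> (1::real)"
      and net: "\<And>g. g \<in> \<G> \<Longrightarrow> \<exists>c\<in>C. \<forall>k\<in>K. \<bar>g (y k) - c (y k)\<bar> \<le> sqrt (real (card K)) * \<epsilon>"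
      using VC_class_finite_net[OF VC K(1,2) yS \<epsilon>] unfolding B_def by metis
    define \<eta> where "\<eta> = sqrt (3 * real (card N)) * \<epsilon>"
    have \<eta>: "0 \<le> \<eta>" "real (card N) * \<eta> \<le> 1" using small \<epsilon> by (auto simp: \<eta>_def)
    have bd: "\<Phi> (sw E y) \<le> ennreal (\<Sum>c\<in>C. exp 1 * exp (\<Sum>i\<in>N. ghost_term l c (y \<circ> ghost_swap E) i))" for E
      unfolding \<Phi>_def
    proof (rule SUP_least)
      fix g assume "g \<in> \<G>0"
      then have g: "g \<in> \<G>" using \<G>0 by auto
      obtain c where c: "c \<in> C" "\<And>k. k \<in> K \<Longrightarrow> \<bar>g (y k) - c (y k)\<bar> \<le> \<eta>"
        using net[OF g] K(3) unfolding \<eta>_def by auto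
      have "ghost_term l g (y \<circ> ghost_swap E) i \<le> ghost_term l c (y \<circ> ghost_swap E) i + \<eta>" if "i \<in> N" for i
      proof (rule ghost_term_close[OF l \<eta>(1)])
        fix a :: nat assume "a \<in> {0, 1, 2}"
        then have k: "ghost_swap E (i, a) \<in> K" using that by (intro swK) (auto simp: K_def)
        show "\<bar>g ((y \<circ> ghost_swap E) (i, a)) - c ((y \<circ> ghost_swap E) (i, a))\<bar> \<le> \<eta>" using c(2)[OF k] by simp
        show "\<bar>g ((y \<circ> ghost_swap E) (i, a))\<bar> \<le> 1" using VC g yS k unfolding VC_class_def by auto
        show "\<bar>c ((y \<circ> ghost_swap E) (i, a))\<bar> \<le> 1" using C(3)[OF c(1)] .
      qed
      then have "(\<Sum>i\<in>N. ghost_term l g (y \<circ> ghost_swap E) i) \<le> (\<Sum>i\<in>N. ghost_term l c (y \<circ> ghost_swap E) i + \<eta>)"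
        by (rule sum_mono)
      also have "\<dots> \<le> 1 + (\<Sum>i\<in>N. ghost_term l c (y \<circ> ghost_swap E) i)" using \<eta>(2) by (simp add: sum.distrib)
      finally have "exp (\<Sum>i\<in>N. ghost_term l g (y \<circ> ghost_swap E) i)
          \<le> exp 1 * exp (\<Sum>i\<in>N. ghost_term l c (y \<circ> ghost_swap E) i)" by (simp add: exp_add[symmetric])
      also have "\<dots> \<le> (\<Sum>c\<in>C. exp 1 * exp (\<Sum>i\<in>N. ghost_term l c (y \<circ> ghost_swap E) i))"
        by (rule member_le_sum[OF c(1)]) (use C(1) in auto)
      finally show "ennreal (exp (\<Sum>i\<in>N. ghost_term l g (sw E y) i))
          \<le> ennreal (\<Sum>c\<in>C. exp 1 * exp (\<Sum>i\<in>N. ghost_term l c (y \<circ> ghost_swap E) i))"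
        by (intro ennreal_leI) (simp add: gs)
    qed
    have "(\<Sum>E\<in>Pow N. \<Phi> (sw E y))
        \<le> (\<Sum>E\<in>Pow N. ennreal (\<Sum>c\<in>C. exp 1 * exp (\<Sum>i\<in>N. ghost_term l c (y \<circ> ghost_swap E) i)))"
      using bd by (intro sum_mono)
    also have "\<dots> = ennreal (\<Sum>E\<in>Pow N. \<Sum>c\<in>C. exp 1 * exp (\<Sum>i\<in>N. ghost_term l c (y \<circ> ghost_swap E) i))"
      by (rule sum_ennreal) (auto intro!: sum_nonneg)
    also have "(\<Sum>E\<in>Pow N. \<Sum>c\<in>C. exp 1 * exp (\<Sum>i\<in>N. ghost_term l c (y \<circ> ghost_swap E) i))
        = (\<Sum>c\<in>C. exp 1 * (\<Sum>E\<in>Pow N. exp (\<Sum>i\<in>N. ghost_term l c (y \<circ> ghost_swap E) i)))"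
      by (subst sum.swap) (simp add: sum_distrib_left)
    also have "\<dots> \<le> (\<Sum>c\<in>C. exp 1 * 2 ^ card N)"
      using C(3) N(1) l by (intro sum_mono mult_left_mono sum_exp_ghost_swap_le) auto
    also have "\<dots> = real (card C) * (exp 1 * 2 ^ card N)" by simp
    also have "\<dots> \<le> B * (exp 1 * 2 ^ card N)" using C(2) by (intro mult_right_mono) auto
    also have "\<dots> = 2 ^ card N * (exp 1 * B)" by simp
    finally show ?thesis by (simp add: ennreal_leI)
  qed
  have "ennreal (2 ^ card N) * (\<integral>\<^sup>+y. \<Phi> y \<partial>\<Omega>) = (\<Sum>E\<in>Pow N. \<integral>\<^sup>+y. \<Phi> (sw E y) \<partial>\<Omega>)"
    by (simp add: swap_int card_Pow N ennreal_power[symmetric])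
  also have "\<dots> = (\<integral>\<^sup>+y. (\<Sum>E\<in>Pow N. \<Phi> (sw E y)) \<partial>\<Omega>)"
    by (rule nn_integral_sum[symmetric]) (rule measurable_compose[OF m_sw \<Phi>_meas])
  also have "\<dots> \<le> (\<integral>\<^sup>+y. ennreal (2 ^ card N * (exp 1 * B)) \<partial>\<Omega>)"
    by (rule nn_integral_mono) (rule point)
  also have "\<dots> = ennreal (2 ^ card N) * ennreal (exp 1 * B)"
    by (simp add: \<Omega>.emeasure_space_1 ennreal_mult B_def)
  finally have "(\<integral>\<^sup>+y. \<Phi> y \<partial>\<Omega>) \<le> ennreal (exp 1 * B)"
    by (subst (asm) ennreal_mult_le_mult_iff) auto
  then show ?thesis unfolding \<Phi>_def \<Omega>_def K_def B_def .
qed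

section \<open>Integrating out the ghost samples and the tail bound\<close>

lemma integral_PiM_component_mult:
  fixes g :: "'a \<Rightarrow> real"
  assumes K: "finite K" "a \<in> K" "b \<in> K" "a \<noteq> b" and prob: "\<And>k. prob_space (M k)"
    and g: "\<And>k. integrable (M k) g"
  shows "(\<integral>y. g (y a) * g (y b) \<partial>(Pi\<^sub>M K M)) = (\<integral>z. g z \<partial>M a) * (\<integral>z. g z \<partial>M b)"
proof -
  interpret product_prob_space M K by (rule product_prob_spaceI) (rule prob)
  define f where "f = (\<lambda>k z. if k = a \<or> k = b then g z else 1)"
  have two: "(\<Prod>k\<in>K. if k = a \<or> k = b then h k else 1) = h a * h b" for h :: "_ \<Rightarrow> real"
  proof -
    have "(\<Prod>k\<in>K. if k = a \<or> k = b then h k else 1) = (\<Prod>k\<in>{a, b}. h k)"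
      using K by (intro prod.mono_neutral_cong_right) auto
    then show ?thesis using K by simp
  qed
  have "(\<integral>y. g (y a) * g (y b) \<partial>(Pi\<^sub>M K M)) = (\<integral>y. (\<Prod>k\<in>K. f k (y k)) \<partial>(Pi\<^sub>M K M))"
    unfolding f_def by (subst two) simp
  also have "\<dots> = (\<Prod>k\<in>K. \<integral>z. f k z \<partial>M k)"
  proof (rule product_integral_prod[OF K(1)])
    fix k
    interpret prob_space "M k" by (rule prob)
    show "integrable (M k) (f k)" using g[of k] by (cases "k = a \<or> k = b") (auto simp: f_def)
  qed
  also have "\<dots> = (\<Prod>k\<in>K. if k = a \<or> k = b then \<integral>z. g z \<partial>M k else 1)"
    by (intro prod.cong refl) (simp add: f_def M.prob_space)
  also have "\<dots> = (\<integral>z. g z \<partial>M a) * (\<integral>z. g z \<partial>M b)" by (rule two)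
  finally show ?thesis .
qed

text \<open>Jensen's inequality for \<open>exp\<close>, with slot 0 fixed and slots 1 and 2
  integrated out. Slot 1 yields the mean, and the squared difference of two independent copies has
  expectation twice the variance, which turns the weight 8 into 16.\<close>

lemma exp_centred_le_ghost_integral:
  fixes \<nu> :: "nat \<Rightarrow> 's measure"
  assumes g: "g \<in> borel_measurable S" "\<And>z. z \<in> space S \<Longrightarrow> \<bar>g z\<bar> \<le> (1::real)"
    and N: "finite N" and prob: "\<And>i. prob_space (\<nu> i)" and sets: "\<And>i. sets (\<nu> i) = sets S"
  shows "ennreal (exp (\<Sum>i\<in>N. l * (g (x (i, 0)) - (\<integral>z. g z \<partial>\<nu> i)) - 16 * l\<^sup>2 * var_of (\<nu> i) g))
    \<le> (\<integral>\<^sup>+y. ennreal (exp (\<Sum>i\<in>N. ghost_term l g (merge (N \<times> {0}) (N \<times> {1, 2}) (x, y)) i))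
          \<partial>(\<Pi>\<^sub>M k\<in>N \<times> {1, 2}. \<nu> (fst k)))"
proof -
  define K where "K = N \<times> {1, 2 :: nat}"
  define R where "R = (\<Pi>\<^sub>M k\<in>K. \<nu> (fst k))"
  define h where "h = (\<lambda>y :: nat \<times> nat \<Rightarrow> 's. \<Sum>i\<in>N. l * (g (x (i, 0)) - g (y (i, 1))) - 8 * l\<^sup>2 * (g (y (i, 1)) - g (y (i, 2)))\<^sup>2)"
  have finK: "finite K" using N by (simp add: K_def)
  interpret R: prob_space R unfolding R_def by (rule prob_space_PiM) (rule prob)
  have space\<nu>: "space (\<nu> i) = space S" for i using sets by (rule sets_eq_imp_space_eq)
  have g\<nu>: "g \<in> borel_measurable (\<nu> i)" for i
    using g(1) measurable_cong_sets[OF sets refl] by blast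
  have int\<nu>: "integrable (\<nu> i) g" "integrable (\<nu> i) (\<lambda>z. (g z)\<^sup>2)" for i
  proof -
    interpret prob_space "\<nu> i" by (rule prob)
    show "integrable (\<nu> i) g"
      by (rule integrable_const_bound[of _ 1]) (use g\<nu> g(2) space\<nu> in auto)
    show "integrable (\<nu> i) (\<lambda>z. (g z)\<^sup>2)"
      by (rule integrable_const_bound[of _ 1]) (use g\<nu> g(2) space\<nu> in \<open>auto simp: abs_square_le_1\<close>)
  qed
  have comp: "(\<lambda>y. y k) \<in> measurable R (\<nu> (fst k))" if "k \<in> K" for k
    unfolding R_def using that by (rule measurable_component_singleton)
  have gm: "(\<lambda>y. g (y k)) \<in> borel_measurable R" if "k \<in> K" for k
    using comp[OF that] g\<nu> by (rule measurable_compose)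
  have gb: "\<bar>g (y k)\<bar> \<le> 1" if "k \<in> K" "y \<in> space R" for k y
    using measurable_space[OF comp[OF that(1)] that(2)] g(2) by (simp add: space\<nu>)
  have E1: "(\<integral>y. q (y k) \<partial>R) = (\<integral>z. q z \<partial>\<nu> (fst k))" if "k \<in> K" "q \<in> borel_measurable S" for k and q :: "'s \<Rightarrow> real"
  proof -
    have "q \<in> borel_measurable (\<nu> (fst k))"
      using that(2) measurable_cong_sets[OF sets refl] by blast
    then show ?thesis
      using integral_distr[OF comp[OF that(1)], of q] distr_PiM_component[of K "\<lambda>k. \<nu> (fst k)" k, OF prob that(1)]
      by (simp add: R_def)
  qed
  have I1: "integrable R (\<lambda>y. g (y k))" if "k \<in> K" for k
    by (rule R.integrable_const_bound[of _ 1]) (use gm gb that in auto)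
  have I2: "integrable R (\<lambda>y. g (y k) * g (y k'))" if "k \<in> K" "k' \<in> K" for k k'
  proof (rule R.integrable_const_bound[of _ 1])
    show "AE y in R. norm (g (y k) * g (y k')) \<le> 1"
    proof (rule AE_I2)
      fix y assume "y \<in> space R"
      then have "\<bar>g (y k)\<bar> * \<bar>g (y k')\<bar> \<le> 1 * 1" using gb that by (intro mult_mono) auto
      then show "norm (g (y k) * g (y k')) \<le> 1" by (simp add: abs_mult)
    qed
  qed (use gm that in auto)
  have Kin: "(i, 1) \<in> K" "(i, 2) \<in> K" if "i \<in> N" for i using that by (auto simp: K_def)
  have sq: "(g (y (i, 1)) - g (y (i, 2)))\<^sup>2
     = g (y (i, 1)) * g (y (i, 1)) + g (y (i, 2)) * g (y (i, 2)) - 2 * (g (y (i, 1)) * g (y (i, 2)))" for y :: "nat \<times> nat \<Rightarrow> 's" and i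
    by (simp add: power2_eq_square algebra_simps)
  have Isq: "integrable R (\<lambda>y. (g (y (i, 1)) - g (y (i, 2)))\<^sup>2)" if "i \<in> N" for i
    unfolding sq using I2 Kin[OF that] by (intro Bochner_Integration.integrable_diff Bochner_Integration.integrable_add integrable_mult_right)
  have Esq: "(\<integral>y. (g (y (i, 1)) - g (y (i, 2)))\<^sup>2 \<partial>R) = 2 * var_of (\<nu> i) g" if i: "i \<in> N" for i
  proof -
    have "(\<integral>y. (g (y (i, 1)) - g (y (i, 2)))\<^sup>2 \<partial>R)
       = (\<integral>y. g (y (i, 1)) * g (y (i, 1)) \<partial>R) + (\<integral>y. g (y (i, 2)) * g (y (i, 2)) \<partial>R)
           - 2 * (\<integral>y. g (y (i, 1)) * g (y (i, 2)) \<partial>R)"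
      unfolding sq using I2 Kin[OF i]
      by (simp add: Bochner_Integration.integral_diff Bochner_Integration.integral_add)
    also have "(\<integral>y. g (y (i, 1)) * g (y (i, 1)) \<partial>R) = (\<integral>z. (g z)\<^sup>2 \<partial>\<nu> i)"
      using E1[OF Kin(1)[OF i], of "\<lambda>z. g z * g z"] g(1) by (simp add: power2_eq_square)
    also have "(\<integral>y. g (y (i, 2)) * g (y (i, 2)) \<partial>R) = (\<integral>z. (g z)\<^sup>2 \<partial>\<nu> i)"
      using E1[OF Kin(2)[OF i], of "\<lambda>z. g z * g z"] g(1) by (simp add: power2_eq_square)
    also have "(\<integral>y. g (y (i, 1)) * g (y (i, 2)) \<partial>R) = (\<integral>z. g z \<partial>\<nu> i) * (\<integral>z. g z \<partial>\<nu> i)"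
      unfolding R_def
      using integral_PiM_component_mult[OF finK Kin[OF i], of "\<lambda>k. \<nu> (fst k)" g] prob int\<nu>(1) by simp
    finally show ?thesis by (simp add: var_of_def power2_eq_square)
  qed
  have Ih: "integrable R h"
    unfolding h_def using I1 Isq Kin
    by (intro Bochner_Integration.integrable_sum Bochner_Integration.integrable_diff integrable_mult_right) auto
  have Eh: "(\<integral>y. h y \<partial>R) = (\<Sum>i\<in>N. l * (g (x (i, 0)) - (\<integral>z. g z \<partial>\<nu> i)) - 16 * l\<^sup>2 * var_of (\<nu> i) g)"
  proof -
    have "(\<integral>y. h y \<partial>R) = (\<Sum>i\<in>N. \<integral>y. l * (g (x (i, 0)) - g (y (i, 1))) - 8 * l\<^sup>2 * (g (y (i, 1)) - g (y (i, 2)))\<^sup>2 \<partial>R)"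
      unfolding h_def using I1 Isq Kin
      by (intro Bochner_Integration.integral_sum Bochner_Integration.integrable_diff integrable_mult_right) auto
    also have "\<dots> = (\<Sum>i\<in>N. l * (g (x (i, 0)) - (\<integral>z. g z \<partial>\<nu> i)) - 16 * l\<^sup>2 * var_of (\<nu> i) g)"
    proof (rule sum.cong[OF refl])
      fix i assume i: "i \<in> N"
      have "(\<integral>y. l * (g (x (i, 0)) - g (y (i, 1))) - 8 * l\<^sup>2 * (g (y (i, 1)) - g (y (i, 2)))\<^sup>2 \<partial>R)
        = l * (g (x (i, 0)) - (\<integral>y. g (y (i, 1)) \<partial>R)) - 8 * l\<^sup>2 * (\<integral>y. (g (y (i, 1)) - g (y (i, 2)))\<^sup>2 \<partial>R)"
        using I1[OF Kin(1)[OF i]] Isq[OF i] by (simp add: R.prob_space)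
      also have "\<dots> = l * (g (x (i, 0)) - (\<integral>z. g z \<partial>\<nu> i)) - 16 * l\<^sup>2 * var_of (\<nu> i) g"
        using E1[OF Kin(1)[OF i] g(1)] Esq[OF i] by simp
      finally show "(\<integral>y. l * (g (x (i, 0)) - g (y (i, 1))) - 8 * l\<^sup>2 * (g (y (i, 1)) - g (y (i, 2)))\<^sup>2 \<partial>R)
        = l * (g (x (i, 0)) - (\<integral>z. g z \<partial>\<nu> i)) - 16 * l\<^sup>2 * var_of (\<nu> i) g" .
    qed
    finally show ?thesis .
  qed
  \<comment> \<open>The penalty only lowers \<open>h\<close>, so dropping it leaves a constant upper
    bound; no lower bound is needed for an exponential.\<close>
  have Ieh: "integrable R (\<lambda>y. exp (h y))"
  proof (rule R.integrable_const_bound)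
    have hm: "h \<in> borel_measurable R" using Ih by simp
    then show "(\<lambda>y. exp (h y)) \<in> borel_measurable R" by simp
    show "AE y in R. norm (exp (h y)) \<le> exp (\<Sum>i\<in>N. \<bar>l\<bar> * (\<bar>g (x (i, 0))\<bar> + 1))"
    proof (rule AE_I2)
      fix y assume y: "y \<in> space R"
      have "h y \<le> (\<Sum>i\<in>N. \<bar>l\<bar> * (\<bar>g (x (i, 0))\<bar> + 1))"
        unfolding h_def
      proof (rule sum_mono)
        fix i assume i: "i \<in> N"
        have "l * (g (x (i, 0)) - g (y (i, 1))) \<le> \<bar>l\<bar> * \<bar>g (x (i, 0)) - g (y (i, 1))\<bar>"
          by (simp add: abs_mult[symmetric])
        also have "\<dots> \<le> \<bar>l\<bar> * (\<bar>g (x (i, 0))\<bar> + 1)"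
          using gb[OF Kin(1)[OF i] y] by (intro mult_left_mono) auto
        finally show "l * (g (x (i, 0)) - g (y (i, 1))) - 8 * l\<^sup>2 * (g (y (i, 1)) - g (y (i, 2)))\<^sup>2
            \<le> \<bar>l\<bar> * (\<bar>g (x (i, 0))\<bar> + 1)" by (smt (verit) mult_nonneg_nonneg zero_le_power2)
      qed
      then show "norm (exp (h y)) \<le> exp (\<Sum>i\<in>N. \<bar>l\<bar> * (\<bar>g (x (i, 0))\<bar> + 1))" by simp
    qed
  qed
  have "exp (\<integral>y. h y \<partial>R) \<le> (\<integral>y. exp (h y) \<partial>R)"
    by (rule R.jensens_inequality[OF Ih _ _ Ieh, where I = UNIV]) (auto simp: exp_convex)
  then have "ennreal (exp (\<integral>y. h y \<partial>R)) \<le> ennreal (\<integral>y. exp (h y) \<partial>R)" by (rule ennreal_leI)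
  also have "\<dots> = (\<integral>\<^sup>+y. ennreal (exp (h y)) \<partial>R)"
    using Ieh by (intro nn_integral_eq_integral[symmetric]) auto
  also have "\<dots> = (\<integral>\<^sup>+y. ennreal (exp (\<Sum>i\<in>N. ghost_term l g (merge (N \<times> {0}) (N \<times> {1, 2}) (x, y)) i)) \<partial>R)"
    by (intro nn_integral_cong arg_cong[where f = ennreal] arg_cong[where f = exp])
       (auto simp: h_def ghost_term_def merge_def intro!: sum.cong)
  finally show ?thesis unfolding Eh unfolding R_def K_def .
qed

text \<open>Jensen is applied to each \<open>g\<close> alone and the supremum is moved under the
  inner integral afterwards, which can only increase the right side. The uniform variance bound
  \<open>s\<close> makes the penalty a constant \<open>a\<close> that leaves the supremum, and
  merging the slots by Tonelli gives the ghost integral.\<close>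

lemma nn_integral_exp_sup_le:
  fixes \<nu> :: "nat \<Rightarrow> 's measure"
  assumes VC: "VC_class S \<G> v A (\<lambda>_. 1)" and \<G>0: "countable \<G>0" "\<G>0 \<subseteq> \<G>"
    and N: "finite N" "N \<noteq> {}" and prob: "\<And>i. prob_space (\<nu> i)" and sets: "\<And>i. sets (\<nu> i) = sets S"
    and var: "\<And>g i. g \<in> \<G>0 \<Longrightarrow> i \<in> N \<Longrightarrow> var_of (\<nu> i) g \<le> s"
    and l: "\<bar>l\<bar> \<le> 1 / 32" and \<epsilon>: "0 < \<epsilon>" "\<epsilon> < 1"
    and small: "real (card N) * (sqrt (3 * real (card N)) * \<epsilon>) \<le> 1"
  shows "(\<integral>\<^sup>+x. (SUP g\<in>\<G>0. ennreal (exp (l * (\<Sum>i\<in>N. g (x i) - (\<integral>z. g z \<partial>\<nu> i))))) \<partial>(Pi\<^sub>M N \<nu>))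
           \<le> ennreal (exp (1 + 16 * l\<^sup>2 * real (card N) * s) * (A / \<epsilon>) powr v)"
proof -
  define M where "M = (\<lambda>k :: nat \<times> nat. \<nu> (fst k))"
  define I where "I = N \<times> {0 :: nat}"
  define J where "J = N \<times> {1, 2 :: nat}"
  define a where "a = 16 * l\<^sup>2 * real (card N) * s"
  define F where "F = (\<lambda>x. SUP g\<in>\<G>0. ennreal (exp (l * (\<Sum>i\<in>N. g (x i) - (\<integral>z. g z \<partial>\<nu> i)))))"
  define \<Phi> where "\<Phi> = (\<lambda>y. SUP g\<in>\<G>0. ennreal (exp (\<Sum>i\<in>N. ghost_term l g y i)))"
  define pr where "pr = (\<lambda>\<omega> :: nat \<times> nat \<Rightarrow> 's. \<lambda>i\<in>N. \<omega> (i, 0))"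
  have IJ: "I \<inter> J = {}" "finite I" "finite J" "I \<union> J = N \<times> {0, 1, 2}"
    using N by (auto simp: I_def J_def)
  interpret product_prob_space M "I \<union> J"
    by (rule product_prob_spaceI) (simp add: M_def prob)
  have mg: "g \<in> borel_measurable S" "\<And>z. z \<in> space S \<Longrightarrow> \<bar>g z\<bar> \<le> 1" if "g \<in> \<G>" for g
    using VC that unfolding VC_class_def pointwise_measurable_def by auto
  have mg\<nu>: "g \<in> borel_measurable (\<nu> i)" if "g \<in> \<G>" for g i
    using mg(1)[OF that] measurable_cong_sets[OF sets refl] by blast
  have F_meas: "F \<in> borel_measurable (Pi\<^sub>M N \<nu>)"
    unfolding F_def
  proof (rule borel_measurable_SUP[OF \<G>0(1)])
    fix g assume "g \<in> \<G>0"
    then have "g \<in> borel_measurable (\<nu> i)" for i using mg\<nu> \<G>0 by auto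
    then have "(\<lambda>x. g (x i)) \<in> borel_measurable (Pi\<^sub>M N \<nu>)" if "i \<in> N" for i
      using that by (intro measurable_compose[OF measurable_component_singleton])
    then show "(\<lambda>x. ennreal (exp (l * (\<Sum>i\<in>N. g (x i) - (\<integral>z. g z \<partial>\<nu> i))))) \<in> borel_measurable (Pi\<^sub>M N \<nu>)"
      by (intro measurable_compose[OF _ measurable_ennreal] measurable_compose[OF _ borel_measurable_exp]
            borel_measurable_times borel_measurable_sum borel_measurable_diff) auto
  qed
  have \<Phi>_meas: "\<Phi> \<in> borel_measurable (Pi\<^sub>M (I \<union> J) M)"
    unfolding \<Phi>_def M_def IJ(4)
  proof (rule borel_measurable_SUP[OF \<G>0(1)])
    fix g assume "g \<in> \<G>0"
    then have "g \<in> borel_measurable S" using mg \<G>0 by auto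
    then show "(\<lambda>y. ennreal (exp (\<Sum>i\<in>N. ghost_term l g y i))) \<in> borel_measurable (\<Pi>\<^sub>M k\<in>N \<times> {0, 1, 2}. \<nu> (fst k))"
      by (intro measurable_compose[OF _ measurable_ennreal] measurable_compose[OF _ borel_measurable_exp]
            borel_measurable_sum borel_measurable_ghost_term) (use sets in auto)
  qed
  have distr_pr: "distr (Pi\<^sub>M I M) (Pi\<^sub>M N \<nu>) pr = Pi\<^sub>M N \<nu>"
    using distr_PiM_reindex[of I M "\<lambda>i. (i, 0)" N] prob
    by (simp add: M_def pr_def I_def inj_on_def Pi_def)
  have m_pr: "pr \<in> measurable (Pi\<^sub>M I M) (Pi\<^sub>M N \<nu>)"
    unfolding pr_def
  proof (rule measurable_restrict)
    fix i assume "i \<in> N"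
    then show "(\<lambda>\<omega>. \<omega> (i, 0)) \<in> Pi\<^sub>M I M \<rightarrow>\<^sub>M \<nu> i"
      using measurable_component_singleton[of "(i, 0)" I M] by (simp add: I_def M_def)
  qed
  have point: "ennreal (exp (- a)) * F (pr x) \<le> (\<integral>\<^sup>+y. \<Phi> (merge I J (x, y)) \<partial>(Pi\<^sub>M J M))" for x
    unfolding F_def SUP_mult_left_ennreal
  proof (rule SUP_least)
    fix g assume g: "g \<in> \<G>0"
    then have g': "g \<in> \<G>" using \<G>0 by auto
    have "ennreal (exp (- a)) * ennreal (exp (l * (\<Sum>i\<in>N. g (pr x i) - (\<integral>z. g z \<partial>\<nu> i))))
       = ennreal (exp (- a + l * (\<Sum>i\<in>N. g (pr x i) - (\<integral>z. g z \<partial>\<nu> i))))"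
      by (simp only: ennreal_mult[symmetric] exp_ge_zero exp_add)
    also have "\<dots> \<le> ennreal (exp (\<Sum>i\<in>N. l * (g (x (i, 0)) - (\<integral>z. g z \<partial>\<nu> i)) - 16 * l\<^sup>2 * var_of (\<nu> i) g))"
    proof -
      have "(\<Sum>i\<in>N. 16 * l\<^sup>2 * var_of (\<nu> i) g) \<le> (\<Sum>i\<in>N. 16 * l\<^sup>2 * s)"
        using var[OF g] by (intro sum_mono mult_left_mono) auto
      also have "\<dots> = a" by (simp add: a_def)
      finally have "(\<Sum>i\<in>N. 16 * l\<^sup>2 * var_of (\<nu> i) g) \<le> a" .
      moreover have "l * (\<Sum>i\<in>N. g (pr x i) - (\<integral>z. g z \<partial>\<nu> i)) = (\<Sum>i\<in>N. l * (g (x (i, 0)) - (\<integral>z. g z \<partial>\<nu> i)))"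
        unfolding sum_distrib_left by (intro sum.cong) (auto simp: pr_def)
      ultimately show ?thesis by (intro ennreal_leI) (simp add: sum_subtractf)
    qed
    also have "\<dots> \<le> (\<integral>\<^sup>+y. ennreal (exp (\<Sum>i\<in>N. ghost_term l g (merge (N \<times> {0}) (N \<times> {1, 2}) (x, y)) i))
          \<partial>(\<Pi>\<^sub>M k\<in>N \<times> {1, 2}. \<nu> (fst k)))"
      by (rule exp_centred_le_ghost_integral[OF mg[OF g'] N(1) prob sets])
    also have "\<dots> \<le> (\<integral>\<^sup>+y. \<Phi> (merge I J (x, y)) \<partial>(Pi\<^sub>M J M))"
      unfolding I_def J_def M_def \<Phi>_def by (intro nn_integral_mono SUP_upper g)
    finally show "ennreal (exp (- a)) * ennreal (exp (l * (\<Sum>i\<in>N. g (pr x i) - (\<integral>z. g z \<partial>\<nu> i))))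
       \<le> (\<integral>\<^sup>+y. \<Phi> (merge I J (x, y)) \<partial>(Pi\<^sub>M J M))" .
  qed
  have "ennreal (exp (- a)) * (\<integral>\<^sup>+x. F x \<partial>(Pi\<^sub>M N \<nu>)) = ennreal (exp (- a)) * (\<integral>\<^sup>+x. F (pr x) \<partial>(Pi\<^sub>M I M))"
    using nn_integral_distr[OF m_pr, of F] F_meas by (simp add: distr_pr)
  also have "\<dots> = (\<integral>\<^sup>+x. ennreal (exp (- a)) * F (pr x) \<partial>(Pi\<^sub>M I M))"
    by (rule nn_integral_cmult[symmetric]) (rule measurable_compose[OF m_pr F_meas])
  also have "\<dots> \<le> (\<integral>\<^sup>+x. \<integral>\<^sup>+y. \<Phi> (merge I J (x, y)) \<partial>(Pi\<^sub>M J M) \<partial>(Pi\<^sub>M I M))"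
    by (rule nn_integral_mono) (rule point)
  also have "\<dots> = (\<integral>\<^sup>+y. \<Phi> y \<partial>(Pi\<^sub>M (I \<union> J) M))"
    by (rule product_nn_integral_fold[symmetric, OF IJ(1-3) \<Phi>_meas])
  also have "\<dots> \<le> ennreal (exp 1 * (A / \<epsilon>) powr v)"
    unfolding IJ(4) M_def \<Phi>_def
    by (rule nn_integral_ghost_term_le[OF VC \<G>0 N prob sets l \<epsilon> small])
  finally have "ennreal (exp a) * (ennreal (exp (- a)) * (\<integral>\<^sup>+x. F x \<partial>(Pi\<^sub>M N \<nu>)))
      \<le> ennreal (exp a) * ennreal (exp 1 * (A / \<epsilon>) powr v)"
    by (rule mult_left_mono) simp
  then have "(\<integral>\<^sup>+x. F x \<partial>(Pi\<^sub>M N \<nu>)) \<le> ennreal (exp a) * ennreal (exp 1 * (A / \<epsilon>) powr v)"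
    by (simp add: mult.assoc[symmetric] ennreal_mult[symmetric] exp_add[symmetric])
  also have "\<dots> = ennreal (exp (1 + a) * (A / \<epsilon>) powr v)"
    by (simp add: ennreal_mult[symmetric] exp_add ac_simps)
  finally show ?thesis unfolding F_def a_def by (simp add: mult.assoc)
qed

text \<open>Markov's inequality for the exponential supremum. The moment bound holds for both signs
  of the parameter, so the cases \<open>l\<close> and \<open>- l\<close> give the two tails and the
  factor 2. Replacing \<open>card N\<close> by \<open>k\<close> makes the bound the same for all
  neighbour sets.\<close>

lemma emeasure_deviation_le:
  fixes \<nu> :: "nat \<Rightarrow> 's measure"
  assumes VC: "VC_class S \<G> v A (\<lambda>_. 1)" and \<G>0: "countable \<G>0" "\<G>0 \<subseteq> \<G>"
    and N: "finite N" "N \<noteq> {}" "card N \<le> k" "k \<le> n"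
    and prob: "\<And>i. prob_space (\<nu> i)" and sets: "\<And>i. sets (\<nu> i) = sets S"
    and var: "\<And>g i. g \<in> \<G>0 \<Longrightarrow> i \<in> N \<Longrightarrow> var_of (\<nu> i) g \<le> s" and s: "0 \<le> s"
    and l: "0 < l" "l \<le> 1 / 32"
  shows "{x \<in> space (Pi\<^sub>M N \<nu>). \<exists>g\<in>\<G>0. t < \<bar>\<Sum>i\<in>N. g (x i) - (\<integral>z. g z \<partial>\<nu> i)\<bar>} \<in> sets (Pi\<^sub>M N \<nu>)"
    and "emeasure (Pi\<^sub>M N \<nu>) {x \<in> space (Pi\<^sub>M N \<nu>). \<exists>g\<in>\<G>0. t < \<bar>\<Sum>i\<in>N. g (x i) - (\<integral>z. g z \<partial>\<nu> i)\<bar>}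
      \<le> ennreal (2 * exp (1 + 16 * l\<^sup>2 * real k * s - l * t) * (2 * (real n)\<^sup>2 * A) powr v)"
proof -
  define D where "D = (\<lambda>(g :: 's \<Rightarrow> real) (x :: nat \<Rightarrow> 's). \<Sum>i\<in>N. g (x i) - (\<integral>z. g z \<partial>\<nu> i))"
  define B where "B = exp (1 + 16 * l\<^sup>2 * real k * s) * (2 * (real n)\<^sup>2 * A) powr v"
  define E where "E = (\<lambda>q. {x \<in> space (Pi\<^sub>M N \<nu>). \<exists>g\<in>\<G>0. l * t < q * D g x})"
  \<comment> \<open>An L2 radius 1 / (2 n^2) over at most 3 n points becomes a pointwise distance of
    at most 1 / n, so the error summed over at most n indices stays below 1.\<close>
  define \<epsilon> where "\<epsilon> = 1 / (2 * (real n)\<^sup>2)"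
  have "card N \<noteq> 0" using N by simp
  then have n: "1 \<le> n" using N by linarith
  have n2: "1 \<le> (real n)\<^sup>2" using n by simp
  have "1 < 2 * (real n)\<^sup>2" using n2 by linarith
  then have \<epsilon>: "0 < \<epsilon>" "\<epsilon> < 1"
    unfolding \<epsilon>_def by (simp_all only: divide_less_eq_1_pos zero_less_divide_1_iff order.strict_trans[OF zero_less_one])
  have small: "real (card N) * (sqrt (3 * real (card N)) * \<epsilon>) \<le> 1"
  proof -
    have "sqrt (3 * real (card N)) \<le> 2 * real n"
    proof (rule real_le_lsqrt)
      have "real (card N) \<le> real n" using N by simp
      moreover have "real n \<le> (real n)\<^sup>2" using n by (simp add: power2_eq_square)
      moreover have "(2 * real n)\<^sup>2 = 4 * (real n)\<^sup>2" by (simp add: power_mult_distrib)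
      ultimately show "3 * real (card N) \<le> (2 * real n)\<^sup>2" using n2 by linarith
    qed simp
    then have "real (card N) * (sqrt (3 * real (card N)) * \<epsilon>) \<le> real n * ((2 * real n) * \<epsilon>)"
      using N \<epsilon> by (intro mult_mono mult_right_mono) auto
    also have "\<dots> = 1" using n by (simp add: \<epsilon>_def power2_eq_square)
    finally show ?thesis .
  qed
  have A\<epsilon>: "A / \<epsilon> = 2 * (real n)\<^sup>2 * A" by (simp add: \<epsilon>_def)
  have mg\<nu>: "g \<in> borel_measurable (\<nu> i)" if "g \<in> \<G>0" for g i
  proof -
    have "g \<in> borel_measurable S"
      using VC that \<G>0 unfolding VC_class_def pointwise_measurable_def by auto
    then show ?thesis using measurable_cong_sets[OF sets refl] by blast
  qed
  have D_meas: "D g \<in> borel_measurable (Pi\<^sub>M N \<nu>)" if "g \<in> \<G>0" for g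
    unfolding D_def using mg\<nu>[OF that]
    by (intro borel_measurable_sum borel_measurable_diff measurable_compose[OF measurable_component_singleton]) auto
  have E_sets: "E q \<in> sets (Pi\<^sub>M N \<nu>)" for q
  proof -
    have "E q = (\<Union>g\<in>\<G>0. {x \<in> space (Pi\<^sub>M N \<nu>). l * t < q * D g x})" by (auto simp: E_def)
    moreover have "{x \<in> space (Pi\<^sub>M N \<nu>). l * t < q * D g x} \<in> sets (Pi\<^sub>M N \<nu>)" if "g \<in> \<G>0" for g
      using D_meas[OF that] by measurable
    ultimately show ?thesis using \<G>0(1) by auto
  qed
  have bound: "emeasure (Pi\<^sub>M N \<nu>) (E q) \<le> ennreal (exp (- (l * t)) * B)" if q: "\<bar>q\<bar> = l" for q
  proof -
    define F where "F = (\<lambda>x. SUP g\<in>\<G>0. ennreal (exp (q * D g x)))"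
    have F_meas: "F \<in> borel_measurable (Pi\<^sub>M N \<nu>)"
      unfolding F_def using D_meas
      by (intro borel_measurable_SUP[OF \<G>0(1)] measurable_compose[OF _ measurable_ennreal]
            measurable_compose[OF _ borel_measurable_exp] borel_measurable_times) auto
    have "emeasure (Pi\<^sub>M N \<nu>) (E q) = (\<integral>\<^sup>+x. indicator (E q) x \<partial>(Pi\<^sub>M N \<nu>))"
      using E_sets by simp
    also have "\<dots> \<le> (\<integral>\<^sup>+x. ennreal (exp (- (l * t))) * F x \<partial>(Pi\<^sub>M N \<nu>))"
    proof (rule nn_integral_mono)
      fix x assume "x \<in> space (Pi\<^sub>M N \<nu>)"
      show "indicator (E q) x \<le> ennreal (exp (- (l * t))) * F x"
      proof (cases "x \<in> E q")
        case True
        then obtain g where g: "g \<in> \<G>0" "l * t < q * D g x" by (auto simp: E_def)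
        have "1 \<le> exp (- (l * t) + q * D g x)" using g by simp
        then have "1 \<le> exp (- (l * t)) * exp (q * D g x)" by (simp only: exp_add)
        then have "1 \<le> ennreal (exp (- (l * t)) * exp (q * D g x))"
          using ennreal_leI[of 1 "exp (- (l * t)) * exp (q * D g x)"] by simp
        also have "\<dots> = ennreal (exp (- (l * t))) * ennreal (exp (q * D g x))" by (simp add: ennreal_mult)
        also have "\<dots> \<le> ennreal (exp (- (l * t))) * F x"
          unfolding F_def using g(1) by (intro mult_left_mono SUP_upper) auto
        finally show ?thesis using True by simp
      qed simp
    qed
    also have "\<dots> = ennreal (exp (- (l * t))) * (\<integral>\<^sup>+x. F x \<partial>(Pi\<^sub>M N \<nu>))"
      by (rule nn_integral_cmult[OF F_meas])
    also have "\<dots> \<le> ennreal (exp (- (l * t))) * ennreal B"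
    proof (rule mult_left_mono)
      have "\<bar>q\<bar> \<le> 1 / 32" using q l by simp
      from nn_integral_exp_sup_le[where \<nu> = \<nu>, OF VC \<G>0 N(1,2) prob sets var this \<epsilon> small]
      have "(\<integral>\<^sup>+x. F x \<partial>(Pi\<^sub>M N \<nu>)) \<le> ennreal (exp (1 + 16 * q\<^sup>2 * real (card N) * s) * (A / \<epsilon>) powr v)"
        unfolding F_def D_def .
      also have "\<dots> \<le> ennreal B"
      proof (rule ennreal_leI)
        have "q\<^sup>2 = l\<^sup>2" using q l by (metis power2_abs)
        moreover have "16 * l\<^sup>2 * real (card N) * s \<le> 16 * l\<^sup>2 * real k * s"
          using N s by (intro mult_right_mono mult_left_mono) auto
        ultimately show "exp (1 + 16 * q\<^sup>2 * real (card N) * s) * (A / \<epsilon>) powr v \<le> B"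
          unfolding B_def A\<epsilon> by (intro mult_right_mono) auto
      qed
      finally show "(\<integral>\<^sup>+x. F x \<partial>(Pi\<^sub>M N \<nu>)) \<le> ennreal B" .
    qed simp
    finally show ?thesis by (simp add: ennreal_mult B_def)
  qed
  have eq: "{x \<in> space (Pi\<^sub>M N \<nu>). \<exists>g\<in>\<G>0. t < \<bar>\<Sum>i\<in>N. g (x i) - (\<integral>z. g z \<partial>\<nu> i)\<bar>} = E l \<union> E (- l)"
  proof -
    have "t < \<bar>d\<bar> \<longleftrightarrow> l * t < l * d \<or> l * t < - l * d" for d
    proof -
      have "t < \<bar>d\<bar> \<longleftrightarrow> t < d \<or> t < - d" by auto
      then show ?thesis using l(1) mult_less_cancel_left_pos[of l t d] mult_less_cancel_left_pos[of l t "- d"] by simp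
    qed
    then show ?thesis unfolding E_def D_def by blast
  qed
  show "{x \<in> space (Pi\<^sub>M N \<nu>). \<exists>g\<in>\<G>0. t < \<bar>\<Sum>i\<in>N. g (x i) - (\<integral>z. g z \<partial>\<nu> i)\<bar>} \<in> sets (Pi\<^sub>M N \<nu>)"
    unfolding eq using E_sets by auto
  have "emeasure (Pi\<^sub>M N \<nu>) (E l \<union> E (- l)) \<le> emeasure (Pi\<^sub>M N \<nu>) (E l) + emeasure (Pi\<^sub>M N \<nu>) (E (- l))"
    by (rule emeasure_subadditive) (rule E_sets)+
  also have "\<dots> \<le> ennreal (exp (- (l * t)) * B) + ennreal (exp (- (l * t)) * B)"
    using l by (intro add_mono bound) auto
  also have "\<dots> = ennreal (2 * (exp (- (l * t)) * B))"
    by (subst ennreal_plus[symmetric]) (auto simp: B_def)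
  also have "2 * (exp (- (l * t)) * B) = 2 * exp (1 + 16 * l\<^sup>2 * real k * s - l * t) * (2 * (real n)\<^sup>2 * A) powr v"
    by (simp add: B_def exp_diff exp_minus field_simps)
  finally show "emeasure (Pi\<^sub>M N \<nu>) {x \<in> space (Pi\<^sub>M N \<nu>). \<exists>g\<in>\<G>0. t < \<bar>\<Sum>i\<in>N. g (x i) - (\<integral>z. g z \<partial>\<nu> i)\<bar>}
      \<le> ennreal (2 * exp (1 + 16 * l\<^sup>2 * real k * s - l * t) * (2 * (real n)\<^sup>2 * A) powr v)"
    unfolding eq .
qed

section \<open>Disintegration of product measures\<close>

text \<open>The right side is the value at \<open>E\<close> of a measure, the mixture over
  \<open>PX\<close> of the laws of (x, y) with y drawn from \<open>\<kappa> x\<close>. Two finite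
  measures that agree on the intersection-stable rectangles agree on the product
  \<sigma>-algebra.\<close>

lemma emeasure_disintegration:
  assumes PX: "prob_space PX" "sets PX = sets X" and \<kappa>: "\<kappa> \<in> X \<rightarrow>\<^sub>M prob_algebra S"
    and P: "sets P = sets (X \<Otimes>\<^sub>M S)"
    and rect: "\<And>B A. B \<in> sets X \<Longrightarrow> A \<in> sets S \<Longrightarrow>
      emeasure P (B \<times> A) = (\<integral>\<^sup>+x. emeasure (\<kappa> x) A * indicator B x \<partial>PX)"
    and E: "E \<in> sets (X \<Otimes>\<^sub>M S)"
  shows "emeasure P E = (\<integral>\<^sup>+x. emeasure (\<kappa> x) (Pair x -` E) \<partial>PX)"
proof -
  define K where "K = (\<lambda>x. distr (\<kappa> x) (X \<Otimes>\<^sub>M S) (Pair x))"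
  have K: "K \<in> X \<rightarrow>\<^sub>M prob_algebra (X \<Otimes>\<^sub>M S)" unfolding K_def using \<kappa> by measurable
  have PXs: "PX \<in> space (prob_algebra X)" using PX by (simp add: space_prob_algebra)
  have spX: "space PX = space X" using PX(2) by (rule sets_eq_imp_space_eq)
  have sets\<kappa>: "sets (\<kappa> x) = sets S" "prob_space (\<kappa> x)" if "x \<in> space X" for x
    using measurable_space[OF \<kappa> that] by (auto simp: space_prob_algebra)
  have EK: "emeasure (K x) F = emeasure (\<kappa> x) (Pair x -` F)" if "x \<in> space X" "F \<in> sets (X \<Otimes>\<^sub>M S)" for x F
  proof -
    have m: "Pair x \<in> \<kappa> x \<rightarrow>\<^sub>M X \<Otimes>\<^sub>M S"
      using that(1) measurable_cong_sets[OF sets\<kappa>(1)[OF that(1)] refl] measurable_Pair1'[OF that(1)] by blast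
    have "Pair x -` F \<inter> space (\<kappa> x) = Pair x -` F"
      using sets.sets_into_space[OF that(2)] sets_eq_imp_space_eq[OF sets\<kappa>(1)[OF that(1)]]
      by (auto simp: space_pair_measure)
    then show ?thesis unfolding K_def using m that(2) by (simp add: emeasure_distr)
  qed
  have bindE: "emeasure (PX \<bind> K) F = (\<integral>\<^sup>+x. emeasure (\<kappa> x) (Pair x -` F) \<partial>PX)" if "F \<in> sets (X \<Otimes>\<^sub>M S)" for F
    using emeasure_bind_prob_algebra[OF PXs K that] EK that spX by (auto intro!: nn_integral_cong)
  have "P = PX \<bind> K"
  proof (rule measure_eqI_generator_eq[where A = "\<lambda>_. space X \<times> space S"])
    show "Int_stable {a \<times> b | a b. a \<in> sets X \<and> b \<in> sets S}" by (rule Int_stable_pair_measure_generator)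
    show "{a \<times> b | a b. a \<in> sets X \<and> b \<in> sets S} \<subseteq> Pow (space X \<times> space S)" by (rule pair_measure_closed)
    show "sets P = sigma_sets (space X \<times> space S) {a \<times> b | a b. a \<in> sets X \<and> b \<in> sets S}"
      using P by (simp add: sets_pair_measure)
    show "sets (PX \<bind> K) = sigma_sets (space X \<times> space S) {a \<times> b | a b. a \<in> sets X \<and> b \<in> sets S}"
      using sets_bind'[OF PXs K] by (simp add: sets_pair_measure)
    show "range (\<lambda>_. space X \<times> space S) \<subseteq> {a \<times> b | a b. a \<in> sets X \<and> b \<in> sets S}" by auto
    show "(\<Union>i::nat. space X \<times> space S) = space X \<times> space S" by auto
  next
    fix F assume "F \<in> {a \<times> b | a b. a \<in> sets X \<and> b \<in> sets S}"
    then obtain B A where F: "F = B \<times> A" "B \<in> sets X" "A \<in> sets S" by auto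
    then show "emeasure P F = emeasure (PX \<bind> K) F"
      by (subst bindE) (auto simp: rect indicator_def intro!: nn_integral_cong)
  next
    have "emeasure P (space X \<times> space S) = (\<integral>\<^sup>+x. emeasure (\<kappa> x) (space S) * indicator (space X) x \<partial>PX)"
      by (rule rect) auto
    also have "\<dots> = (\<integral>\<^sup>+x. 1 \<partial>PX)"
    proof (rule nn_integral_cong)
      fix x assume "x \<in> space PX"
      then have x: "x \<in> space X" by (simp add: spX)
      have "emeasure (\<kappa> x) (space (\<kappa> x)) = 1" using sets\<kappa>(2)[OF x] by (rule prob_space.emeasure_space_1)
      then show "emeasure (\<kappa> x) (space S) * indicator (space X) x = 1"
        using x sets_eq_imp_space_eq[OF sets\<kappa>(1)[OF x]] by simp
    qed
    also have "\<dots> \<noteq> \<infinity>" using prob_space.emeasure_space_1[OF PX(1)] by simp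
    finally show "emeasure P (space X \<times> space S) \<noteq> \<infinity>" .
  qed
  then show ?thesis using bindE[OF E] by simp
qed

text \<open>Measurability of a probability kernel can be tested on an intersection-stable generator.
  On boxes the product measure is a finite product of measurable functions of single
  coordinates.\<close>

lemma measurable_PiM_kernel:
  assumes I: "finite I" and \<kappa>: "\<kappa> \<in> X \<rightarrow>\<^sub>M prob_algebra S"
  shows "(\<lambda>x. \<Pi>\<^sub>M i\<in>I. \<kappa> (x i)) \<in> (\<Pi>\<^sub>M i\<in>I. X) \<rightarrow>\<^sub>M prob_algebra (\<Pi>\<^sub>M i\<in>I. S)"
proof (rule measurable_prob_algebra_generated[OF sets_PiM Int_stable_prod_algebra prod_algebra_sets_into_space])
  have \<kappa>x: "sets (\<kappa> (x i)) = sets S" "prob_space (\<kappa> (x i))" if "x \<in> space (\<Pi>\<^sub>M i\<in>I. X)" "i \<in> I" for x i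
    using measurable_space[OF \<kappa>, of "x i"] that by (auto simp: space_prob_algebra space_PiM)
  show "prob_space (\<Pi>\<^sub>M i\<in>I. \<kappa> (x i))" if "x \<in> space (\<Pi>\<^sub>M i\<in>I. X)" for x
    using \<kappa>x that by (intro prob_space_PiM)
  show "sets (\<Pi>\<^sub>M i\<in>I. \<kappa> (x i)) = sets (\<Pi>\<^sub>M i\<in>I. S)" if "x \<in> space (\<Pi>\<^sub>M i\<in>I. X)" for x
    using \<kappa>x that by (intro sets_PiM_cong) auto
  fix A assume "A \<in> prod_algebra I (\<lambda>i. S)"
  then obtain E where A: "A = Pi\<^sub>E I E" and E: "\<And>i. i \<in> I \<Longrightarrow> E i \<in> sets S"
    by (auto elim!: prod_algebraE_all)
  have eq: "emeasure (\<Pi>\<^sub>M i\<in>I. \<kappa> (x i)) A = (\<Prod>i\<in>I. emeasure (\<kappa> (x i)) (E i))" if x: "x \<in> space (\<Pi>\<^sub>M i\<in>I. X)" for x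
  proof -
    have "E i \<subseteq> space (\<kappa> (x i))" if "i \<in> I" for i
      using sets.sets_into_space[of "E i" "\<kappa> (x i)"] E[OF that] \<kappa>x(1)[OF x that] by auto
    then have "prod_emb I (\<lambda>i. \<kappa> (x i)) I (Pi\<^sub>E I E) = Pi\<^sub>E I E" by (intro prod_emb_id) auto
    then show ?thesis
      using emeasure_PiM_emb[of I "\<lambda>i. \<kappa> (x i)" I E] I \<kappa>x[OF x] E by (simp add: A)
  qed
  have "(\<lambda>x. \<Prod>i\<in>I. emeasure (\<kappa> (x i)) (E i)) \<in> borel_measurable (\<Pi>\<^sub>M i\<in>I. X)"
  proof (rule borel_measurable_prod_ennreal)
    fix i assume i: "i \<in> I"
    have "(\<lambda>x. emeasure (\<kappa> x) (E i)) \<in> borel_measurable X"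
      by (rule measurable_emeasure_kernel[OF measurable_prob_algebraD[OF \<kappa>] E[OF i]])
    then show "(\<lambda>x. emeasure (\<kappa> (x i)) (E i)) \<in> borel_measurable (\<Pi>\<^sub>M i\<in>I. X)"
      using i by (intro measurable_compose[OF measurable_component_singleton])
  qed
  then show "(\<lambda>x. emeasure (\<Pi>\<^sub>M i\<in>I. \<kappa> (x i)) A) \<in> borel_measurable (\<Pi>\<^sub>M i\<in>I. X)"
    by (subst measurable_cong[OF eq])
qed

text \<open>This is the conditional independence of the responses given all covariates. On boxes the
  inner measure is a product over \<open>i\<close>, its integral factorises because the covariates
  are independent, and each factor is the disintegration of one pair; boxes determine the product
  measure.\<close>

lemma emeasure_PiM_disintegration:
  fixes I :: "'i set" and PX :: "'x measure" and S :: "'s measure"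
  assumes I: "finite I"
    and PX: "prob_space PX" "sets PX = sets X" and \<kappa>: "\<kappa> \<in> X \<rightarrow>\<^sub>M prob_algebra S"
    and P: "prob_space P" "sets P = sets (X \<Otimes>\<^sub>M S)"
    and rect: "\<And>B A. B \<in> sets X \<Longrightarrow> A \<in> sets S \<Longrightarrow>
      emeasure P (B \<times> A) = (\<integral>\<^sup>+x. emeasure (\<kappa> x) A * indicator B x \<partial>PX)"
    and E: "E \<in> sets (\<Pi>\<^sub>M i\<in>I. X \<Otimes>\<^sub>M S)"
  shows "emeasure (\<Pi>\<^sub>M i\<in>I. P) E =
    (\<integral>\<^sup>+x. emeasure (\<Pi>\<^sub>M i\<in>I. \<kappa> (x i)) {y \<in> space (\<Pi>\<^sub>M i\<in>I. S). (\<lambda>i\<in>I. (x i, y i)) \<in> E} \<partial>(\<Pi>\<^sub>M i\<in>I. PX))"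
proof -
  define Z where "Z = (\<Pi>\<^sub>M i\<in>I. X \<Otimes>\<^sub>M S)"
  define R where "R = (\<Pi>\<^sub>M i\<in>I. PX)"
  define f where "f = (\<lambda>(x :: 'i \<Rightarrow> 'x) (y :: 'i \<Rightarrow> 's). \<lambda>i\<in>I. (x i, y i))"
  define K where "K = (\<lambda>x. distr (\<Pi>\<^sub>M i\<in>I. \<kappa> (x i)) Z (f x))"
  have setsR: "sets R = sets (\<Pi>\<^sub>M i\<in>I. X)" unfolding R_def using PX by (intro sets_PiM_cong) auto
  have spR: "space R = space (\<Pi>\<^sub>M i\<in>I. X)" using setsR by (rule sets_eq_imp_space_eq)
  have Rs: "R \<in> space (prob_algebra (\<Pi>\<^sub>M i\<in>I. X))"
    unfolding space_prob_algebra using setsR prob_space_PiM[of I "\<lambda>i. PX"] PX by (simp add: R_def)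
  have f: "(\<lambda>(x, y). f x y) \<in> (\<Pi>\<^sub>M i\<in>I. X) \<Otimes>\<^sub>M (\<Pi>\<^sub>M i\<in>I. S) \<rightarrow>\<^sub>M Z"
    unfolding f_def Z_def by measurable
  have fx: "f x \<in> (\<Pi>\<^sub>M i\<in>I. S) \<rightarrow>\<^sub>M Z" if "x \<in> space (\<Pi>\<^sub>M i\<in>I. X)" for x
    using measurable_compose[OF measurable_Pair1'[OF that] f] by simp
  have K: "K \<in> (\<Pi>\<^sub>M i\<in>I. X) \<rightarrow>\<^sub>M prob_algebra Z"
    unfolding K_def by (rule measurable_distr_prob_space2[OF measurable_PiM_kernel[OF I \<kappa>] f])
  have \<kappa>x: "sets (\<kappa> z) = sets S" "prob_space (\<kappa> z)" if "z \<in> space X" for z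
    using measurable_space[OF \<kappa> that] by (auto simp: space_prob_algebra)
  have xi: "x i \<in> space X" if "x \<in> space (\<Pi>\<^sub>M i\<in>I. X)" "i \<in> I" for x i
    using that by (auto simp: space_PiM)
  have EK: "emeasure (K x) F = emeasure (\<Pi>\<^sub>M i\<in>I. \<kappa> (x i)) {y \<in> space (\<Pi>\<^sub>M i\<in>I. S). f x y \<in> F}"
    if x: "x \<in> space (\<Pi>\<^sub>M i\<in>I. X)" and F: "F \<in> sets Z" for x F
  proof -
    have s: "sets (\<Pi>\<^sub>M i\<in>I. \<kappa> (x i)) = sets (\<Pi>\<^sub>M i\<in>I. S)"
      using \<kappa>x xi x by (intro sets_PiM_cong) auto
    have "f x \<in> (\<Pi>\<^sub>M i\<in>I. \<kappa> (x i)) \<rightarrow>\<^sub>M Z"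
      using fx[OF x] measurable_cong_sets[OF s refl] by blast
    moreover have "f x -` F \<inter> space (\<Pi>\<^sub>M i\<in>I. \<kappa> (x i)) = {y \<in> space (\<Pi>\<^sub>M i\<in>I. S). f x y \<in> F}"
      using sets_eq_imp_space_eq[OF s] by auto
    ultimately show ?thesis unfolding K_def using F by (simp add: emeasure_distr)
  qed
  have bindE: "emeasure (R \<bind> K) F = (\<integral>\<^sup>+x. emeasure (\<Pi>\<^sub>M i\<in>I. \<kappa> (x i)) {y \<in> space (\<Pi>\<^sub>M i\<in>I. S). f x y \<in> F} \<partial>R)"
    if "F \<in> sets Z" for F
    using emeasure_bind_prob_algebra[OF Rs K that] EK that spR by (auto intro!: nn_integral_cong)
  interpret P: product_prob_space "\<lambda>i. P" I by (rule product_prob_spaceI) (rule P)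
  interpret PX: product_prob_space "\<lambda>i. PX" I by (rule product_prob_spaceI) (rule PX)
  have "R \<bind> K = (\<Pi>\<^sub>M i\<in>I. P)"
  proof (rule P.PiM_eqI[OF I])
    show "sets (R \<bind> K) = sets (\<Pi>\<^sub>M i\<in>I. P)"
    proof -
      have "sets Z = sets (\<Pi>\<^sub>M i\<in>I. P)" unfolding Z_def using P(2) by (intro sets_PiM_cong) auto
      then show ?thesis using sets_bind'[OF Rs K] by simp
    qed
    fix A assume "\<And>i. i \<in> I \<Longrightarrow> A i \<in> sets P"
    then have A: "\<And>i. i \<in> I \<Longrightarrow> A i \<in> sets (X \<Otimes>\<^sub>M S)" using P(2) by simp
    have "Pi\<^sub>E I A \<in> sets Z" unfolding Z_def using A I by (intro sets_PiM_I_finite)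
    then have "emeasure (R \<bind> K) (Pi\<^sub>E I A)
       = (\<integral>\<^sup>+x. emeasure (\<Pi>\<^sub>M i\<in>I. \<kappa> (x i)) {y \<in> space (\<Pi>\<^sub>M i\<in>I. S). f x y \<in> Pi\<^sub>E I A} \<partial>R)" by (rule bindE)
    also have "\<dots> = (\<integral>\<^sup>+x. (\<Prod>i\<in>I. emeasure (\<kappa> (x i)) (Pair (x i) -` A i)) \<partial>R)"
    proof (rule nn_integral_cong)
      fix x assume "x \<in> space R"
      then have x: "x \<in> space (\<Pi>\<^sub>M i\<in>I. X)" by (simp add: spR)
      have sec: "Pair (x i) -` A i \<in> sets S" if "i \<in> I" for i using A[OF that] by (rule sets_Pair1)
      have "{y \<in> space (\<Pi>\<^sub>M i\<in>I. S). f x y \<in> Pi\<^sub>E I A} = (\<Pi>\<^sub>E i\<in>I. Pair (x i) -` A i)"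
        using sets.sets_into_space[OF sec] by (auto simp: f_def space_PiM PiE_iff extensional_def)
      moreover have "prod_emb I (\<lambda>i. \<kappa> (x i)) I (\<Pi>\<^sub>E i\<in>I. Pair (x i) -` A i) = (\<Pi>\<^sub>E i\<in>I. Pair (x i) -` A i)"
        using sets.sets_into_space[OF sec] sets_eq_imp_space_eq[OF \<kappa>x(1)[OF xi[OF x]]]
        by (intro prod_emb_id) blast
      ultimately show "emeasure (\<Pi>\<^sub>M i\<in>I. \<kappa> (x i)) {y \<in> space (\<Pi>\<^sub>M i\<in>I. S). f x y \<in> Pi\<^sub>E I A}
         = (\<Prod>i\<in>I. emeasure (\<kappa> (x i)) (Pair (x i) -` A i))"
        using emeasure_PiM_emb[of I "\<lambda>i. \<kappa> (x i)" I "\<lambda>i. Pair (x i) -` A i"] I \<kappa>x xi[OF x] sec by simp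
    qed
    also have "\<dots> = (\<Prod>i\<in>I. \<integral>\<^sup>+z. emeasure (\<kappa> z) (Pair z -` A i) \<partial>PX)"
      unfolding R_def
    proof (rule PX.product_nn_integral_prod[OF I])
      fix i assume i: "i \<in> I"
      have eq: "(SIGMA z:space X. Pair z -` A i) = A i"
        using sets.sets_into_space[OF A[OF i]] by (auto simp: space_pair_measure)
      have "(\<lambda>z. emeasure (\<kappa> z) (Pair z -` A i)) \<in> borel_measurable X"
        by (rule emeasure_measurable_subprob_algebra2[OF _ measurable_prob_algebraD[OF \<kappa>]]) (simp add: eq A[OF i])
      then show "(\<lambda>z. emeasure (\<kappa> z) (Pair z -` A i)) \<in> borel_measurable PX"
        using measurable_cong_sets[OF PX(2) refl] by blast
    qed
    also have "\<dots> = (\<Prod>i\<in>I. emeasure P (A i))"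
    proof (rule prod.cong[OF refl])
      fix i assume i: "i \<in> I"
      show "(\<integral>\<^sup>+z. emeasure (\<kappa> z) (Pair z -` A i) \<partial>PX) = emeasure P (A i)"
        by (rule emeasure_disintegration[OF PX \<kappa> P(2) _ A[OF i], symmetric]) (rule rect)
    qed
    finally show "emeasure (R \<bind> K) (Pi\<^sub>E I A) = (\<Prod>i\<in>I. emeasure P (A i))" .
  qed
  then show ?thesis using bindE[of E] E by (simp add: Z_def R_def f_def)
qed

section \<open>The deviation over all neighbour sets\<close>

text \<open>Whether \<open>N\<close> is a neighbour set is decided by the covariates. Conditionally
  on them the deviation bound for the fixed set \<open>N\<close> applies and carries the indicator
  of \<open>AN N\<close>. Summing these indicators under the integral counts only the realised sets,
  at most (1 + 2 n^2)^d, instead of all 2^n subsets.\<close>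

lemma emeasure_neighbour_deviation_le:
  fixes PX :: "(real ^ ('d::{finite,linorder})) measure" and S :: "'s measure"
    and \<kappa> :: "real ^ ('d::{finite,linorder}) \<Rightarrow> 's measure"
  assumes PX: "prob_space PX" "sets PX = sets borel" and \<kappa>: "\<kappa> \<in> borel \<rightarrow>\<^sub>M prob_algebra S"
    and P: "prob_space P" "sets P = sets (borel \<Otimes>\<^sub>M S)"
    and rect: "\<And>B A. B \<in> sets borel \<Longrightarrow> A \<in> sets S \<Longrightarrow>
      emeasure P (B \<times> A) = (\<integral>\<^sup>+x. emeasure (\<kappa> x) A * indicator B x \<partial>PX)"
    and VC: "VC_class S \<G> v A (\<lambda>_. 1)" and \<G>0: "countable \<G>0" "\<G>0 \<subseteq> \<G>"
    and kn: "k \<le> n"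
    and var: "\<And>g x. g \<in> \<G>0 \<Longrightarrow> var_of (\<kappa> x) g \<le> s" and s: "0 \<le> s"
    and l: "0 < l" "l \<le> 1 / 32" and t: "0 \<le> t"
  defines "Bad \<equiv> {z \<in> space (\<Pi>\<^sub>M i\<in>{1..n}. borel \<Otimes>\<^sub>M S). \<exists>x. \<exists>g\<in>\<G>0.
      t < \<bar>\<Sum>i\<in>nn_indices (\<lambda>i. fst (z i)) n k x. g (snd (z i)) - (\<integral>y. g y \<partial>\<kappa> (fst (z i)))\<bar>}"
  shows "Bad \<in> sets (\<Pi>\<^sub>M i\<in>{1..n}. borel \<Otimes>\<^sub>M S)"
    and "emeasure (\<Pi>\<^sub>M i\<in>{1..n}. P) Bad \<le> ennreal ((1 + 2 * (real n)\<^sup>2) ^ CARD('d) *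
      (2 * exp (1 + 16 * l\<^sup>2 * real k * s - l * t) * (2 * (real n)\<^sup>2 * A) powr v))"
proof -
  define I where "I = {1..n}"
  define Z where "Z = (\<Pi>\<^sub>M i\<in>I. (borel :: (real ^ ('d::{finite,linorder})) measure) \<Otimes>\<^sub>M S)"
  define R where "R = (\<Pi>\<^sub>M i\<in>I. PX)"
  define \<rho> where "\<rho> = 2 * exp (1 + 16 * l\<^sup>2 * real k * s - l * t) * (2 * (real n)\<^sup>2 * A) powr v"
  define dev where "dev = (\<lambda>N (x :: nat \<Rightarrow> real ^ ('d::{finite,linorder})) (y :: nat \<Rightarrow> 's) (g :: 's \<Rightarrow> real). \<bar>\<Sum>i\<in>N. g (y i) - (\<integral>u. g u \<partial>\<kappa> (x i))\<bar>)"
  define AN where "AN = (\<lambda>N. {x \<in> space R. \<exists>u. nn_indices x n k u = N})"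
  define BN where "BN = (\<lambda>N. {z \<in> space Z. (\<exists>u. nn_indices (\<lambda>i. fst (z i)) n k u = N) \<and>
      (\<exists>g\<in>\<G>0. t < dev N (\<lambda>i. fst (z i)) (\<lambda>i. snd (z i)) g)})"
  \<comment> \<open>The empty set is left out because its deviation is 0 and cannot exceed
    \<open>t\<close>, whereas the tail bound asks for a nonempty index set.\<close>
  define \<N> where "\<N> = Pow I - {{}}"
  have finI: "finite I" and fin\<N>: "finite \<N>" by (auto simp: I_def \<N>_def)
  have \<kappa>x: "sets (\<kappa> x) = sets S" "prob_space (\<kappa> x)" for x
    using measurable_space[OF \<kappa>, of x] by (auto simp: space_prob_algebra)
  have spX: "space PX = UNIV" using sets_eq_imp_space_eq[OF PX(2)] by simp
  have spR: "space R = (\<Pi>\<^sub>E i\<in>I. UNIV)" by (simp add: R_def space_PiM spX)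
  have mg: "g \<in> borel_measurable S" if "g \<in> \<G>0" for g
    using VC that \<G>0 unfolding VC_class_def pointwise_measurable_def by auto
  have mean: "(\<lambda>x. \<integral>u. g u \<partial>\<kappa> x) \<in> borel_measurable borel" if "g \<in> \<G>0" for g
    using measurable_compose[OF measurable_prob_algebraD[OF \<kappa>] integral_measurable_subprob_algebra[OF mg[OF that]]] .
  have comp: "(\<lambda>z. z i) \<in> Z \<rightarrow>\<^sub>M borel \<Otimes>\<^sub>M S" if "i \<in> I" for i
    unfolding Z_def using that by (rule measurable_component_singleton)
  have AN_sets: "AN N \<in> sets R" for N
    unfolding AN_def
  proof (rule sets_ex_nn_indices)
    fix i assume "i \<in> {1..n}"
    then have "(\<lambda>x. x i) \<in> R \<rightarrow>\<^sub>M PX" unfolding R_def I_def by (intro measurable_component_singleton)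
    then show "(\<lambda>x. x i) \<in> borel_measurable R" using measurable_cong_sets[OF refl PX(2)] by blast
  qed
  have BN_sets: "BN N \<in> sets Z" if "N \<in> \<N>" for N
  proof -
    have 1: "{z \<in> space Z. \<exists>u. nn_indices (\<lambda>i. fst (z i)) n k u = N} \<in> sets Z"
    proof (rule sets_ex_nn_indices)
      fix i assume "i \<in> {1..n}"
      then show "(\<lambda>z. fst (z i)) \<in> borel_measurable Z"
        using comp[of i] by (intro measurable_compose[OF _ measurable_fst]) (auto simp: I_def)
    qed
    have "{z \<in> space Z. t < dev N (\<lambda>i. fst (z i)) (\<lambda>i. snd (z i)) g} \<in> sets Z" if g: "g \<in> \<G>0" for g
    proof -
      have "(\<lambda>z. g (snd (z i)) - (\<integral>u. g u \<partial>\<kappa> (fst (z i)))) \<in> borel_measurable Z" if "i \<in> N" for i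
      proof -
        have i: "i \<in> I" using that \<open>N \<in> \<N>\<close> by (auto simp: \<N>_def)
        have "(\<lambda>z. g (snd (z i))) \<in> borel_measurable Z"
          using measurable_compose[OF measurable_compose[OF comp[OF i] measurable_snd] mg[OF g]] .
        moreover have "(\<lambda>z. \<integral>u. g u \<partial>\<kappa> (fst (z i))) \<in> borel_measurable Z"
          using measurable_compose[OF measurable_compose[OF comp[OF i] measurable_fst] mean[OF g]] .
        ultimately show ?thesis by (rule borel_measurable_diff)
      qed
      then have [measurable]: "(\<lambda>z. \<Sum>i\<in>N. g (snd (z i)) - (\<integral>u. g u \<partial>\<kappa> (fst (z i)))) \<in> borel_measurable Z"
        by (rule borel_measurable_sum)
      show ?thesis unfolding dev_def by measurable
    qed
    then have 2: "(\<Union>g\<in>\<G>0. {z \<in> space Z. t < dev N (\<lambda>i. fst (z i)) (\<lambda>i. snd (z i)) g}) \<in> sets Z"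
      using \<G>0(1) by auto
    have "BN N = {z \<in> space Z. \<exists>u. nn_indices (\<lambda>i. fst (z i)) n k u = N} \<inter>
        (\<Union>g\<in>\<G>0. {z \<in> space Z. t < dev N (\<lambda>i. fst (z i)) (\<lambda>i. snd (z i)) g})"
      by (auto simp: BN_def)
    then show ?thesis using sets.Int[OF 1 2] by simp
  qed
  have Bad_iff: "z \<in> Bad \<longleftrightarrow> z \<in> space Z \<and> (\<exists>u. \<exists>g\<in>\<G>0.
      t < dev (nn_indices (\<lambda>i. fst (z i)) n k u) (\<lambda>i. fst (z i)) (\<lambda>i. snd (z i)) g)" for z
    by (simp add: Bad_def Z_def I_def dev_def)
  have Bad_eq: "Bad = (\<Union>N\<in>\<N>. BN N)"
  proof (intro equalityI subsetI)
    fix z assume "z \<in> Bad"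
    then obtain u g where z: "z \<in> space Z" "g \<in> \<G>0"
      "t < dev (nn_indices (\<lambda>i. fst (z i)) n k u) (\<lambda>i. fst (z i)) (\<lambda>i. snd (z i)) g"
      unfolding Bad_iff by blast
    have "nn_indices (\<lambda>i. fst (z i)) n k u \<noteq> {}" using z(3) t by (auto simp: dev_def)
    then have "nn_indices (\<lambda>i. fst (z i)) n k u \<in> \<N>"
      using nn_indices_subset[of "\<lambda>i. fst (z i)" n k u] by (simp add: \<N>_def I_def)
    moreover have "z \<in> BN (nn_indices (\<lambda>i. fst (z i)) n k u)"
      unfolding BN_def using z by blast
    ultimately show "z \<in> (\<Union>N\<in>\<N>. BN N)" by (rule UN_I)
  next
    fix z assume "z \<in> (\<Union>N\<in>\<N>. BN N)"
    then obtain N where "z \<in> BN N" by (rule UN_E)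
    then show "z \<in> Bad" unfolding BN_def Bad_iff by blast
  qed
  show "Bad \<in> sets (\<Pi>\<^sub>M i\<in>{1..n}. borel \<Otimes>\<^sub>M S)"
    unfolding Bad_eq using BN_sets fin\<N> by (auto simp: Z_def I_def)
  \<comment> \<open>Off \<open>AN N\<close> the section is empty. On \<open>AN N\<close> the
    neighbour condition holds for every \<open>y\<close>, and what remains depends only on the
    coordinates in \<open>N\<close>, so the product over \<open>I\<close> is restricted to
    \<open>N\<close>.\<close>
  have inner: "emeasure (\<Pi>\<^sub>M i\<in>I. \<kappa> (x i)) {y \<in> space (\<Pi>\<^sub>M i\<in>I. S). (\<lambda>i\<in>I. (x i, y i)) \<in> BN N}
      \<le> ennreal \<rho> * indicator (AN N) x" if N: "N \<in> \<N>" and x: "x \<in> space R" for N x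
  proof -
    have nn: "nn_indices (\<lambda>i. fst ((\<lambda>i\<in>I. (x i, y i)) i)) n k u = nn_indices x n k u" for y :: "nat \<Rightarrow> 's" and u
      by (rule nn_indices_cong) (simp add: I_def)
    have NI: "N \<subseteq> I" "N \<noteq> {}" using N by (auto simp: \<N>_def)
    have dev: "dev N (\<lambda>i. fst ((\<lambda>i\<in>I. (x i, y i)) i)) (\<lambda>i. snd ((\<lambda>i\<in>I. (x i, y i)) i)) g = dev N x y g" for y g
      unfolding dev_def using NI by (intro arg_cong[where f = abs] sum.cong) auto
    have insp: "(\<lambda>i\<in>I. (x i, y i)) \<in> space Z" if "y \<in> space (\<Pi>\<^sub>M i\<in>I. S)" for y
      using that by (auto simp: Z_def space_PiM space_pair_measure)
    have BN_iff: "(\<lambda>i\<in>I. (x i, y i)) \<in> BN N \<longleftrightarrow> (\<exists>u. nn_indices x n k u = N) \<and> (\<exists>g\<in>\<G>0. t < dev N x y g)"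
      if "y \<in> space (\<Pi>\<^sub>M i\<in>I. S)" for y
      unfolding BN_def mem_Collect_eq using insp[OF that] by (simp only: nn dev simp_thms)
    show ?thesis
    proof (cases "x \<in> AN N")
      case False
      then have "{y \<in> space (\<Pi>\<^sub>M i\<in>I. S). (\<lambda>i\<in>I. (x i, y i)) \<in> BN N} = {}"
        using x BN_iff by (auto simp: AN_def)
      then show ?thesis by (simp only: emeasure_empty zero_le)
    next
      case True
      then have ex: "\<exists>u. nn_indices x n k u = N" by (simp add: AN_def)
      then have cardN: "card N \<le> k" using card_nn_indices_le by blast
      have finN: "finite N" using NI finI finite_subset by blast
      define \<nu> where "\<nu> = (\<lambda>i. \<kappa> (x i))"
      have \<nu>: "prob_space (\<nu> i)" "sets (\<nu> i) = sets S" for i using \<kappa>x by (auto simp: \<nu>_def)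
      interpret product_prob_space \<nu> I by (rule product_prob_spaceI) (rule \<nu>)
      define D where "D = {y \<in> space (Pi\<^sub>M N \<nu>). \<exists>g\<in>\<G>0. t < \<bar>\<Sum>i\<in>N. g (y i) - (\<integral>u. g u \<partial>\<nu> i)\<bar>}"
      have D: "D \<in> sets (Pi\<^sub>M N \<nu>)" "emeasure (Pi\<^sub>M N \<nu>) D \<le> ennreal \<rho>"
        unfolding D_def \<rho>_def
        by (rule emeasure_deviation_le[OF VC \<G>0 finN NI(2) cardN kn \<nu> _ s l]; simp add: \<nu>_def var)+
      have sp: "space (Pi\<^sub>M I \<nu>) = space (\<Pi>\<^sub>M i\<in>I. S)"
        using \<nu>(2) by (intro sets_eq_imp_space_eq sets_PiM_cong) auto
      have mr: "(\<lambda>y. restrict y N) \<in> Pi\<^sub>M I \<nu> \<rightarrow>\<^sub>M Pi\<^sub>M N \<nu>"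
        using NI(1) by (rule measurable_restrict_subset)
      have "{y \<in> space (\<Pi>\<^sub>M i\<in>I. S). (\<lambda>i\<in>I. (x i, y i)) \<in> BN N} = (\<lambda>y. restrict y N) -` D \<inter> space (Pi\<^sub>M I \<nu>)"
      proof -
        have "(\<lambda>i\<in>I. (x i, y i)) \<in> BN N \<longleftrightarrow> restrict y N \<in> D" if y: "y \<in> space (\<Pi>\<^sub>M i\<in>I. S)" for y
        proof -
          have "restrict y N \<in> space (Pi\<^sub>M N \<nu>)" using measurable_space[OF mr] y sp by blast
          moreover have "(\<Sum>i\<in>N. g (restrict y N i) - (\<integral>u. g u \<partial>\<nu> i)) = (\<Sum>i\<in>N. g (y i) - (\<integral>u. g u \<partial>\<nu> i))" for g :: "'s \<Rightarrow> real"
            by (intro sum.cong) auto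
          ultimately show ?thesis
            using ex unfolding BN_iff[OF y] D_def by (simp add: dev_def \<nu>_def)
        qed
        then show ?thesis using sp by auto
      qed
      moreover have "emeasure (Pi\<^sub>M N \<nu>) D = emeasure (Pi\<^sub>M I \<nu>) ((\<lambda>y. restrict y N) -` D \<inter> space (Pi\<^sub>M I \<nu>))"
        by (subst distr_restrict[OF NI(1) finI]) (rule emeasure_distr[OF mr D(1)])
      ultimately show ?thesis using D(2) True by (simp add: \<nu>_def)
    qed
  qed
  have count: "(\<Sum>N\<in>\<N>. indicator (AN N) x :: ennreal) \<le> ennreal ((1 + 2 * (real n)\<^sup>2) ^ CARD('d))" if x: "x \<in> space R" for x
  proof -
    have "(\<Sum>N\<in>\<N>. indicator (AN N) x :: ennreal) = of_nat (card {N \<in> \<N>. x \<in> AN N})"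
      using fin\<N> by (simp add: indicator_def sum.If_cases Int_def)
    also have "card {N \<in> \<N>. x \<in> AN N} \<le> card (range (nn_indices x n k))"
      by (rule card_mono[OF card_nn_indices_range(1)]) (auto simp: AN_def)
    also have "\<dots> \<le> (1 + 2 * n\<^sup>2) ^ CARD('d)" by (rule card_nn_indices_range(2))
    finally have "(\<Sum>N\<in>\<N>. indicator (AN N) x :: ennreal) \<le> of_nat ((1 + 2 * n\<^sup>2) ^ CARD('d))"
      by (simp only: of_nat_le_iff)
    moreover have "real ((1 + 2 * n\<^sup>2) ^ CARD('d)) = (1 + 2 * (real n)\<^sup>2) ^ CARD('d)" by simp
    ultimately show ?thesis by (simp only: ennreal_of_nat_eq_real_of_nat)
  qed
  have "emeasure (\<Pi>\<^sub>M i\<in>I. P) Bad \<le> (\<Sum>N\<in>\<N>. emeasure (\<Pi>\<^sub>M i\<in>I. P) (BN N))"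
    unfolding Bad_eq
  proof (rule emeasure_subadditive_finite[OF fin\<N>])
    have "sets (\<Pi>\<^sub>M i\<in>I. P) = sets Z" unfolding Z_def using P(2) by (intro sets_PiM_cong) auto
    then show "BN ` \<N> \<subseteq> sets (\<Pi>\<^sub>M i\<in>I. P)" using BN_sets by auto
  qed
  also have "\<dots> = (\<Sum>N\<in>\<N>. \<integral>\<^sup>+x. emeasure (\<Pi>\<^sub>M i\<in>I. \<kappa> (x i)) {y \<in> space (\<Pi>\<^sub>M i\<in>I. S). (\<lambda>i\<in>I. (x i, y i)) \<in> BN N} \<partial>R)"
  proof (rule sum.cong[OF refl])
    fix N assume "N \<in> \<N>"
    show "emeasure (\<Pi>\<^sub>M i\<in>I. P) (BN N)
       = (\<integral>\<^sup>+x. emeasure (\<Pi>\<^sub>M i\<in>I. \<kappa> (x i)) {y \<in> space (\<Pi>\<^sub>M i\<in>I. S). (\<lambda>i\<in>I. (x i, y i)) \<in> BN N} \<partial>R)"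
      unfolding R_def
      by (rule emeasure_PiM_disintegration[OF finI PX \<kappa> P _ BN_sets[OF \<open>N \<in> \<N>\<close>, unfolded Z_def]]) (rule rect)
  qed
  also have "\<dots> \<le> (\<Sum>N\<in>\<N>. \<integral>\<^sup>+x. ennreal \<rho> * indicator (AN N) x \<partial>R)"
    by (intro sum_mono nn_integral_mono inner)
  also have "\<dots> = (\<integral>\<^sup>+x. (\<Sum>N\<in>\<N>. ennreal \<rho> * indicator (AN N) x) \<partial>R)"
    using AN_sets by (intro nn_integral_sum[symmetric]) simp
  also have "\<dots> \<le> (\<integral>\<^sup>+x. ennreal \<rho> * ennreal ((1 + 2 * (real n)\<^sup>2) ^ CARD('d)) \<partial>R)"
    unfolding sum_distrib_left[symmetric] by (intro nn_integral_mono mult_left_mono count) auto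
  also have "\<dots> = ennreal ((1 + 2 * (real n)\<^sup>2) ^ CARD('d) * \<rho>)"
  proof -
    have "prob_space R" unfolding R_def by (rule prob_space_PiM) (rule PX)
    then have "emeasure R (space R) = 1" by (rule prob_space.emeasure_space_1)
    moreover have "0 \<le> \<rho>" by (simp add: \<rho>_def)
    ultimately show ?thesis by (simp add: ennreal_mult mult.commute)
  qed
  finally show "emeasure (\<Pi>\<^sub>M i\<in>{1..n}. P) Bad \<le> ennreal ((1 + 2 * (real n)\<^sup>2) ^ CARD('d) *
      (2 * exp (1 + 16 * l\<^sup>2 * real k * s - l * t) * (2 * (real n)\<^sup>2 * A) powr v))"
    unfolding I_def \<rho>_def .
qed

section \<open>Choice of the exponential parameter and the constants\<close>

text \<open>The exponents d, 1 and v of the three factors, each paid for by exp (2 L), add up to 2 D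
  L with D = d + 1 + v. The threshold \<open>t\<close> makes \<open>l * t\<close> exceed the
  variance term by exactly this amount. The values 90 and 20736 are 2 K1 and 4 K2 for C = 9.\<close>

lemma deviation_threshold:
  fixes A s \<delta> v \<kappa> :: real and n k d :: nat
  assumes A: "1 \<le> A" and n: "1 \<le> n" and k: "1 \<le> k" and s: "0 < s" "s \<le> 1" and \<delta>: "0 < \<delta>" "\<delta> < 1"
    and v: "0 < v" and \<kappa>: "1 \<le> \<kappa>"
  defines "L \<equiv> ln (52 * (exp 1)\<^sup>2 * (A * real n / (s * \<delta>)))"
  obtains l t where "0 < l" "l \<le> 1 / 32" "0 \<le> t"
    "(1 + 2 * (real n)\<^sup>2) ^ d * (2 * exp (1 + 16 * l\<^sup>2 * real k * s\<^sup>2 - l * t) * (2 * (real n)\<^sup>2 * A) powr v) \<le> \<delta>"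
    "t \<le> real k * (90 * sqrt ((real d + 1 + v) * s\<^sup>2 * \<kappa> / real k * L) + 20736 * ((real d + 1 + v) / real k) * L)"
proof -
  define W where "W = 52 * (exp 1)\<^sup>2 * (A * real n / (s * \<delta>))"
  define D where "D = real d + 1 + v"
  have e1: "(1::real) \<le> exp 1" by simp
  have sd: "0 < s * \<delta>" "s * \<delta> \<le> \<delta>" using s \<delta> by (auto simp: mult_le_cancel_right1)
  have An: "1 \<le> A * real n" using mult_mono[OF A, of 1 "real n"] n A by simp
  have W1: "52 * (exp 1)\<^sup>2 * (A * real n) \<le> W * \<delta>"
  proof -
    have "W * (s * \<delta>) = 52 * (exp 1)\<^sup>2 * (A * real n)" using s \<delta> by (simp add: W_def)
    moreover have "W * (s * \<delta>) \<le> W * \<delta>"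
      using sd An by (intro mult_left_mono) (auto simp: W_def)
    ultimately show ?thesis by simp
  qed
  have Wpos: "0 < W" using An sd by (auto simp: W_def)
  have "W * \<delta> \<le> W" using Wpos \<delta> by simp
  moreover have "52 * (A * real n) \<le> 52 * (exp 1)\<^sup>2 * (A * real n)"
    using An one_le_power[OF e1, of 2] by (simp add: mult_le_cancel_right1)
  ultimately have WAn: "52 * (A * real n) \<le> W" using W1 by linarith
  have "1 \<le> W" using WAn An by linarith
  have eL: "exp L = W" unfolding L_def W_def[symmetric] using Wpos by simp
  have e2L: "exp (2 * L) = W\<^sup>2" using eL by (metis exp_double)
  have L: "0 < L"
  proof -
    have "1 < W" using WAn An by linarith
    then show ?thesis unfolding L_def W_def[symmetric] by simp
  qed
  have D: "1 < D" using v by (simp add: D_def)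
  \<comment> \<open>The square root of \<open>r\<close> minimises 2 D L / l + 16 l k s^2 over l > 0;
    \<open>l\<close> is this minimiser, cut off at the largest admissible value 1 / 32.\<close>
  define r where "r = D * L / (8 * (real k * s\<^sup>2))"
  have ks: "0 < real k * s\<^sup>2" using k s by simp
  have r: "0 < r" using D L ks by (simp add: r_def)
  define l where "l = min (1 / 32) (sqrt r)"
  define t where "t = 2 * (D * L) / l + 16 * l * (real k * s\<^sup>2)"
  have l: "0 < l" "l \<le> 1 / 32" using r by (auto simp: l_def)
  have lt: "l * t = 2 * (D * L) + 16 * l\<^sup>2 * real k * s\<^sup>2"
    using l by (simp add: t_def distrib_left power2_eq_square)
  have t: "0 \<le> t" using l D L ks by (simp add: t_def)
  have "(1 + 2 * (real n)\<^sup>2) ^ d * (2 * exp (1 + 16 * l\<^sup>2 * real k * s\<^sup>2 - l * t) * (2 * (real n)\<^sup>2 * A) powr v) \<le> \<delta>"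
  proof -
    have nA: "real n \<le> A * real n" using A n by (simp add: mult_le_cancel_right1)
    have n52: "52 * real n \<le> W" using WAn nA by linarith
    have n1: "1 \<le> (real n)\<^sup>2" using n by simp
    have "(52 * real n)\<^sup>2 \<le> W\<^sup>2" using n52 by (intro power_mono) auto
    then have "2704 * (real n)\<^sup>2 \<le> W\<^sup>2" by (simp add: power_mult_distrib)
    then have 1: "1 + 2 * (real n)\<^sup>2 \<le> exp (2 * L)" using n1 e2L by linarith
    have "(2 * real n) * (A * real n) \<le> W * W"
      using n52 WAn An by (intro mult_mono) auto
    then have 2: "2 * (real n)\<^sup>2 * A \<le> exp (2 * L)" unfolding e2L power2_eq_square by (simp only: ac_simps)
    \<comment> \<open>One more factor exp (2 L), the 1 in d + 1 + v, absorbs both the 2 of the two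
      tails and the e from the net and produces \<delta>.\<close>
    have 3: "2 * exp 1 \<le> \<delta> * exp (2 * L)"
    proof -
      have "2 * exp (1::real) \<le> 52 * (exp 1)\<^sup>2 * 1"
        by (simp add: power2_eq_square) (use exp_ge_add_one_self[of 1] in linarith)
      also have "\<dots> \<le> 52 * (exp 1)\<^sup>2 * (A * real n)" using An by (intro mult_left_mono) auto
      also have "\<dots> \<le> W * \<delta>" by (rule W1)
      also have "\<dots> \<le> W\<^sup>2 * \<delta>" using \<open>1 \<le> W\<close> \<delta> by (simp add: power2_eq_square)
      finally show ?thesis unfolding e2L by (simp only: mult.commute)
    qed
    have "(1 + 2 * (real n)\<^sup>2) ^ d \<le> exp (2 * L) ^ d" using 1 by (intro power_mono) auto
    then have a: "(1 + 2 * (real n)\<^sup>2) ^ d \<le> exp (real d * (2 * L))" by (simp add: exp_of_nat_mult)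
    have "(2 * (real n)\<^sup>2 * A) powr v \<le> exp (2 * L) powr v" using 2 A v by (intro powr_mono2) auto
    then have b: "(2 * (real n)\<^sup>2 * A) powr v \<le> exp (v * (2 * L))" by (simp add: powr_def mult.commute)
    have c: "2 * exp (1 + 16 * l\<^sup>2 * real k * s\<^sup>2 - l * t) = 2 * exp 1 * exp (- (2 * (D * L)))"
      unfolding lt by (simp add: exp_add[symmetric])
    have "(1 + 2 * (real n)\<^sup>2) ^ d * (2 * exp (1 + 16 * l\<^sup>2 * real k * s\<^sup>2 - l * t) * (2 * (real n)\<^sup>2 * A) powr v)
       \<le> exp (real d * (2 * L)) * ((\<delta> * exp (2 * L)) * exp (- (2 * (D * L))) * exp (v * (2 * L)))"
      unfolding c using \<delta> by (intro mult_mono[OF a] mult_mono[OF _ b] mult_right_mono[OF 3]) auto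
    also have "\<dots> = \<delta> * exp (real d * (2 * L) + 2 * L + (- (2 * (D * L))) + v * (2 * L))"
      by (simp only: exp_add mult.assoc mult.left_commute mult.commute)
    also have "real d * (2 * L) + 2 * L + (- (2 * (D * L))) + v * (2 * L) = 0"
      by (simp add: D_def algebra_simps)
    finally show ?thesis by simp
  qed
  moreover have "t \<le> real k * (90 * sqrt (D * s\<^sup>2 * \<kappa> / real k * L) + 20736 * (D / real k) * L)"
  proof -
    define q where "q = real k * sqrt (D * s\<^sup>2 * \<kappa> / real k * L)"
    have rhs: "real k * (90 * sqrt (D * s\<^sup>2 * \<kappa> / real k * L) + 20736 * (D / real k) * L) = 90 * q + 20736 * (D * L)"
      using k by (simp add: q_def distrib_left)
    have DL: "0 < D * L" using D L by simp
    have q0: "0 \<le> q" using D L \<kappa> by (simp add: q_def)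
    show ?thesis
    proof (cases "1 / 32 \<le> sqrt r")
      \<comment> \<open>In the capped regime the variance is small: k s^2 \<le> 128 D L, and both
        summands of \<open>t\<close> are at most 64 D L. This is the linear term of the bound. In
        the other regime the summands are equal and give the square root term.\<close>
      case True
      then have l32: "l = 1 / 32" by (simp add: l_def)
      have "(1 / 32)\<^sup>2 \<le> r" using True r by (simp add: real_le_rsqrt sqrt_ge_absD)
      then have "8 * (real k * s\<^sup>2) \<le> 1024 * (D * L)"
        using k s by (simp add: r_def field_simps power2_eq_square)
      then have "t \<le> 128 * (D * L)" by (simp add: t_def l32)
      then show ?thesis unfolding rhs using q0 DL by linarith
    next
      case False
      then have lr: "l = sqrt r" by (simp add: l_def)
      have l2: "l * l = r" using r by (simp add: lr)
      have "D * L = 8 * (real k * s\<^sup>2) * (l * l)" unfolding l2 using k s by (simp add: r_def)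
      then have "2 * (D * L) / l = 16 * l * (real k * s\<^sup>2)" using l by simp
      then have teq: "t = 32 * (l * (real k * s\<^sup>2))" by (simp add: t_def)
      have "l * (real k * s\<^sup>2) \<le> q"
      proof -
        have "(l * (real k * s\<^sup>2))\<^sup>2 = r * (real k * s\<^sup>2)\<^sup>2" using l2 by (simp add: power2_eq_square)
        also have "\<dots> = (D * L) * (real k * s\<^sup>2) / 8" using k s by (simp add: r_def power2_eq_square)
        also have "\<dots> \<le> (D * L) * (real k * s\<^sup>2) * \<kappa>"
          using mult_left_mono[OF \<kappa>, of "(D * L) * (real k * s\<^sup>2)"] mult_pos_pos[OF DL ks] by linarith
        also have "\<dots> = (real k)\<^sup>2 * (D * s\<^sup>2 * \<kappa> / real k * L)" using k by (simp add: power2_eq_square)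
        also have "\<dots> = q\<^sup>2" using D L \<kappa> by (simp add: q_def power_mult_distrib)
        finally show ?thesis using q0 by (rule power2_le_imp_le)
      qed
      then show ?thesis unfolding rhs teq using q0 DL by linarith
    qed
  qed
  ultimately show ?thesis using that[of l t] l t unfolding D_def by blast
qed

section \<open>Support, conditional variance and a version of the conditional law\<close>

text \<open>The complement of the support is the union of all open null sets, and by the Lindelof
  property countably many of them suffice.\<close>

lemma AE_in_measure_support:
  fixes P :: "'a::second_countable_topology measure"
  assumes "sets P = sets borel"
  shows "AE x in P. x \<in> measure_support P"
proof -
  define F where "F = {U. open U \<and> emeasure P U = 0}"
  obtain F' where F': "F' \<subseteq> F" "countable F'" "\<Union>F' = \<Union>F"
    using Lindelof[of F] by (auto simp: F_def)
  have "\<Union>F' \<in> null_sets P"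
    using F'(1,2) assms by (intro null_sets_UN'[of F' "\<lambda>U. U", simplified]) (auto simp: F_def null_sets_def)
  then show ?thesis
  proof (rule AE_I')
    show "{x \<in> space P. x \<notin> measure_support P} \<subseteq> \<Union>F'"
      unfolding F'(3) by (auto simp: measure_support_def F_def)
  qed
qed

lemma var_of_le_1:
  assumes "prob_space \<nu>" "g \<in> borel_measurable \<nu>" "\<And>y. y \<in> space \<nu> \<Longrightarrow> \<bar>g y\<bar> \<le> 1"
  shows "var_of \<nu> g \<le> 1"
proof -
  interpret prob_space \<nu> by fact
  have "(\<integral>y. (g y)\<^sup>2 \<partial>\<nu>) \<le> 1"
    using assms(2,3) by (intro integral_le_const integrable_const_bound[of _ 1]) (auto simp: abs_square_le_1)
  then show ?thesis unfolding var_of_def using zero_le_power2[of "\<integral>y. g y \<partial>\<nu>"] by linarith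
qed

text \<open>A supremum of reals behaves as a supremum only over a bounded nonempty set. The bound 1
  on each variance supplies boundedness; nonemptiness has to be assumed for the upper
  estimate.\<close>

lemma sup_cond_var_upper:
  assumes "\<G> \<subseteq> borel_measurable S" "\<And>g y. g \<in> \<G> \<Longrightarrow> y \<in> space S \<Longrightarrow> \<bar>g y\<bar> \<le> 1"
  shows "\<And>g x. g \<in> \<G> \<Longrightarrow> x \<in> D \<Longrightarrow> prob_space (\<mu> x) \<Longrightarrow> sets (\<mu> x) = sets S \<Longrightarrow>
      var_of (\<mu> x) g \<le> sup_cond_var S \<G> D \<mu>"
    and "\<G> \<noteq> {} \<Longrightarrow> \<exists>x\<in>D. prob_space (\<mu> x) \<and> sets (\<mu> x) = sets S \<Longrightarrow> sup_cond_var S \<G> D \<mu> \<le> 1"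
proof -
  define I where "I = \<G> \<times> {x \<in> D. prob_space (\<mu> x) \<and> sets (\<mu> x) = sets S}"
  have eq: "sup_cond_var S \<G> D \<mu> = (SUP p\<in>I. var_of (\<mu> (snd p)) (fst p))"
    unfolding sup_cond_var_def I_def case_prod_unfold ..
  have le1: "var_of (\<mu> (snd p)) (fst p) \<le> 1" if "p \<in> I" for p
  proof (rule var_of_le_1)
    have s: "sets (\<mu> (snd p)) = sets S" and G: "fst p \<in> \<G>" and prob: "prob_space (\<mu> (snd p))"
      using that by (simp_all add: I_def mem_Times_iff)
    show "prob_space (\<mu> (snd p))" by (rule prob)
    from G have "fst p \<in> borel_measurable S" using assms(1) by blast
    then show "fst p \<in> borel_measurable (\<mu> (snd p))" using measurable_cong_sets[OF s refl] by blast
    from G show "\<bar>fst p y\<bar> \<le> 1" if "y \<in> space (\<mu> (snd p))" for y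
      using that unfolding sets_eq_imp_space_eq[OF s] by (rule assms(2))
  qed
  show "var_of (\<mu> x) g \<le> sup_cond_var S \<G> D \<mu>"
    if "g \<in> \<G>" "x \<in> D" "prob_space (\<mu> x)" "sets (\<mu> x) = sets S" for g x
  proof -
    have "(g, x) \<in> I" using that by (simp add: I_def)
    moreover have "bdd_above ((\<lambda>p. var_of (\<mu> (snd p)) (fst p)) ` I)"
      using le1 by (rule bdd_aboveI2)
    ultimately have "var_of (\<mu> (snd (g, x))) (fst (g, x)) \<le> (SUP p\<in>I. var_of (\<mu> (snd p)) (fst p))"
      by (rule cSUP_upper)
    then show ?thesis by (simp add: eq)
  qed
  show "sup_cond_var S \<G> D \<mu> \<le> 1"
    if ne: "\<G> \<noteq> {}" "\<exists>x\<in>D. prob_space (\<mu> x) \<and> sets (\<mu> x) = sets S"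
  proof -
    obtain g x where "g \<in> \<G>" "x \<in> D" "prob_space (\<mu> x)" "sets (\<mu> x) = sets S"
      using ne by blast
    then have "(g, x) \<in> I" by (simp add: I_def)
    then have "I \<noteq> {}" by blast
    then show ?thesis unfolding eq using le1 by (rule cSUP_least)
  qed
qed

text \<open>A part of a ball has at most the measure of the ball. The purpose is
  \<open>1 \<le> \<kappa>\<close>, which follows from this together with
  \<open>b \<le> U\<close>.\<close>

lemma lebesgue_density_constant_le_1:
  fixes D :: "'a::euclidean_space set"
  assumes "c * measure lborel (cball x T) \<le> measure lborel (D \<inter> cball x T)" "0 < T"
  shows "c \<le> 1"
proof -
  have pos: "0 < measure lborel (cball x T)" using assms(2) by (rule content_cball_pos)
  have "measure lborel (D \<inter> cball x T) \<le> measure lborel (cball x T)"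
  \<comment> \<open>A set outside the \<sigma>-algebra has \<open>measure\<close> 0 by convention,
    so measurability of the support need not be established.\<close>
  proof (cases "D \<inter> cball x T \<in> sets lborel")
    case True
    then show ?thesis
      by (intro measure_mono_fmeasurable) (use emeasure_lborel_cball_finite[of x T] in \<open>auto intro!: fmeasurableI\<close>)
  qed (simp add: measure_notin_sets)
  then have "c * measure lborel (cball x T) \<le> 1 * measure lborel (cball x T)" using assms(1) by simp
  then show ?thesis using pos by (rule mult_right_le_imp_le)
qed

text \<open>Off the good set the family is replaced by a point mass, which depends on
  \<open>x\<close> only through membership in \<open>G\<close>. The result is a kernel at every
  point, as the disintegration requires.\<close>

lemma measurable_kernel_modification:
  assumes \<mu>: "\<And>A. A \<in> sets S \<Longrightarrow> (\<lambda>x. emeasure (\<mu> x) A) \<in> borel_measurable X"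
    and G: "{x \<in> space X. x \<in> G} \<in> sets X" "\<And>x. x \<in> G \<Longrightarrow> prob_space (\<mu> x) \<and> sets (\<mu> x) = sets S"
    and y: "y \<in> space S"
  shows "(\<lambda>x. if x \<in> G then \<mu> x else return S y) \<in> X \<rightarrow>\<^sub>M prob_algebra S"
proof (rule measurable_prob_algebra_generated[OF sets.sigma_sets_eq[symmetric] sets.Int_stable sets.space_closed])
  fix A assume A: "A \<in> sets S"
  have "(\<lambda>x. if x \<in> G then emeasure (\<mu> x) A else indicator A y) \<in> borel_measurable X"
    using \<mu>[OF A] G(1) by (intro measurable_If) auto
  also have "(\<lambda>x. if x \<in> G then emeasure (\<mu> x) A else indicator A y)
      = (\<lambda>x. emeasure (if x \<in> G then \<mu> x else return S y) A)"
    using A by auto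
  finally show "(\<lambda>x. emeasure (if x \<in> G then \<mu> x else return S y) A) \<in> borel_measurable X" .
next
  fix x
  show "prob_space (if x \<in> G then \<mu> x else return S y)" using G(2)[of x] y by (simp add: prob_space_return)
  show "sets (if x \<in> G then \<mu> x else return S y) = sets S" using G(2)[of x] by simp
qed

(* Index 0 of the sequence is the generic pair (X,Y); the sample consists of indices 1,2,... *)
theorem theorem5:
  fixes M :: "'w measure" and S :: "'s measure"
    and P :: "((real ^ ('d::{finite,linorder})) \<times> 's) measure"
    and X :: "nat \<Rightarrow> 'w \<Rightarrow> real ^ ('d::{finite,linorder})" and Y :: "nat \<Rightarrow> 'w \<Rightarrow> 's"
    and f :: "real ^ ('d::{finite,linorder}) \<Rightarrow> real" and \<mu> :: "real ^ ('d::{finite,linorder}) \<Rightarrow> 's measure"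
    and \<G> :: "('s \<Rightarrow> real) set" and S_X :: "(real ^ ('d::{finite,linorder})) set"
    and c T b U v A \<delta> \<kappa> \<sigma> C K1 K2 V d :: real and n k :: nat
  assumes "prob_space M"
    and "prob_space.indep_vars M (\<lambda>_. borel \<Otimes>\<^sub>M S) (\<lambda>i \<omega>. (X i \<omega>, Y i \<omega>)) UNIV"
    and "\<And>i. distr M (borel \<Otimes>\<^sub>M S) (\<lambda>\<omega>. (X i \<omega>, Y i \<omega>)) = P"
    and "\<And>x. 0 \<le> f x"
    and "distributed M lborel (X 0) (\<lambda>x. ennreal (f x))"
    and "regular_cond_distr M S (X 0) (Y 0) f \<mu>"
    and "S_X = measure_support (distr M borel (X 0))"
    and "0 < c" and "0 < T"
    and "\<And>\<tau> x. 0 < \<tau> \<Longrightarrow> \<tau> \<le> T \<Longrightarrow> x \<in> S_X \<Longrightarrow>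
           c * measure lborel (cball x \<tau>) \<le> measure lborel (S_X \<inter> cball x \<tau>)"
    and "0 < b" and "b \<le> U" and "\<And>x. x \<in> S_X \<Longrightarrow> b \<le> f x \<and> f x \<le> U"
    and "VC_class S \<G> v A (\<lambda>_. 1)"
    and "\<kappa> = U / (c * b)"
    and "\<sigma> = sqrt (sup_cond_var S \<G> S_X \<mu>)" and "0 < \<sigma>"
    and "d = real CARD('d)" and "V = measure lborel (cball (0 :: real ^ ('d::{finite,linorder})) 1)"
    and "C = 9" and "K1 = 5 * C" and "K2 = 64 * C\<^sup>2"
    and "1 \<le> n" and "0 < \<delta>" and "\<delta> < 1" and "1 \<le> k" and "k \<le> n"
    and "8 * d * ln (24 * real n / \<delta>) \<le> real k"
    and "real k \<le> real n * min (2 / (\<sigma>\<^sup>2 * \<kappa>)) (T ^ CARD('d) * b * c * V / 2)"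
  shows "holds_with_prob_ge M (1 - \<delta>) (\<lambda>\<omega>.
     (SUP (g, x) \<in> \<G> \<times> S_X.
        ereal \<bar>(1 / real k) *
          (\<Sum>i \<in> nn_indices (\<lambda>i. X i \<omega>) n k x. g (Y i \<omega>) - (\<integral>y. g y \<partial>\<mu> (X i \<omega>)))\<bar>)
     \<le> ereal (2 * K1 * sqrt ((d + 1 + v) * \<sigma>\<^sup>2 * \<kappa> / real k
                  * ln (52 * (exp 1)\<^sup>2 * (A * real n / (\<sigma> * \<delta>))))
             + 4 * K2 * ((d + 1 + v) / real k)
                  * ln (52 * (exp 1)\<^sup>2 * (A * real n / (\<sigma> * \<delta>)))))"
proof -
  note M = assms(1) and indep = assms(2) and law = assms(3) and dens = assms(5) and rcd = assms(6)
    and S_X = assms(7) and VC = assms(14)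
  interpret M: prob_space M by (rule M)
  define bnd where "bnd = 2 * K1 * sqrt ((d + 1 + v) * \<sigma>\<^sup>2 * \<kappa> / real k
                  * ln (52 * (exp 1)\<^sup>2 * (A * real n / (\<sigma> * \<delta>))))
             + 4 * K2 * ((d + 1 + v) / real k)
                  * ln (52 * (exp 1)\<^sup>2 * (A * real n / (\<sigma> * \<delta>)))"
  define PX where "PX = distr M borel (X 0)"
  have v: "0 < v" and A: "1 \<le> A" and G_meas: "\<G> \<subseteq> borel_measurable S"
    and G_bd: "\<And>g y. g \<in> \<G> \<Longrightarrow> y \<in> space S \<Longrightarrow> \<bar>g y\<bar> \<le> 1"
    using VC unfolding VC_class_def pointwise_measurable_def by auto
  have "pointwise_measurable S \<G>" using VC by (simp add: VC_class_def)
  then obtain \<G>0 where G0: "countable \<G>0" "\<G>0 \<subseteq> \<G>"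
    and lim: "\<And>g. g \<in> \<G> \<Longrightarrow> \<exists>h. (\<forall>m::nat. h m \<in> \<G>0) \<and> (\<forall>y\<in>space S. (\<lambda>m. h m y) \<longlonglongrightarrow> g y)"
    unfolding pointwise_measurable_def by blast
  have mXY: "(\<lambda>\<omega>. (X i \<omega>, Y i \<omega>)) \<in> M \<rightarrow>\<^sub>M borel \<Otimes>\<^sub>M S" for i
    using indep by (simp add: M.indep_vars_def)
  have mX: "X i \<in> borel_measurable M" and mY: "Y i \<in> M \<rightarrow>\<^sub>M S" for i
    using measurable_compose[OF mXY[of i] measurable_fst] measurable_compose[OF mXY[of i] measurable_snd]
    by simp_all
  have P: "prob_space P" unfolding law[of 0, symmetric] by (rule M.prob_space_distr[OF mXY])
  have sP: "sets P = sets (borel \<Otimes>\<^sub>M S)" unfolding law[of 0, symmetric] by simp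
  have PXi: "distr M borel (X i) = PX" for i
  proof -
    have "distr M borel (X i) = distr P borel fst" for i
      unfolding law[of i, symmetric] by (subst distr_distr[OF measurable_fst mXY]) (simp add: comp_def)
    then show ?thesis by (simp add: PX_def)
  qed
  have PX: "prob_space PX" unfolding PX_def by (rule M.prob_space_distr[OF mX])
  have sPX: "sets PX = sets borel" by (simp add: PX_def)
  interpret PX: prob_space PX by (rule PX)
  have PX_dens: "PX = density lborel (\<lambda>x. ennreal (f x))"
  proof -
    have "PX = distr M lborel (X 0)" unfolding PX_def by (rule distr_cong) auto
    then show ?thesis using dens by (simp add: distributed_def)
  qed
  have f_meas: "(\<lambda>x. ennreal (f x)) \<in> borel_measurable lborel"
    using dens by (simp add: distributed_def)
  have \<mu>_meas: "(\<lambda>x. emeasure (\<mu> x) B) \<in> borel_measurable borel" if "B \<in> sets S" for B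
    using rcd that by (simp add: regular_cond_distr_def)
  have "AE x in PX. (prob_space (\<mu> x) \<and> sets (\<mu> x) = sets S) \<and> x \<in> S_X"
    using rcd AE_in_measure_support[OF sPX] unfolding regular_cond_distr_def S_X PX_def by auto
  \<comment> \<open>The exceptional points need not form a measurable set; \<open>N0\<close> is a
    measurable null set containing those where \<open>\<mu>\<close> fails and those outside the
    support.\<close>
  then obtain N0 where N0: "{x \<in> space PX. \<not> ((prob_space (\<mu> x) \<and> sets (\<mu> x) = sets S) \<and> x \<in> S_X)} \<subseteq> N0"
    "emeasure PX N0 = 0" "N0 \<in> sets PX" by (rule AE_E)
  define Good where "Good = - N0"
  have spPX: "space PX = UNIV" by (simp add: PX_def)
  have Good: "prob_space (\<mu> x) \<and> sets (\<mu> x) = sets S" "x \<in> S_X" if "x \<in> Good" for x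
    using N0(1) that spPX by (auto simp: Good_def)
  have Good_sets: "Good \<in> sets borel" "N0 \<in> sets borel" using N0(3) sPX by (auto simp: Good_def)
  have AE_Good: "AE x in PX. x \<in> Good"
    using N0(2,3) by (intro AE_I'[of N0]) (auto simp: Good_def)
  obtain \<omega>0 where "\<omega>0 \<in> space M" using M.not_empty by blast
  define y0 where "y0 = Y 0 \<omega>0"
  have y0: "y0 \<in> space S" using measurable_space[OF mY \<open>\<omega>0 \<in> space M\<close>] by (simp add: y0_def)
  \<comment> \<open>A point mass has variance 0, so the variance bound by \<sigma>^2 holds for the
    modified kernel at every \<open>x\<close>, and not merely on \<open>Good\<close>.\<close>
  define \<nu> where "\<nu> = (\<lambda>x. if x \<in> Good then \<mu> x else return S y0)"
  have \<nu>: "\<nu> \<in> borel \<rightarrow>\<^sub>M prob_algebra S"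
    unfolding \<nu>_def using \<mu>_meas Good(1) Good_sets(1) y0 by (intro measurable_kernel_modification) auto
  have \<nu>x: "sets (\<nu> x) = sets S" "prob_space (\<nu> x)" for x
    using measurable_space[OF \<nu>, of x] by (auto simp: space_prob_algebra)
  have rect: "emeasure P (B \<times> A) = (\<integral>\<^sup>+x. emeasure (\<nu> x) A * indicator B x \<partial>PX)"
    if B: "B \<in> sets borel" and A: "A \<in> sets S" for B A
  proof -
    have "emeasure P (B \<times> A) = emeasure M ((\<lambda>\<omega>. (X 0 \<omega>, Y 0 \<omega>)) -` (B \<times> A) \<inter> space M)"
      unfolding law[of 0, symmetric] by (rule emeasure_distr[OF mXY]) (use A B in auto)
    also have "(\<lambda>\<omega>. (X 0 \<omega>, Y 0 \<omega>)) -` (B \<times> A) \<inter> space M = {\<omega> \<in> space M. Y 0 \<omega> \<in> A \<and> X 0 \<omega> \<in> B}" by auto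
    also have "emeasure M \<dots> = (\<integral>\<^sup>+x\<in>B. (emeasure (\<mu> x) A * ennreal (f x)) \<partial>lborel)"
      using rcd A B unfolding regular_cond_distr_def by blast
    also have "\<dots> = (\<integral>\<^sup>+x. ennreal (f x) * (emeasure (\<mu> x) A * indicator B x) \<partial>lborel)"
      by (intro nn_integral_cong) (simp add: ac_simps)
    also have "\<dots> = (\<integral>\<^sup>+x. emeasure (\<mu> x) A * indicator B x \<partial>PX)"
      unfolding PX_dens using \<mu>_meas[OF A] B by (intro nn_integral_density[symmetric] f_meas) auto
    also have "\<dots> = (\<integral>\<^sup>+x. emeasure (\<nu> x) A * indicator B x \<partial>PX)"
      using AE_Good by (intro nn_integral_cong_AE) (auto simp: \<nu>_def)
    finally show ?thesis .
  qed
  show ?thesis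
  proof (cases "\<G> = {} \<or> S_X = {}")
    \<comment> \<open>The supremum of the empty family in the extended reals is minus infinity, so
      the whole space serves as the event.\<close>
    case True
    then show ?thesis
      using \<open>0 < \<delta>\<close> M.prob_space
      by (auto simp: holds_with_prob_ge_def bot_ereal_def intro!: bexI[of _ "space M"])
  next
    case False
    then obtain xS where xS: "xS \<in> S_X" by auto
    have "c \<le> 1"
      using lebesgue_density_constant_le_1[OF assms(10)[OF \<open>0 < T\<close> order.refl xS] \<open>0 < T\<close>] .
    then have "c * b \<le> 1 * U" using \<open>0 < c\<close> \<open>0 < b\<close> \<open>b \<le> U\<close> by (intro mult_mono) auto
    then have \<kappa>1: "1 \<le> \<kappa>" using \<open>0 < c\<close> \<open>0 < b\<close> by (simp add: \<open>\<kappa> = U / (c * b)\<close>)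
    have "Good \<noteq> {}"
    proof
      assume "Good = {}"
      then have "N0 = UNIV" by (auto simp: Good_def)
      then show False using N0(2) PX.emeasure_space_1 spPX by simp
    qed
    then have ex: "\<exists>x\<in>S_X. prob_space (\<mu> x) \<and> sets (\<mu> x) = sets S" using Good by blast
    define sv where "sv = sup_cond_var S \<G> S_X \<mu>"
    have "sv \<le> 1" unfolding sv_def using False ex G_bd by (intro sup_cond_var_upper(2)[OF G_meas]) auto
    have svp: "0 < sv" using \<open>0 < \<sigma>\<close> by (simp add: assms(16) sv_def)
    have \<sigma>2: "\<sigma>\<^sup>2 = sv" using svp by (simp add: assms(16) sv_def)
    have \<sigma>1: "\<sigma> \<le> 1" using \<open>sv \<le> 1\<close> by (simp add: assms(16) sv_def)
    have var: "var_of (\<nu> x) g \<le> \<sigma>\<^sup>2" if g: "g \<in> \<G>0" for g x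
    proof (cases "x \<in> Good")
      case True
      have "g \<in> \<G>" using g G0(2) by auto
      moreover have "x \<in> S_X" "prob_space (\<mu> x)" "sets (\<mu> x) = sets S" using Good[OF True] by auto
      ultimately have "var_of (\<mu> x) g \<le> sv"
        unfolding sv_def using G_bd by (intro sup_cond_var_upper(1)[OF G_meas])
      then show ?thesis using True by (simp add: \<nu>_def \<sigma>2)
    next
      case False
      have "g \<in> borel_measurable S" using g G0(2) G_meas by auto
      then have "var_of (\<nu> x) g = 0"
        using False y0 by (simp add: \<nu>_def var_of_def integral_return)
      then show ?thesis by simp
    qed
    obtain l t where l: "0 < l" "l \<le> 1 / 32" and t: "0 \<le> t"
      and prob_le: "(1 + 2 * (real n)\<^sup>2) ^ CARD('d) *
        (2 * exp (1 + 16 * l\<^sup>2 * real k * \<sigma>\<^sup>2 - l * t) * (2 * (real n)\<^sup>2 * A) powr v) \<le> \<delta>"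
      and t_le: "t \<le> real k * (90 * sqrt ((real CARD('d) + 1 + v) * \<sigma>\<^sup>2 * \<kappa> / real k
              * ln (52 * (exp 1)\<^sup>2 * (A * real n / (\<sigma> * \<delta>))))
            + 20736 * ((real CARD('d) + 1 + v) / real k) * ln (52 * (exp 1)\<^sup>2 * (A * real n / (\<sigma> * \<delta>))))"
      using deviation_threshold[OF A \<open>1 \<le> n\<close> \<open>1 \<le> k\<close> \<open>0 < \<sigma>\<close> \<sigma>1 \<open>0 < \<delta>\<close> \<open>\<delta> < 1\<close> v \<kappa>1, of "CARD('d)"]
      by metis
    have t_bnd: "t \<le> real k * bnd"
      using t_le by (simp add: bnd_def assms(18) \<open>C = 9\<close> \<open>K1 = 5 * C\<close> \<open>K2 = 64 * C\<^sup>2\<close>)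
    \<comment> \<open>The query point ranges over the whole of Euclidean space, which contains
      \<open>S_X\<close>, and the class is the countable \<open>\<G>0\<close>, which keeps this
      event measurable.\<close>
    define Bad where "Bad = {z \<in> space (\<Pi>\<^sub>M i\<in>{1..n}. borel \<Otimes>\<^sub>M S). \<exists>x. \<exists>g\<in>\<G>0.
      t < \<bar>\<Sum>i\<in>nn_indices (\<lambda>i. fst (z i)) n k x. g (snd (z i)) - (\<integral>y. g y \<partial>\<nu> (fst (z i)))\<bar>}"
    note dev = emeasure_neighbour_deviation_le[OF PX sPX \<nu> P sP _ VC G0 \<open>k \<le> n\<close> _ _ l t, of "\<sigma>\<^sup>2"]
    have Bad_sets: "Bad \<in> sets (\<Pi>\<^sub>M i\<in>{1..n}. borel \<Otimes>\<^sub>M S)"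
      unfolding Bad_def by (rule dev(1)) (simp_all add: rect var)
    have Bad_le: "emeasure (\<Pi>\<^sub>M i\<in>{1..n}. P) Bad \<le> ennreal \<delta>"
    proof -
      have "emeasure (\<Pi>\<^sub>M i\<in>{1..n}. P) Bad \<le> ennreal ((1 + 2 * (real n)\<^sup>2) ^ CARD('d) *
        (2 * exp (1 + 16 * l\<^sup>2 * real k * \<sigma>\<^sup>2 - l * t) * (2 * (real n)\<^sup>2 * A) powr v))"
        unfolding Bad_def by (rule dev(2)) (simp_all add: rect var)
      also have "\<dots> \<le> ennreal \<delta>" using prob_le by (rule ennreal_leI)
      finally show ?thesis .
    qed
    define Z where "Z = (\<lambda>\<omega>. \<lambda>i\<in>{1..n}. (X i \<omega>, Y i \<omega>))"
    have mZ: "Z \<in> M \<rightarrow>\<^sub>M (\<Pi>\<^sub>M i\<in>{1..n}. borel \<Otimes>\<^sub>M S)"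
      unfolding Z_def using mXY by (intro measurable_restrict)
    have distr_Z: "distr M (\<Pi>\<^sub>M i\<in>{1..n}. borel \<Otimes>\<^sub>M S) Z = (\<Pi>\<^sub>M i\<in>{1..n}. P)"
    proof -
      have "M.indep_vars (\<lambda>_. borel \<Otimes>\<^sub>M S) (\<lambda>i \<omega>. (X i \<omega>, Y i \<omega>)) {1..n}"
        using indep by (rule M.indep_vars_subset) auto
      then show ?thesis
        using M.indep_vars_iff_distr_eq_PiM'[of "{1..n}" "\<lambda>i \<omega>. (X i \<omega>, Y i \<omega>)" "\<lambda>_. borel \<Otimes>\<^sub>M S"]
          mXY \<open>1 \<le> n\<close> law by (simp add: Z_def)
    qed
    define E where "E = Z -` Bad \<inter> space M"
    have E: "E \<in> sets M" using measurable_sets[OF mZ Bad_sets] by (simp add: E_def)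
    have E_le: "emeasure M E \<le> ennreal \<delta>"
      using Bad_le unfolding distr_Z[symmetric] emeasure_distr[OF mZ Bad_sets] E_def .
    \<comment> \<open>All covariates have the law \<open>PX\<close>, so almost surely none of the n
      sample points hits the null set, and on that event \<open>\<mu>\<close> and
      \<open>\<nu>\<close> agree at the sample.\<close>
    have AE_X: "AE \<omega> in M. \<forall>i\<in>{1..n}. X i \<omega> \<in> Good"
    proof (rule AE_finite_allI)
      fix i
      have "AE x in distr M borel (X i). x \<in> Good" unfolding PXi by (rule AE_Good)
      then show "AE \<omega> in M. X i \<omega> \<in> Good" by (rule AE_distrD[OF mX])
    qed simp
    define H where "H = {\<omega> \<in> space M. \<forall>i\<in>{1..n}. X i \<omega> \<in> Good}"
    have H: "H \<in> sets M"
      unfolding H_def using mX Good_sets(1) by measurable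
    have "M.prob H = 1" unfolding H_def using AE_X H by (intro M.prob_Collect_eq_1[THEN iffD2]) (auto simp: H_def)
    then have "M.prob (H - E) = 1 - M.prob (H \<inter> E)"
      using H E by (simp add: M.finite_measure_Diff')
    moreover have "M.prob (H \<inter> E) \<le> \<delta>"
    proof -
      have "M.prob (H \<inter> E) \<le> M.prob E" using E by (intro M.finite_measure_mono) auto
      also have "\<dots> \<le> \<delta>" using E_le \<open>0 < \<delta>\<close> by (simp add: M.emeasure_eq_measure)
      finally show ?thesis .
    qed
    ultimately have F_prob: "1 - \<delta> \<le> M.prob (H - E)" by simp
    \<comment> \<open>Every \<open>g\<close> is a pointwise limit from \<open>\<G>0\<close>. Its
      means converge by dominated convergence with the constant 1, and the non-strict bound
      \<open>t\<close> on the finite sum survives the limit.\<close>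
    have dev_le: "\<bar>\<Sum>i\<in>nn_indices (\<lambda>i. X i \<omega>) n k x. g (Y i \<omega>) - (\<integral>y. g y \<partial>\<mu> (X i \<omega>))\<bar> \<le> t"
      if \<omega>: "\<omega> \<in> H - E" and g: "g \<in> \<G>" for \<omega> x g
    proof -
      define N where "N = nn_indices (\<lambda>i. X i \<omega>) n k x"
      have \<omega>M: "\<omega> \<in> space M" using \<omega> by (simp add: H_def)
      have N: "i \<in> {1..n}" if "i \<in> N" for i
        using that nn_indices_subset unfolding N_def by blast
      have \<mu>\<nu>: "\<mu> (X i \<omega>) = \<nu> (X i \<omega>)" if "i \<in> N" for i using N[OF that] \<omega> by (simp add: H_def \<nu>_def)
      have nnZ: "nn_indices (\<lambda>i. fst (Z \<omega> i)) n k x = N"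
        unfolding N_def by (rule nn_indices_cong) (simp add: Z_def)
      have "Z \<omega> \<notin> Bad" using \<omega> \<omega>M by (auto simp: E_def)
      have Z_space: "Z \<omega> \<in> space (\<Pi>\<^sub>M i\<in>{1..n}. borel \<Otimes>\<^sub>M S)" using mZ \<omega>M by (rule measurable_space)
      have "\<bar>\<Sum>i\<in>N. q (snd (Z \<omega> i)) - (\<integral>y. q y \<partial>\<nu> (fst (Z \<omega> i)))\<bar> \<le> t" if "q \<in> \<G>0" for q
      proof (rule ccontr)
        assume "\<not> ?thesis"
        then have "t < \<bar>\<Sum>i\<in>nn_indices (\<lambda>i. fst (Z \<omega> i)) n k x.
            q (snd (Z \<omega> i)) - (\<integral>y. q y \<partial>\<nu> (fst (Z \<omega> i)))\<bar>" by (simp add: nnZ)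
        then have "Z \<omega> \<in> Bad"
          unfolding Bad_def mem_Collect_eq
          using that Z_space by (intro conjI exI[of _ x] bexI[of _ q])
        then show False using \<open>Z \<omega> \<notin> Bad\<close> by simp
      qed
      moreover have "(\<Sum>i\<in>N. q (snd (Z \<omega> i)) - (\<integral>y. q y \<partial>\<nu> (fst (Z \<omega> i))))
          = (\<Sum>i\<in>N. q (Y i \<omega>) - (\<integral>y. q y \<partial>\<nu> (X i \<omega>)))" for q :: "'s \<Rightarrow> real"
        by (intro sum.cong refl) (use N in \<open>auto simp: Z_def\<close>)
      ultimately have le: "\<bar>\<Sum>i\<in>N. q (Y i \<omega>) - (\<integral>y. q y \<partial>\<nu> (X i \<omega>))\<bar> \<le> t" if "q \<in> \<G>0" for q
        using that by simp
      obtain h where h: "\<And>m::nat. h m \<in> \<G>0" "\<And>y. y \<in> space S \<Longrightarrow> (\<lambda>m. h m y) \<longlonglongrightarrow> g y"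
        using lim[OF g] by blast
      have "(\<lambda>m. \<integral>y. h m y \<partial>\<nu> z) \<longlonglongrightarrow> (\<integral>y. g y \<partial>\<nu> z)" for z
      proof (rule integral_dominated_convergence[where w = "\<lambda>_. 1"])
        interpret prob_space "\<nu> z" by (rule \<nu>x)
        have sp: "space (\<nu> z) = space S" using \<nu>x(1) by (rule sets_eq_imp_space_eq)
        have bm: "q \<in> borel_measurable (\<nu> z)" if "q \<in> \<G>" for q
          using that G_meas measurable_cong_sets[OF \<nu>x(1) refl] by blast
        show "g \<in> borel_measurable (\<nu> z)" using g by (rule bm)
        show "h m \<in> borel_measurable (\<nu> z)" for m using h(1) G0(2) by (intro bm) auto
        show "integrable (\<nu> z) (\<lambda>_. 1 :: real)" by simp
        show "AE y in \<nu> z. (\<lambda>m. h m y) \<longlonglongrightarrow> g y" using h(2) sp by (intro AE_I2) simp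
        show "AE y in \<nu> z. norm (h m y) \<le> 1" for m using G_bd h(1)[of m] G0(2) sp by (intro AE_I2) auto
      qed
      moreover have "(\<lambda>m. h m (Y i \<omega>)) \<longlonglongrightarrow> g (Y i \<omega>)" for i
        using h(2) measurable_space[OF mY \<omega>M] by simp
      ultimately have "(\<lambda>m. \<bar>\<Sum>i\<in>N. h m (Y i \<omega>) - (\<integral>y. h m y \<partial>\<nu> (X i \<omega>))\<bar>)
          \<longlonglongrightarrow> \<bar>\<Sum>i\<in>N. g (Y i \<omega>) - (\<integral>y. g y \<partial>\<nu> (X i \<omega>))\<bar>"
        by (intro tendsto_rabs tendsto_sum tendsto_diff)
      then have "\<bar>\<Sum>i\<in>N. g (Y i \<omega>) - (\<integral>y. g y \<partial>\<nu> (X i \<omega>))\<bar> \<le> t"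
        using le h(1) by (intro LIMSEQ_le_const2) auto
      then show ?thesis using \<mu>\<nu> unfolding N_def by simp
    qed
    show ?thesis
      unfolding bnd_def[symmetric] holds_with_prob_ge_def
    \<comment> \<open>The measurable set \<open>H - E\<close> witnesses the claim, so the supremum
      over the uncountable family need not itself be measurable.\<close>
    proof (intro bexI[of _ "H - E"] conjI ballI)
      show "H - E \<in> sets M" using H E by auto
      show "1 - \<delta> \<le> M.prob (H - E)" by (rule F_prob)
      fix \<omega> assume \<omega>: "\<omega> \<in> H - E"
      show "(SUP (g, x)\<in>\<G> \<times> S_X. ereal \<bar>1 / real k *
          (\<Sum>i\<in>nn_indices (\<lambda>i. X i \<omega>) n k x. g (Y i \<omega>) - (\<integral>y. g y \<partial>\<mu> (X i \<omega>)))\<bar>) \<le> ereal bnd"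
      proof (rule SUP_least)
        fix p assume "p \<in> \<G> \<times> S_X"
        then obtain g x where p: "p = (g, x)" "g \<in> \<G>" by auto
        define D where "D = (\<Sum>i\<in>nn_indices (\<lambda>i. X i \<omega>) n k x. g (Y i \<omega>) - (\<integral>y. g y \<partial>\<mu> (X i \<omega>)))"
        have "\<bar>D\<bar> \<le> real k * bnd" using dev_le[OF \<omega> p(2), of x] t_bnd unfolding D_def by linarith
        then have "\<bar>1 / real k * D\<bar> \<le> bnd" using \<open>1 \<le> k\<close> by (simp add: abs_mult divide_le_eq mult.commute)
        then show "(case p of (g, x) \<Rightarrow> ereal \<bar>1 / real k *
          (\<Sum>i\<in>nn_indices (\<lambda>i. X i \<omega>) n k x. g (Y i \<omega>) - (\<integral>y. g y \<partial>\<mu> (X i \<omega>)))\<bar>) \<le> ereal bnd"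
          unfolding D_def by (simp add: p)
      qed
    qed
  qed
qed

end
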